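(* Assume conditions $(\mathbf u_\sigma)$, $(\mathbf{fg})$, $(\boldsymbol\partial)$ hold. Let $\tau=(\tau_n)_{n\in\mathbb N}$ be an unbounded monotonically increasing sequence in $\mathbb T$ and let the pair $(x^0,u^0)\in C_{loc}(\mathbb T,\mathbb X)\times\mathfrak U$ be $\tau$-sporadically catching up optimal for the problem of maximizing $\lim_{T\to\infty}J_T(u)$ over $u\in\mathfrak U$. Let $I_*\in\mathbb X$ be the limit of $I_\xi(\tau_n)$ as $n\to\infty$, $\xi\to0_{\mathbb X}$ (joint limit, assumed to exist). Then there exists a unique solution $(x^0,u^0,\lambda^0,\psi^0)\in\mathfrak Z$ (with this $x^0,u^0$) of all relations of the Maximum Principle satisfying the transversality condition $$\liminf_{n\to\infty}\|\psi^0(\tau_n)A_*(\tau_n)\|_{\mathbb X}=0.$$ Moreover, up to a positive factor (i.e. after multiplying the pair $(\lambda^0,\psi^0)$ by a positive constant), $$\lambda^0=1,\qquad \psi^0(T)=\Big(I_*-\int_0^T\frac{\partial g(t,x^0(t),u^0(t))}{\partial x}A_*(t)\,dt\Big)A_*^{-1}(T)\qquad\forall T\in\mathbb T.$$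
   Context: Notation. $\mathbb T=\mathbb R_{\ge0}$, $\mathbb X=\mathbb R^m$, $\mathbb L$ is the space of real $m\times m$ matrices with unit matrix $1_{\mathbb L}$, $\mathbb U$ is a finite-dimensional Euclidean space, $U:\mathbb T\rightsquigarrow\mathbb U$ is a set-valued map with graph $\mathrm{Gr}\,U$, and $\mathfrak U$ is the set of all Borel measurable selectors of $U$. $C_{loc}(\mathbb T,E)$ is the set of continuous functions $\mathbb T\to E$ with the compact-open topology. $\mathcal L^1_{loc}(\mathbb T,\mathbb T)$ is the set of nonnegative locally summable functions on $\mathbb T$. $\Omega$ is the set of continuous $\omega:\mathbb T\to\mathbb T$ with $\lim_{t\to\infty}\omega(t)=0$. A function $a:\mathbb T\times E'\times\mathbb U\to E''$ is called: (1) Carathéodory if $a(\cdot,y,u)$ is measurable for all $y\in E'$ and all $u$ belonging to some $U(t)$, and $a(t,\cdot,\cdot):E'\times U(t)\to E''$ is continuous for all $t\in\mathbb T$; (2) locally Lipschitz continuous if for each compact $K\subset\mathbb T\times E'$ there is $L^a_K\in\mathcal L^1_{loc}(\mathbb T,\mathbb T)$ with $\|a(t,x',u)-a(t,x'',u)\|\le L^a_K(t)\|x'-x''\|$ for all $(t,x'),(t,x'')\in K$, $u\in U(t)$; (3) integrally bounded (on each compact subset) if for each compact $K\subset\mathbb T\times E'$ there is $M^a_K\in\mathcal L^1_{loc}(\mathbb T,\mathbb T)$ with $\|a(t,x,u)\|\le M^a_K(t)$ for all $(t,x)\in K$, $u\in U(t)$; (4) satisfying the continuability condition if it is locally Lipschitz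 continuous with $L^a_K$ independent of $K$ and it is integrally bounded on each compact subset. Condition $(\mathbf u_\sigma)$: $U$ is $\sigma$-compact-valued and $\mathrm{Gr}\,U$ is a Borel subset of $\mathbb T\times\mathbb U$. Together with it, it is assumed that there is a nondecreasing sequence $(U^{(r)})_{r\in\mathbb N}$ of compact-valued maps $\mathbb T\rightsquigarrow\mathbb U$ with Borel graphs, each integrally bounded on each compact subset of $\mathbb T$ (norms of elements of $U^{(r)}(t)$ are dominated by a locally summable function of $t$), such that $U(t)=\bigcup_rU^{(r)}(t)$ for all $t$, and that $u^0(t)\in U^{(1)}(t)$ for all $t$. Condition $(\mathbf{fg})$: $f:\mathbb T\times\mathbb X\times\mathbb U\to\mathbb X$ and $g:\mathbb T\times\mathbb X\times\mathbb U\to\mathbb R$ are locally Lipschitz continuous Carathéodory maps, integrally bounded on each compact subset, and $f$ satisfies the continuability condition. Condition $(\boldsymbol\partial)$: $f$ and $g$ have partial derivatives in $x$ that are locally Lipschitz continuous Carathéodory maps, integrally bounded on each compact subset. For $u\in\mathfrak U$, $\varphi[u]$ is the unique solution on $\mathbb T$ of $\dot x=f(t,x,u(t))$, $x(0)=0$, and $J_T(u)=\int_0^Tg(t,\varphi[u](t),u(t))\,dt$. A control $u^0\in\mathfrak U$ is $\tau$-sporadically catching up optimal, for the unbounded monotonically increasing sequence $\tau=(\tau_n)$, if there is $\omega^0\in\Omega$ such that $J_{\tau_n}(u^0)\ge J_{\tau_n}(u)-\omega^0(\tau_k)$ for all $u\in\mathfrak U$ and all $k,n\in\mathbb N$ with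 $k<n$; the pair $(x^0,u^0)$ with $x^0=\varphi[u^0]$ is then also called so. $\mathcal H(x,t,u,\lambda,\psi)=\psi f(t,x,u)+\lambda g(t,x,u)$ ($\psi$ a row vector). $\mathfrak Z$ is the set of $(x,u,\lambda,\psi)\in C_{loc}(\mathbb T,\mathbb X)\times\mathfrak U\times[0,1]\times C_{loc}(\mathbb T,\mathbb X)$ ($x,\psi$ locally absolutely continuous) with $x(0)=0$, $\|\psi(0)\|_{\mathbb X}+\lambda=1$ and, a.e. on $\mathbb T$: $\dot x=f(t,x,u(t))$, $\dot\psi=-\frac{\partial\mathcal H}{\partial x}(x(t),t,u(t),\lambda,\psi(t))$, $\sup_{p\in U(t)}\mathcal H(x(t),t,p,\lambda,\psi(t))=\mathcal H(x(t),t,u(t),\lambda,\psi(t))$ (the relations of the Maximum Principle). For $\xi\in\mathbb X$, $x_\xi$ is the solution of $\dot x=f(t,x,u^0(t))$, $x(0)=\xi$; $A_\xi:\mathbb T\to\mathbb L$ is the solution of $\dot A_\xi(t)=\frac{\partial f(t,x_\xi(t),u^0(t))}{\partial x}A_\xi(t)$, $A_\xi(0)=1_{\mathbb L}$; $A_*=A_{0_{\mathbb X}}$ (so it corresponds to $x_0=x^0$); and $I_\xi(T)=\int_0^T\frac{\partial g(t,x_\xi(t),u^0(t))}{\partial x}A_\xi(t)\,dt$ (a row vector) for $T\in\mathbb T$. *)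

theory Defs
  imports "HOL-Analysis.Analysis"
begin

text \<open>
  Time is the half-line \<open>{0..}\<close> of \<^typ>\<open>real\<close>; functions of time have type \<open>real \<Rightarrow> 'a\<close>, and only
  their values on \<open>{0..}\<close> are ever constrained or compared. The control space is a Euclidean
  space \<^typ>\<open>'u\<close>, and both column states and row covectors are of type \<^typ>\<open>real ^ 'm\<close>, a covector
  acting on a matrix by \<open>v*\<close>.
\<close>

section \<open>Function classes on the half-line\<close>

definition loc_summable :: "(real \<Rightarrow> real) set" where
  "loc_summable = {L. (\<forall>t\<ge>0. 0 \<le> L t) \<and> (\<forall>T\<ge>0. integrable (lebesgue_on {0..T}) L)}"

definition C_loc :: "(real \<Rightarrow> 'a::topological_space) set" where
  "C_loc = {x. continuous_on {0..} x}"

definition vanishing_functions :: "(real \<Rightarrow> real) set" where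
  "vanishing_functions =
     {\<omega>. continuous_on {0..} \<omega> \<and> (\<forall>t\<ge>0. 0 \<le> \<omega> t) \<and> (\<omega> \<longlongrightarrow> 0) at_top}"

text \<open>
  Since \<open>d division_of \<Union>d\<close> makes \<open>d\<close> a finite set of nonempty, nonoverlapping compact intervals,
  this is the usual \<open>\<epsilon>\<close>-\<open>\<delta>\<close> definition, with \<open>Inf k\<close> and \<open>Sup k\<close> the endpoints of \<open>k\<close>.
\<close>

definition abs_cont_on :: "real set \<Rightarrow> (real \<Rightarrow> 'a::real_normed_vector) \<Rightarrow> bool" where
  "abs_cont_on S x \<longleftrightarrow>
     (\<forall>\<epsilon>>0. \<exists>\<delta>>0. \<forall>d. d division_of \<Union>d \<and> \<Union>d \<subseteq> S \<and> (\<Sum>k\<in>d. Sup k - Inf k) < \<delta>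
        \<longrightarrow> (\<Sum>k\<in>d. norm (x (Sup k) - x (Inf k))) < \<epsilon>)"

definition loc_abs_cont :: "(real \<Rightarrow> 'a::real_normed_vector) \<Rightarrow> bool" where
  "loc_abs_cont x \<longleftrightarrow> (\<forall>T\<ge>0. abs_cont_on {0..T} x)"

definition ode_solution ::
    "(real \<Rightarrow> 'a \<Rightarrow> 'a) \<Rightarrow> 'a \<Rightarrow> (real \<Rightarrow> 'a::real_normed_vector) \<Rightarrow> bool" where
  "ode_solution F x0 x \<longleftrightarrow>
     loc_abs_cont x \<and> x 0 = x0 \<and>
     (AE t in lebesgue_on {0..}. (x has_vector_derivative F t (x t)) (at t))"

section \<open>Conditions on maps of time, state and control\<close>

text \<open>
  Continuity in the control is required only on \<open>U t\<close>, for the same \<open>t\<close>. Hence this notion does not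
  by itself make \<open>t \<mapsto> a t y (u t)\<close> measurable for a measurable selector \<open>u\<close>: take
  \<open>U t = {h t}\<close> with \<open>h\<close> injective, so that each control value occurs at one time only.
\<close>

definition caratheodory ::
    "(real \<Rightarrow> 'u::euclidean_space set) \<Rightarrow>
     (real \<Rightarrow> 'a::euclidean_space \<Rightarrow> 'u \<Rightarrow> 'b::euclidean_space) \<Rightarrow> bool" where
  "caratheodory U a \<longleftrightarrow>
     (\<forall>y. \<forall>v\<in>(\<Union>t\<in>{0..}. U t). (\<lambda>t. a t y v) \<in> borel_measurable (lebesgue_on {0..})) \<and>
     (\<forall>t\<ge>0. continuous_on (UNIV \<times> U t) (\<lambda>(y, v). a t y v))"

definition lipschitz_with ::
    "(real \<Rightarrow> 'u set) \<Rightarrow> (real \<Rightarrow> 'a::euclidean_space \<Rightarrow> 'u \<Rightarrow> 'b::euclidean_space) \<Rightarrow>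
     (real \<times> 'a) set \<Rightarrow> (real \<Rightarrow> real) \<Rightarrow> bool" where
  "lipschitz_with U a K L \<longleftrightarrow>
     (\<forall>t x' x''. \<forall>v\<in>U t. (t, x') \<in> K \<longrightarrow> (t, x'') \<in> K \<longrightarrow>
        norm (a t x' v - a t x'' v) \<le> L t * norm (x' - x''))"

definition locally_lipschitz ::
    "(real \<Rightarrow> 'u set) \<Rightarrow> (real \<Rightarrow> 'a::euclidean_space \<Rightarrow> 'u \<Rightarrow> 'b::euclidean_space) \<Rightarrow> bool" where
  "locally_lipschitz U a \<longleftrightarrow>
     (\<forall>K. compact K \<and> K \<subseteq> {0..} \<times> UNIV \<longrightarrow> (\<exists>L\<in>loc_summable. lipschitz_with U a K L))"

definition integrally_bounded ::
    "(real \<Rightarrow> 'u set) \<Rightarrow> (real \<Rightarrow> 'a::euclidean_space \<Rightarrow> 'u \<Rightarrow> 'b::euclidean_space) \<Rightarrow> bool" where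
  "integrally_bounded U a \<longleftrightarrow>
     (\<forall>K. compact K \<and> K \<subseteq> {0..} \<times> UNIV \<longrightarrow>
        (\<exists>M\<in>loc_summable. \<forall>(t, x)\<in>K. \<forall>v\<in>U t. norm (a t x v) \<le> M t))"

definition continuability ::
    "(real \<Rightarrow> 'u set) \<Rightarrow> (real \<Rightarrow> 'a::euclidean_space \<Rightarrow> 'u \<Rightarrow> 'b::euclidean_space) \<Rightarrow> bool" where
  "continuability U a \<longleftrightarrow>
     (\<exists>L\<in>loc_summable. \<forall>K. compact K \<and> K \<subseteq> {0..} \<times> UNIV \<longrightarrow> lipschitz_with U a K L) \<and>
     integrally_bounded U a"

definition regular_map ::
    "(real \<Rightarrow> 'u::euclidean_space set) \<Rightarrow>
     (real \<Rightarrow> 'a::euclidean_space \<Rightarrow> 'u \<Rightarrow> 'b::euclidean_space) \<Rightarrow> bool" where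
  "regular_map U a \<longleftrightarrow> caratheodory U a \<and> locally_lipschitz U a \<and> integrally_bounded U a"

section \<open>Controls\<close>

definition graph :: "(real \<Rightarrow> 'u set) \<Rightarrow> (real \<times> 'u) set" where
  "graph U = {(t, v). 0 \<le> t \<and> v \<in> U t}"

definition selectors :: "(real \<Rightarrow> 'u::euclidean_space set) \<Rightarrow> (real \<Rightarrow> 'u) set" where
  "selectors U =
     {u. u \<in> borel_measurable (restrict_space borel {0..}) \<and> (\<forall>t\<ge>0. u t \<in> U t)}"

definition sigma_compact :: "'a::topological_space set \<Rightarrow> bool" where
  "sigma_compact S \<longleftrightarrow> (\<exists>C :: nat \<Rightarrow> 'a set. (\<forall>n. compact (C n)) \<and> S = (\<Union>n. C n))"

definition cond_u_sigma ::
    "(real \<Rightarrow> 'u::euclidean_space set) \<Rightarrow> (real \<Rightarrow> 'u) \<Rightarrow> bool" where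
  "cond_u_sigma U u0 \<longleftrightarrow>
     (\<forall>t\<ge>0. sigma_compact (U t)) \<and> graph U \<in> sets borel \<and>
     (\<exists>V :: nat \<Rightarrow> real \<Rightarrow> 'u set.
        (\<forall>r. graph (V r) \<in> sets borel) \<and>
        (\<forall>r. \<forall>t\<ge>0. compact (V r t)) \<and>
        (\<forall>r. \<forall>t\<ge>0. V r t \<subseteq> V (Suc r) t) \<and>
        (\<forall>r K. compact K \<and> K \<subseteq> {0..} \<longrightarrow>
           (\<exists>M\<in>loc_summable. \<forall>t\<in>K. \<forall>v\<in>V r t. norm v \<le> M t)) \<and>
        (\<forall>t\<ge>0. U t = (\<Union>r. V r t)) \<and>
        (\<forall>t\<ge>0. u0 t \<in> V 1 t))"

section \<open>Dynamics, running payoff and their state derivatives\<close>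

definition gradient :: "('a::real_inner \<Rightarrow> real) \<Rightarrow> 'a \<Rightarrow> 'a" where
  "gradient F x = (THE D. GDERIV F x :> D)"

definition Df ::
    "(real \<Rightarrow> real ^ 'm \<Rightarrow> 'u \<Rightarrow> real ^ 'm) \<Rightarrow> real \<Rightarrow> real ^ 'm \<Rightarrow> 'u \<Rightarrow> real ^ 'm ^ 'm" where
  "Df f t x v = jacobian (\<lambda>y. f t y v) (at x)"

definition Dg ::
    "(real \<Rightarrow> real ^ 'm \<Rightarrow> 'u \<Rightarrow> real) \<Rightarrow> real \<Rightarrow> real ^ 'm \<Rightarrow> 'u \<Rightarrow> real ^ 'm" where
  "Dg g t x v = gradient (\<lambda>y. g t y v) x"

definition cond_fg ::
    "(real \<Rightarrow> 'u::euclidean_space set) \<Rightarrow> (real \<Rightarrow> real ^ 'm \<Rightarrow> 'u \<Rightarrow> real ^ 'm) \<Rightarrow>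
     (real \<Rightarrow> real ^ 'm \<Rightarrow> 'u \<Rightarrow> real) \<Rightarrow> bool" where
  "cond_fg U f g \<longleftrightarrow> regular_map U f \<and> regular_map U g \<and> continuability U f"

definition cond_partial ::
    "(real \<Rightarrow> 'u::euclidean_space set) \<Rightarrow> (real \<Rightarrow> real ^ 'm \<Rightarrow> 'u \<Rightarrow> real ^ 'm) \<Rightarrow>
     (real \<Rightarrow> real ^ 'm \<Rightarrow> 'u \<Rightarrow> real) \<Rightarrow> bool" where
  "cond_partial U f g \<longleftrightarrow>
     (\<forall>t\<ge>0. \<forall>x v. (\<lambda>y. f t y v) differentiable (at x) \<and> (\<lambda>y. g t y v) differentiable (at x)) \<and>
     regular_map U (Df f) \<and> regular_map U (Dg g)"

section \<open>Optimality and the Maximum Principle\<close>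

definition sporadically_catching_up_optimal ::
    "(real \<Rightarrow> 'u::euclidean_space set) \<Rightarrow> ((real \<Rightarrow> 'u) \<Rightarrow> real \<Rightarrow> 'a) \<Rightarrow>
     (real \<Rightarrow> (real \<Rightarrow> 'u) \<Rightarrow> real) \<Rightarrow> (nat \<Rightarrow> real) \<Rightarrow> (real \<Rightarrow> 'a) \<Rightarrow> (real \<Rightarrow> 'u) \<Rightarrow> bool" where
  "sporadically_catching_up_optimal U \<phi> J \<tau> x0 u0 \<longleftrightarrow>
     u0 \<in> selectors U \<and> (\<forall>t\<ge>0. x0 t = \<phi> u0 t) \<and>
     (\<exists>\<omega>\<in>vanishing_functions. \<forall>u\<in>selectors U. \<forall>k n. k < n \<longrightarrow>
        J (\<tau> n) u0 \<ge> J (\<tau> n) u - \<omega> (\<tau> k))"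

definition hamiltonian ::
    "(real \<Rightarrow> real ^ 'm \<Rightarrow> 'u \<Rightarrow> real ^ 'm) \<Rightarrow> (real \<Rightarrow> real ^ 'm \<Rightarrow> 'u \<Rightarrow> real) \<Rightarrow>
     real ^ 'm \<Rightarrow> real \<Rightarrow> 'u \<Rightarrow> real \<Rightarrow> real ^ 'm \<Rightarrow> real" where
  "hamiltonian f g x t v lam p = p \<bullet> f t x v + lam * g t x v"

text \<open>
  The supremum below is a real one. It is taken over a nonempty set, which is bounded as soon as
  \<open>f\<close> and \<open>g\<close> are integrally bounded.
\<close>

definition max_principle_solutions ::
    "(real \<Rightarrow> 'u::euclidean_space set) \<Rightarrow> (real \<Rightarrow> real ^ 'm \<Rightarrow> 'u \<Rightarrow> real ^ 'm) \<Rightarrow>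
     (real \<Rightarrow> real ^ 'm \<Rightarrow> 'u \<Rightarrow> real) \<Rightarrow>
     ((real \<Rightarrow> real ^ 'm) \<times> (real \<Rightarrow> 'u) \<times> real \<times> (real \<Rightarrow> real ^ 'm)) set" where
  "max_principle_solutions U f g =
     {(x, u, lam, \<psi>).
        x \<in> C_loc \<and> u \<in> selectors U \<and> lam \<in> {0..1} \<and> \<psi> \<in> C_loc \<and>
        loc_abs_cont x \<and> loc_abs_cont \<psi> \<and>
        x 0 = 0 \<and> norm (\<psi> 0) + lam = 1 \<and>
        (AE t in lebesgue_on {0..}.
           (x has_vector_derivative f t (x t) (u t)) (at t) \<and>
           (\<psi> has_vector_derivative
              - gradient (\<lambda>y. hamiltonian f g y t (u t) lam (\<psi> t)) (x t)) (at t) \<and>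
           (SUP p\<in>U t. hamiltonian f g (x t) t p lam (\<psi> t))
             = hamiltonian f g (x t) t (u t) lam (\<psi> t))}"

end

theory Submission
  imports Defs
begin

text \<open>
  Write \<open>A\<close> for the variational matrix along the optimal trajectory, \<open>I 0 T\<close> for the integral of
  \<open>Dg v* A\<close> up to \<open>T\<close>, and \<open>H t p\<close> for the Hamiltonian at time \<open>t\<close> and control value \<open>p\<close>.

  If \<open>\<psi>\<close> solves the adjoint equation with multiplier \<open>lam\<close>, then \<open>\<psi> T v* A T = \<psi> 0 - lam *\<^sub>R I 0 T\<close>
  (\<open>adjoint_solution\<close>). Since \<open>I 0 (\<tau> n)\<close> tends to \<open>I_star\<close> (\<open>I_tendsto\<close>), the transversality condition
  says that \<open>\<psi> 0 = lam *\<^sub>R I_star\<close>. The normalisation then determines \<open>lam\<close> and with it \<open>\<psi>\<close>, which is the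
  function of the theorem up to a factor (\<open>costate\<close>). So there is one candidate, and what has to be
  shown is that it satisfies the maximum condition.

  For this, replace \<open>u0\<close> by another selector \<open>u\<close> on a short interval of length \<open>\<epsilon>\<close>, a needle. At the
  end \<open>s\<close> of the needle the state is displaced by approximately \<open>\<epsilon>\<close> times the jump of \<open>f\<close>, and afterwards
  the system follows a trajectory \<open>X \<xi>\<close> of \<open>u0\<close> with an initial state \<open>\<xi>\<close> of order \<open>\<epsilon>\<close> (\<open>X_surj\<close>). The gain up
  to \<open>\<tau> n\<close> is \<open>\<epsilon>\<close> times the jump of \<open>g\<close> plus the increment of the payoff along \<open>X \<xi>\<close> between \<open>s\<close> and
  \<open>\<tau> n\<close>. The increment over the whole of \<open>{0..\<tau> n}\<close> is the mean of \<open>I (r *\<^sub>R \<xi>) (\<tau> n) \<bullet> \<xi>\<close> over \<open>r\<close> between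
  \<open>0\<close> and \<open>1\<close>, and by the joint limit it equals \<open>I_star \<bullet> \<xi>\<close> up to an error that is small compared with \<open>\<xi>\<close>,
  uniformly in all large \<open>n\<close> (\<open>payoff_increment_uniform\<close>). Without its part up to \<open>s\<close> it is
  \<open>(I_star - I 0 s) \<bullet> \<xi>\<close>, which is the costate applied to the displacement. Altogether the gain at all
  late times \<open>\<tau> n\<close> is at least \<open>\<epsilon>\<close> times \<open>H t (u t) - H t (u0 t)\<close> up to lower order, and sporadic
  optimality excludes a persistent positive gain (\<open>no_asymptotic_gain\<close>). Hence
  \<open>H t (u t) \<le> H t (u0 t)\<close> at almost every \<open>t\<close> (\<open>needle_inequality\<close>).

  Two questions of measurability remain. First, the Caratheodory conditions do not make \<open>f\<close> and \<open>g\<close>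
  measurable along a trajectory; this has to be drawn from the equations that are assumed to have
  solutions, by approximation (\<open>measurable_along_base\<close>, \<open>payoff_increment_integral\<close>). Second, the
  exceptional null set above depends on \<open>u\<close>, so countably many selectors are needed that come close
  to every value of \<open>U t\<close> at almost every \<open>t\<close> (\<open>selector_hitting_open\<close>). As the graph of \<open>U\<close> is a Borel
  set, they exist by the capacitability of Suslin sets (\<open>suslin_inner_compact\<close>).
\<close>

section \<open>Suslin sets and measurable selection\<close>

text \<open>
  Suslin (analytic) sets, written as projections along the Baire space \<open>nat \<Rightarrow> nat\<close>: a sequence is
  a witness for membership, and countable unions and intersections only reindex witnesses.
\<close>

definition suslin :: "'a::topological_space set \<Rightarrow> bool" where
  "suslin B \<longleftrightarrow> (\<exists>C :: ('a \<times> (nat \<Rightarrow> nat)) set. closed C \<and> B = fst ` C)"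

lemma continuous_on_seq_reindex:
  "continuous_on UNIV (\<lambda>p :: 'a::topological_space \<times> (nat \<Rightarrow> nat). (fst p, \<lambda>k. snd p (j k)))"
  by (intro continuous_on_Pair continuous_on_coordinatewise_then_product continuous_on_fst continuous_on_id
        continuous_on_product_then_coordinatewise[OF continuous_on_snd])

lemma continuous_on_seq_coordinate:
  "continuous_on UNIV (\<lambda>p :: 'a::topological_space \<times> (nat \<Rightarrow> nat). snd p i)"
  by (intro continuous_on_product_then_coordinatewise[OF continuous_on_snd] continuous_on_id)

lemma closed_seq_coordinate: "closed {p :: 'a::topological_space \<times> (nat \<Rightarrow> nat). snd p i \<in> S}"
  using closed_vimage[OF _ continuous_on_seq_coordinate, of S i]
  by (simp add: vimage_def closed_def open_discrete)

lemma suslin_closed: "closed B \<Longrightarrow> suslin B"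
  unfolding suslin_def by (intro exI[of _ "B \<times> UNIV"]) (auto intro: closed_Times)

text \<open>
  The first entry of a witness names the set of the union, the other entries witness membership in it.
\<close>

lemma suslin_UN:
  fixes B :: "nat \<Rightarrow> 'a::topological_space set"
  assumes "\<And>n. suslin (B n)"
  shows "suslin (\<Union>n. B n)"
proof -
  obtain C :: "nat \<Rightarrow> ('a \<times> (nat \<Rightarrow> nat)) set" where C: "\<And>n. closed (C n)" "\<And>n. B n = fst ` C n"
    using assms unfolding suslin_def by metis
  define D where "D = {p. (fst p, \<lambda>k. snd p (Suc k)) \<in> C (snd p 0)}"
  have "D = (\<Inter>n. {p. snd p 0 \<in> - {n}} \<union> (\<lambda>p. (fst p, \<lambda>k. snd p (Suc k))) -` C n)"
    by (auto simp: D_def)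
  then have "closed D"
    by (auto intro!: closed_INT closed_Un closed_vimage C continuous_on_seq_reindex closed_seq_coordinate
        simp del: Compl_iff)
  moreover have "(\<Union>n. B n) = fst ` D"
  proof (intro equalityI subsetI)
    fix x assume "x \<in> (\<Union>n. B n)"
    then obtain n \<sigma> where "(x, \<sigma>) \<in> C n" using C by auto
    then have "(x, case_nat n \<sigma>) \<in> D" by (simp add: D_def)
    then show "x \<in> fst ` D" by force
  next
    fix x assume "x \<in> fst ` D"
    then obtain \<sigma> where "(x, \<lambda>k. \<sigma> (Suc k)) \<in> C (\<sigma> 0)" by (auto simp: D_def)
    then show "x \<in> (\<Union>n. B n)" unfolding C by force
  qed
  ultimately show ?thesis unfolding suslin_def by blast
qed

text \<open>
  A pairing function lets one sequence carry a witness for each of the countably many sets.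
\<close>

lemma suslin_INT:
  fixes B :: "nat \<Rightarrow> 'a::topological_space set"
  assumes "\<And>n. suslin (B n)"
  shows "suslin (\<Inter>n. B n)"
proof -
  obtain C :: "nat \<Rightarrow> ('a \<times> (nat \<Rightarrow> nat)) set" where C: "\<And>n. closed (C n)" "\<And>n. B n = fst ` C n"
    using assms unfolding suslin_def by metis
  define D where "D = (\<Inter>n. (\<lambda>p. (fst p, \<lambda>k. snd p (prod_encode (n, k)))) -` C n)"
  have "closed D" unfolding D_def
    by (auto intro!: closed_INT closed_vimage C continuous_on_seq_reindex)
  moreover have "(\<Inter>n. B n) = fst ` D"
  proof (intro equalityI subsetI)
    fix x assume "x \<in> (\<Inter>n. B n)"
    then have "\<forall>n. \<exists>\<sigma>. (x, \<sigma>) \<in> C n" using C by force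
    then obtain \<sigma> where \<sigma>: "\<And>n. (x, \<sigma> n) \<in> C n" by metis
    have "(x, \<lambda>j. case prod_decode j of (n, k) \<Rightarrow> \<sigma> n k) \<in> D" using \<sigma> by (simp add: D_def)
    then show "x \<in> fst ` D" by force
  next
    fix x assume "x \<in> fst ` D"
    then obtain \<sigma> where "\<And>n. (x, \<lambda>k. \<sigma> (prod_encode (n, k))) \<in> C n" by (auto simp: D_def)
    then show "x \<in> (\<Inter>n. B n)" unfolding C by force
  qed
  ultimately show ?thesis unfolding suslin_def by blast
qed

text \<open>
  Complements of Suslin sets need not be Suslin, so the induction runs over the sets that are Suslin
  together with their complement.
\<close>

lemma suslin_borel:
  fixes B :: "'a::metric_space set"
  assumes "B \<in> sets borel"
  shows "suslin B"
proof -
  have op: "suslin S" if "open S" for S :: "'a set"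
  proof -
    have "fsigma_in euclidean S"
      using that by (intro open_imp_fsigma_in) (auto simp: metrizable_space_euclidean)
    from fsigma_in_ascending[THEN iffD1, OF this]
    obtain C :: "nat \<Rightarrow> 'a set" where C: "\<forall>n. closedin euclidean (C n)" "\<Union> (range C) = S"
      by (elim exE conjE)
    have "suslin (\<Union>n. C n)" using C(1) by (intro suslin_UN suslin_closed) auto
    then show ?thesis using C(2) by simp
  qed
  have "B \<in> sigma_sets UNIV {S. open S}" using assms by (simp add: borel_def)
  then have "suslin B \<and> suslin (- B)"
  proof induction
    case (Basic a)
    then show ?case by (auto intro: op suslin_closed)
  next
    case Empty
    then show ?case by (auto intro: suslin_closed)
  next
    case (Compl a)
    then show ?case by (simp add: Compl_eq_Diff_UNIV[symmetric])
  next
    case (Union a)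
    then show ?case by (auto intro!: suslin_UN suslin_INT)
  qed
  then show ?thesis ..
qed

text \<open>
  Choquet's capacitability theorem for the outer measure of the projection to the time axis. Outer
  measure is continuous along increasing unions, so the entries of the witnesses can be bounded one
  after the other, keeping the outer measure of the projection above a fixed number larger than \<open>c\<close>.
  Once all entries are bounded, the remaining set is compact by Tychonoff's theorem, and a
  subsequence argument shows that its projection contains the intersection of the closures of the
  projections of the partially bounded sets, whose measure is the limit of theirs.
\<close>

lemma suslin_inner_compact:
  fixes B :: "(real \<times> 'u::euclidean_space) set"
  assumes B: "suslin B" and c: "c < outer_measure_of lebesgue (fst ` B)"
  shows "\<exists>K. compact K \<and> K \<subseteq> B \<and> c < emeasure lebesgue (fst ` K)"
proof -
  obtain c' where c': "c < c'" "c' < outer_measure_of lebesgue (fst ` B)" using c dense by blast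
  obtain C0 :: "((real \<times> 'u) \<times> (nat \<Rightarrow> nat)) set" where C0: "closed C0" "B = fst ` C0" using B unfolding suslin_def by blast
  \<comment> \<open>A new first entry bounds the point itself, so that bounding the entries also gives compactness in the first factor.\<close>
  define C where "C = {p. norm (fst p) \<le> real (snd p 0)} \<inter> (\<lambda>p. (fst p, \<lambda>k. snd p (Suc k))) -` C0"
  have "continuous_on UNIV (\<lambda>p :: (real \<times> 'u) \<times> (nat \<Rightarrow> nat). real (snd p 0))"
    by (rule continuous_on_compose2[OF _ continuous_on_seq_coordinate[of 0], of UNIV])
       (auto intro!: continuous_on_discrete)
  then have "closed C" unfolding C_def
    by (intro closed_Int closed_vimage C0 continuous_on_seq_reindex closed_Collect_le
        continuous_on_norm continuous_on_fst continuous_on_id)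
  have BC: "B = fst ` C"
  proof (intro equalityI subsetI)
    fix x assume "x \<in> B"
    then obtain \<sigma> where s: "(x, \<sigma>) \<in> C0" using C0 by auto
    obtain n where "norm x \<le> real n" using real_arch_simple by blast
    then have "(x, case_nat n \<sigma>) \<in> C" using s by (simp add: C_def)
    then show "x \<in> fst ` C" by force
  qed (auto simp: C_def C0 intro: rev_image_eqI)
  let ?O = "\<lambda>D :: ((real \<times> 'u) \<times> (nat \<Rightarrow> nat)) set. outer_measure_of lebesgue (fst ` fst ` D)"
  obtain D where D: "\<And>n. c' < ?O (D n)" "D 0 = C"
      "\<And>n. \<exists>k. D (Suc n) = {p \<in> D n. snd p n \<le> k}"
  proof (atomize_elim, rule dependent_nat_choice[where P = "\<lambda>n D. c' < ?O D \<and> (n = 0 \<longrightarrow> D = C)"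
        and Q = "\<lambda>n D D'. \<exists>k. D' = {p \<in> D. snd p n \<le> k}", THEN ex_forward])
    show "\<exists>D. c' < ?O D \<and> (0 = (0::nat) \<longrightarrow> D = C)" using c' BC by auto
  next
    fix D :: "((real \<times> 'u) \<times> (nat \<Rightarrow> nat)) set" and n :: nat
    assume *: "c' < ?O D \<and> (n = 0 \<longrightarrow> D = C)"
    let ?D = "\<lambda>k. {p \<in> D. snd p n \<le> k}"
    have "incseq (\<lambda>k. fst ` fst ` ?D k)"
      by (intro monoI image_mono) auto
    moreover have "(\<Union>k. fst ` fst ` ?D k) = fst ` fst ` D" by force
    ultimately have "(SUP k. ?O (?D k)) = ?O D"
      using SUP_outer_measure_of_incseq[of "\<lambda>k. fst ` fst ` ?D k" lebesgue] by simp
    with * have "c' < (SUP k. ?O (?D k))" by simp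
    then obtain k where "c' < ?O (?D k)" by (auto simp: less_SUP_iff)
    then show "\<exists>D'. (c' < ?O D' \<and> (Suc n = 0 \<longrightarrow> D' = C)) \<and> (\<exists>k. D' = {p \<in> D. snd p n \<le> k})"
      by blast
  qed blast
  have "\<exists>k. \<forall>n. D (Suc n) = {p \<in> D n. snd p n \<le> k n}" by (intro choice allI D(3))
  then obtain k where k: "\<And>n. D (Suc n) = {p \<in> D n. snd p n \<le> k n}" by blast
  have Dn: "D n = {p \<in> C. \<forall>i<n. snd p i \<le> k i}" for n
    by (induction n) (auto simp: D(2) k less_Suc_eq)
  have cpt: "compact (Pi\<^sub>E UNIV (\<lambda>i. {..m i}))" for m :: "nat \<Rightarrow> nat"
  proof -
    have "compactin (product_topology (\<lambda>i::nat. euclidean :: nat topology) UNIV) (Pi\<^sub>E UNIV (\<lambda>i. {..m i}))"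
      by (subst compactin_PiE) (auto intro: finite_imp_compact)
    then show ?thesis by (simp add: euclidean_product_topology)
  qed
  define E where "E = {p \<in> C. \<forall>i. snd p i \<le> k i}"
  have bnd: "norm (fst p) \<le> real (k 0)" if "p \<in> C" "snd p 0 \<le> k 0" for p
  proof -
    have "norm (fst p) \<le> real (snd p 0)" using that by (simp add: C_def)
    also have "\<dots> \<le> real (k 0)" using that by simp
    finally show ?thesis .
  qed
  have cE: "E = C \<inter> (cball 0 (real (k 0)) \<times> Pi\<^sub>E UNIV (\<lambda>i. {..k i}))"
    unfolding E_def using bnd by (auto simp: PiE_iff mem_Times_iff)
  have "compact E" unfolding cE
    by (rule closed_Int_compact[OF \<open>closed C\<close> compact_Times[OF compact_cball cpt]])
  then have K: "compact (fst ` E)" "compact (fst ` fst ` E)"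
    by (auto intro!: compact_continuous_image continuous_intros)
  let ?F = "\<lambda>n. closure (fst ` fst ` D (Suc n))"
  have sub: "(\<Inter>n. ?F n) \<subseteq> fst ` fst ` E"
  proof
    fix t assume t: "t \<in> (\<Inter>n. ?F n)"
    have "\<exists>p\<in>D (Suc n). dist (fst (fst p)) t < inverse (real (Suc n))" for n
    proof -
      have "t \<in> ?F n" using t by blast
      then show ?thesis unfolding closure_approachable by (auto simp: Bex_def dest!: spec[of _ "inverse (real (Suc n))"])
    qed
    then obtain p where p: "\<And>n. p n \<in> D (Suc n)" "\<And>n. dist (fst (fst (p n))) t < inverse (real (Suc n))"
      by metis
    have pC: "p n \<in> C" and pk: "i \<le> n \<Longrightarrow> snd (p n) i \<le> k i" for n i
      using p(1)[of n] by (auto simp: Dn)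
    \<comment> \<open>The bound \<open>k i\<close> holds for the entry \<open>i\<close> of \<open>p n\<close> once \<open>i \<le> n\<close>; finitely many other values are added.\<close>
    define m where "m i = Max (insert (k i) ((\<lambda>n. snd (p n) i) ` {..<i}))" for i
    have pm: "snd (p n) i \<le> m i" for n i
    proof (cases "i \<le> n")
      case True
      then show ?thesis using pk[OF True] unfolding m_def by (meson Max_ge finite.insertI finite_imageI finite_lessThan insertI1 order_trans)
    next
      case False
      then show ?thesis unfolding m_def by (intro Max_ge) auto
    qed
    have pb: "norm (fst (p n)) \<le> real (k 0)" for n
      using bnd[OF pC pk] by simp
    have "p n \<in> cball 0 (real (k 0)) \<times> Pi\<^sub>E UNIV (\<lambda>i. {..m i})" for n
      using pm pb by (auto simp: mem_Times_iff)
    moreover have "seq_compact (cball (0::real \<times> 'u) (real (k 0)) \<times> Pi\<^sub>E UNIV (\<lambda>i. {..m i}))"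
      by (intro compact_imp_seq_compact compact_Times compact_cball cpt)
    ultimately obtain q r where r: "strict_mono (r :: nat \<Rightarrow> nat)" "(p \<circ> r) \<longlonglongrightarrow> q"
      unfolding seq_compact_def by metis
    have "q \<in> C" using closed_sequentially[OF \<open>closed C\<close> _ r(2)] pC by simp
    have "snd q i \<le> k i" for i
    proof -
      have "(\<lambda>n. snd ((p \<circ> r) n) i) \<longlonglongrightarrow> snd q i"
        using continuous_on_tendsto_compose[OF continuous_on_seq_coordinate[of i] r(2)] by simp
      moreover have "\<forall>\<^sub>F n in sequentially. snd ((p \<circ> r) n) i \<le> k i"
        using eventually_ge_at_top[of i]
      proof eventually_elim
        case (elim n)
        then show ?case using pk seq_suble[OF r(1), of n] by (simp add: order_trans)
      qed
      ultimately show ?thesis by (intro tendsto_upperbound) auto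
    qed
    with \<open>q \<in> C\<close> have "q \<in> E" by (simp add: E_def)
    have "(\<lambda>n. fst (fst ((p \<circ> r) n))) \<longlonglongrightarrow> fst (fst q)" using r(2) by (intro tendsto_fst)
    moreover have "(\<lambda>n. fst (fst (p n))) \<longlonglongrightarrow> t"
      by (rule metric_tendsto_imp_tendsto[OF LIMSEQ_inverse_real_of_nat])
         (use p(2) in \<open>auto intro!: always_eventually less_imp_le simp: dist_norm\<close>)
    then have "((\<lambda>n. fst (fst (p n))) \<circ> r) \<longlonglongrightarrow> t" using r(1) LIMSEQ_subseq_LIMSEQ by blast
    ultimately have "t = fst (fst q)" by (simp add: o_def LIMSEQ_unique)
    with \<open>q \<in> E\<close> show "t \<in> fst ` fst ` E" by blast
  qed
  have fin: "emeasure lebesgue (?F n) \<noteq> \<infinity>" for n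
  proof -
    have "fst ` fst ` D (Suc n) \<subseteq> cball 0 (real (k 0))"
    proof clarsimp
      fix t v \<sigma> assume "((t, v), \<sigma>) \<in> D (Suc n)"
      then have "norm (t, v) \<le> real (k 0)" using bnd[of "((t, v), \<sigma>)"] by (simp add: Dn)
      then show "\<bar>t\<bar> \<le> real (k 0)" using norm_fst_le[of t v] by simp
    qed
    then have "bounded (?F n)" by (meson bounded_cball bounded_closure bounded_subset)
    then have "?F n \<in> lmeasurable" by (intro lmeasurable_compact) (simp add: compact_eq_bounded_closed)
    then show ?thesis by (simp add: fmeasurable_def less_top)
  qed
  have ge: "c' \<le> emeasure lebesgue (?F n)" for n
  proof -
    have "c' \<le> outer_measure_of lebesgue (fst ` fst ` D (Suc n))" using D(1) by (simp add: less_imp_le)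
    also have "\<dots> \<le> outer_measure_of lebesgue (?F n)" by (intro outer_measure_of_mono closure_subset)
    finally show ?thesis by simp
  qed
  have "c' \<le> (INF n. emeasure lebesgue (?F n))" using ge by (intro INF_greatest) auto
  also have "\<dots> = emeasure lebesgue (\<Inter>n. ?F n)"
  proof (rule INF_emeasure_decseq)
    show "decseq ?F" by (intro decseq_SucI closure_mono image_mono) (auto simp: k)
  qed (use fin in auto)
  also have "\<dots> \<le> emeasure lebesgue (fst ` fst ` E)"
    using sub K by (intro emeasure_mono) (auto simp: lmeasurable_compact fmeasurableD)
  finally have "c < emeasure lebesgue (fst ` fst ` E)" using c'(1) by (rule less_le_trans[rotated])
  moreover have "fst ` E \<subseteq> B" unfolding BC by (rule image_mono) (simp add: E_def Collect_conj_eq)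
  ultimately show ?thesis using K(1) by (intro exI[of _ "fst ` E"]) simp
qed

text \<open>
  A compact set is made single-valued by keeping in each section only the points of least
  \<open>b\<close>-coordinate, for one \<open>b\<close> after the other. This does not change the projection, as compact sections
  attain the minimum, but the result is only Borel; capacitability makes it compact again before
  the next coordinate.
\<close>

lemma single_valued_inner_compact:
  fixes B :: "(real \<times> 'u::euclidean_space) set"
  assumes "finite D" "B \<in> sets borel" "c < outer_measure_of lebesgue (fst ` B)"
  shows "\<exists>K. compact K \<and> K \<subseteq> B \<and> c < emeasure lebesgue (fst ` K) \<and>
           (\<forall>t v w. (t, v) \<in> K \<longrightarrow> (t, w) \<in> K \<longrightarrow> (\<forall>b\<in>D. v \<bullet> b = w \<bullet> b))"
  using assms
proof (induction D)
  case empty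
  then show ?case using suslin_inner_compact[OF suslin_borel] by force
next
  case (insert b D)
  then obtain K where K: "compact K" "K \<subseteq> B" "c < emeasure lebesgue (fst ` K)"
      "\<And>t v w d. (t, v) \<in> K \<Longrightarrow> (t, w) \<in> K \<Longrightarrow> d \<in> D \<Longrightarrow> v \<bullet> d = w \<bullet> d"
    by blast
  define P where "P q = fst ` (K \<inter> {p. snd p \<bullet> b \<le> q})" for q
  have P: "closed (P q)" for q
    unfolding P_def
    by (intro compact_imp_closed compact_continuous_image compact_Int_closed K closed_Collect_le
          continuous_intros)
  define M where "M = K \<inter> (\<Inter>q\<in>\<rat>. {p. snd p \<bullet> b \<le> q} \<union> (- P q) \<times> UNIV)"
  have Mi: "(t, v) \<in> M \<longleftrightarrow> (t, v) \<in> K \<and> (\<forall>w. (t, w) \<in> K \<longrightarrow> v \<bullet> b \<le> w \<bullet> b)" for t v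
  proof safe
    fix w assume M: "(t, v) \<in> M" and w: "(t, w) \<in> K"
    show "v \<bullet> b \<le> w \<bullet> b"
    proof (rule ccontr)
      assume "\<not> v \<bullet> b \<le> w \<bullet> b"
      then obtain q where q: "q \<in> \<rat>" "w \<bullet> b < q" "q < v \<bullet> b" using Rats_dense_in_real[of "w \<bullet> b" "v \<bullet> b"] by auto
      have "t \<in> P q" using w q unfolding P_def by force
      with M q show False unfolding M_def by auto
    qed
  qed (force simp: M_def P_def)+
  have "closed {p :: real \<times> 'u. snd p \<bullet> b \<le> q}" for q
    by (intro closed_Collect_le continuous_intros)
  then have "{p :: real \<times> 'u. snd p \<bullet> b \<le> q} \<union> (- P q) \<times> UNIV \<in> sets borel" for q
    using P by (intro sets.Un borel_closed borel_open open_Times) auto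
  then have "(\<Inter>q\<in>\<rat>. {p :: real \<times> 'u. snd p \<bullet> b \<le> q} \<union> (- P q) \<times> UNIV) \<in> sets borel"
    by (intro sets.countable_INT''[OF _ countable_rat]) auto
  then have "M \<in> sets borel"
    unfolding M_def by (rule sets.Int[OF borel_compact[OF K(1)]])
  moreover have fM: "fst ` M = fst ` K"
  proof (intro equalityI subsetI)
    fix t assume "t \<in> fst ` K"
    then obtain v where v: "(t, v) \<in> K" by force
    have "compact (K \<inter> {t} \<times> UNIV)"
      by (intro compact_Int_closed K closed_Times) auto
    moreover have "K \<inter> {t} \<times> UNIV \<noteq> {}" using v by blast
    moreover have "continuous_on (K \<inter> {t} \<times> UNIV) (\<lambda>p. snd p \<bullet> b)" by (intro continuous_intros)
    ultimately obtain p where "p \<in> K \<inter> {t} \<times> UNIV" "\<forall>y\<in>K \<inter> {t} \<times> UNIV. snd p \<bullet> b \<le> snd y \<bullet> b"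
      by (meson continuous_attains_inf)
    then have "(t, snd p) \<in> K" "\<And>w. (t, w) \<in> K \<Longrightarrow> snd p \<bullet> b \<le> w \<bullet> b" by (cases p; force)+
    then have "(t, snd p) \<in> M" unfolding Mi by blast
    then show "t \<in> fst ` M" by force
  qed (auto simp: M_def)
  ultimately have "c < outer_measure_of lebesgue (fst ` M)"
    using K(1,3) by (simp add: lmeasurable_compact fmeasurableD compact_continuous_image continuous_on_fst)
  with suslin_inner_compact[OF suslin_borel[OF \<open>M \<in> sets borel\<close>]]
  obtain L where L: "compact L" "L \<subseteq> M" "c < emeasure lebesgue (fst ` L)" by blast
  have single: "v \<bullet> d = w \<bullet> d" if "(t, v) \<in> L" "(t, w) \<in> L" "d \<in> insert b D" for t v w d
  proof (cases "d = b")
    case True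
    have "(t, v) \<in> M" "(t, w) \<in> M" using that L by auto
    then show ?thesis unfolding Mi True by (auto intro: antisym)
  next
    case False
    then show ?thesis using that L K(4)[of t v w d] by (auto simp: M_def)
  qed
  have "L \<subseteq> B" using L(2) K(2) by (auto simp: M_def)
  moreover have "\<forall>t v w. (t, v) \<in> L \<longrightarrow> (t, w) \<in> L \<longrightarrow> (\<forall>d\<in>insert b D. v \<bullet> d = w \<bullet> d)"
    using single by blast
  ultimately have "compact L \<and> L \<subseteq> B \<and> c < emeasure lebesgue (fst ` L) \<and>
      (\<forall>t v w. (t, v) \<in> L \<longrightarrow> (t, w) \<in> L \<longrightarrow> (\<forall>d\<in>insert b D. v \<bullet> d = w \<bullet> d))"
    using L(1,3) by (intro conjI)
  then show ?case by (rule exI)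
qed

lemma compact_graph_selection:
  fixes K :: "(real \<times> 'u::euclidean_space) set"
  assumes K: "compact K" and single: "\<And>t v w. (t, v) \<in> K \<Longrightarrow> (t, w) \<in> K \<Longrightarrow> v = w"
  obtains s where "continuous_on (fst ` K) s" "\<And>t. t \<in> fst ` K \<Longrightarrow> (t, s t) \<in> K"
proof
  define s where "s t = (SOME v. (t, v) \<in> K)" for t
  show s: "(t, s t) \<in> K" if "t \<in> fst ` K" for t
    unfolding s_def using that by (intro someI_ex[of "\<lambda>v. (t, v) \<in> K"]) force
  have "(\<lambda>t. Pair t (s t)) ` (fst ` K) = K"
  proof (intro equalityI subsetI)
    fix p assume "p \<in> K"
    then have f: "fst p \<in> fst ` K" and "(fst p, snd p) \<in> K" by auto
    with single[OF s[OF f]] have "s (fst p) = snd p" by blast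
    then have "p = (fst p, s (fst p))" by simp
    with f show "p \<in> (\<lambda>t. (t, s t)) ` fst ` K" by blast
  qed (use s in auto)
  then show "continuous_on (fst ` K) s"
  proof (intro continuous_from_closed_graph[of "snd ` K"])
    show "compact (snd ` K)" using K by (intro compact_continuous_image continuous_intros)
    show "s \<in> fst ` K \<rightarrow> snd ` K" using s by force
  qed (use compact_imp_closed[OF K] in simp)
qed

text \<open>
  Measurable selection up to a null set: inside the Borel graph of \<open>U\<close>, restricted to values in \<open>S\<close>, lie
  compact graphs of continuous functions whose domains fill the projection up to a null set. Each
  extends by \<open>u0\<close> to a selector. With \<open>S\<close> ranging over a countable base, countably many selectors come
  arbitrarily close to every admissible control value at almost every time.
\<close>

lemma selector_hitting_open:
  fixes U :: "real \<Rightarrow> 'u::euclidean_space set"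
  assumes u0: "u0 \<in> selectors U" and G: "graph U \<in> sets borel" and S: "open S"
  shows "\<exists>w. (\<forall>n::nat. w n \<in> selectors U) \<and>
    (AE t in lebesgue. 0 \<le> t \<longrightarrow> U t \<inter> S \<noteq> {} \<longrightarrow> (\<exists>n. w n t \<in> S))"
proof -
  define B where "B N = graph U \<inter> ({0..real N} \<times> S)" for N
  have B: "B N \<in> sets borel" for N
    using G S unfolding B_def by (intro sets.Int) (auto intro!: borel_Times)
  have Bsub: "fst ` B N \<subseteq> {0..real N}" for N by (auto simp: B_def)
  have fin: "outer_measure_of lebesgue (fst ` B N) < \<infinity>" for N
  proof -
    have "outer_measure_of lebesgue (fst ` B N) \<le> outer_measure_of lebesgue {0..real N}"
      by (intro outer_measure_of_mono Bsub)
    also have "\<dots> < \<infinity>" by simp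
    finally show ?thesis .
  qed
  have "\<exists>v. v \<in> selectors U \<and> (\<exists>Z\<in>sets lebesgue. Z \<subseteq> fst ` B N \<and> (\<forall>t\<in>Z. v t \<in> S) \<and>
            outer_measure_of lebesgue (fst ` B N) \<le> emeasure lebesgue Z + inverse (real (Suc k)))" for N k
  proof (cases "outer_measure_of lebesgue (fst ` B N) = 0")
    case True
    then show ?thesis using u0 by (intro exI[of _ u0] conjI bexI[of _ "{}"]) auto
  next
    case False
    let ?o = "outer_measure_of lebesgue (fst ` B N)"
    have "?o - inverse (real (Suc k)) < ?o"
      using fin[of N] False by (intro ennreal_between) (auto simp: less_top[symmetric] zero_less_iff_neq_zero)
    from single_valued_inner_compact[OF finite_Basis B this]
    obtain K where K: "compact K" "K \<subseteq> B N" "?o - inverse (real (Suc k)) < emeasure lebesgue (fst ` K)"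
        "\<And>t v w b. (t, v) \<in> K \<Longrightarrow> (t, w) \<in> K \<Longrightarrow> b \<in> Basis \<Longrightarrow> v \<bullet> b = w \<bullet> b"
      by blast
    have single: "v = w" if "(t, v) \<in> K" "(t, w) \<in> K" for t v w
      using K(4)[OF that] by (rule euclidean_eqI)
    obtain s where s: "continuous_on (fst ` K) s" "\<And>t. t \<in> fst ` K \<Longrightarrow> (t, s t) \<in> K"
      by (rule compact_graph_selection[OF K(1)]) (use single in auto)
    have cK: "compact (fst ` K)"
      by (rule compact_continuous_image[OF continuous_on_fst[OF continuous_on_id] K(1)])
    define v where "v t = (if t \<in> fst ` K then s t else u0 t)" for t
    have sub: "fst ` K \<subseteq> {0..}" using K(2) by (auto simp: B_def)
    have "v \<in> borel_measurable (restrict_space borel {0..})" unfolding v_def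
    proof (subst measurable_If_restrict_space_iff)
      show "{x \<in> space (restrict_space borel {0..}). x \<in> fst ` K} \<in> sets (restrict_space borel {0..})"
        using sub cK by (auto simp: sets_restrict_space space_restrict_space borel_compact intro!: image_eqI[of _ _ "fst ` K"])
      have eq: "restrict_space (restrict_space borel {0..}) {x. x \<in> fst ` K} = restrict_space borel (fst ` K)"
        using sub cK by (subst restrict_restrict_space) (auto simp: Int_absorb1 borel_compact)
      have "s \<in> borel_measurable (restrict_space (restrict_space borel {0..}) {x. x \<in> fst ` K})"
        unfolding eq by (rule borel_measurable_continuous_on_restrict[OF s(1)])
      moreover have "u0 \<in> borel_measurable (restrict_space (restrict_space borel {0..}) {x. x \<notin> fst ` K})"
        by (rule measurable_restrict_space1) (use u0 in \<open>simp add: selectors_def\<close>)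
      ultimately show "s \<in> borel_measurable (restrict_space (restrict_space borel {0..}) {x. x \<in> fst ` K}) \<and>
          u0 \<in> borel_measurable (restrict_space (restrict_space borel {0..}) {x. x \<notin> fst ` K})" ..
    qed
    moreover have "v t \<in> U t" if "0 \<le> t" for t
      using u0 that s(2)[of t] K(2) by (auto simp: v_def selectors_def B_def graph_def)
    ultimately have "v \<in> selectors U" by (simp add: selectors_def)
    moreover have "fst ` K \<in> sets lebesgue" using cK by (simp add: lmeasurable_compact fmeasurableD)
    moreover have "fst ` K \<subseteq> fst ` B N" using K(2) by blast
    moreover have "\<forall>t\<in>fst ` K. v t \<in> S" using s(2) K(2) by (auto simp: v_def B_def)
    moreover have "?o \<le> emeasure lebesgue (fst ` K) + inverse (real (Suc k))"
      using ennreal_minus_le_iff[THEN iffD1, OF less_imp_le[OF K(3)]] by (simp only: add.commute)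
    ultimately show ?thesis by (intro exI[of _ v] conjI bexI[of _ "fst ` K"])
  qed
  then obtain v Z where v: "\<And>N k. v N k \<in> selectors U" and Z: "\<And>N k. Z N k \<in> sets lebesgue"
      "\<And>N k. Z N k \<subseteq> fst ` B N" "\<And>N k t. t \<in> Z N k \<Longrightarrow> v N k t \<in> S"
      "\<And>N k. outer_measure_of lebesgue (fst ` B N) \<le> emeasure lebesgue (Z N k) + inverse (real (Suc k))"
    by metis
  have "negligible (fst ` B N - (\<Union>k. Z N k))" for N
  proof -
    obtain E where E: "E \<in> sets lebesgue" "fst ` B N \<subseteq> E"
        "outer_measure_of lebesgue (fst ` B N) = emeasure lebesgue E"
      using outer_measure_of_attain[of "fst ` B N" lebesgue] by auto
    have UE: "(\<Union>k. Z N k) \<subseteq> E" using Z(2) E(2) by blast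
    have "emeasure lebesgue E \<le> emeasure lebesgue (\<Union>k. Z N k)"
    proof (rule ennreal_le_epsilon)
      fix e :: real assume "0 < e"
      then obtain k where k: "inverse (real (Suc k)) < e" using reals_Archimedean by blast
      have "emeasure lebesgue E \<le> emeasure lebesgue (Z N k) + inverse (real (Suc k))" using Z(4) E by metis
      also have "\<dots> \<le> emeasure lebesgue (\<Union>k. Z N k) + e"
        using k Z(1) by (intro add_mono emeasure_mono ennreal_leI) auto
      finally show "emeasure lebesgue E \<le> emeasure lebesgue (\<Union>k. Z N k) + e" .
    qed
    moreover have "emeasure lebesgue (E - (\<Union>k. Z N k)) = emeasure lebesgue E - emeasure lebesgue (\<Union>k. Z N k)"
    proof (rule emeasure_Diff)
      have "emeasure lebesgue (\<Union>k. Z N k) \<le> emeasure lebesgue E" using E UE by (intro emeasure_mono)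
      also have "\<dots> < \<infinity>" using fin[of N] E by simp
      finally show "emeasure lebesgue (\<Union>k. Z N k) \<noteq> \<infinity>" by simp
    qed (use E UE Z in auto)
    ultimately have "emeasure lebesgue (E - (\<Union>k. Z N k)) = 0"
      using fin[of N] E by (simp add: diff_eq_0_iff_ennreal)
    then have "E - (\<Union>k. Z N k) \<in> null_sets lebesgue" using E Z by (auto intro!: null_setsI)
    then show ?thesis using E(2) by (meson Diff_mono negligible_iff_null_sets negligible_subset order_refl)
  qed
  then have "negligible (\<Union>N. fst ` B N - (\<Union>k. Z N k))" by (intro negligible_countable_Union) auto
  then have "AE t in lebesgue. t \<notin> (\<Union>N. fst ` B N - (\<Union>k. Z N k))"
    unfolding negligible_iff_null_sets by (rule AE_not_in)
  then have "AE t in lebesgue. 0 \<le> t \<longrightarrow> U t \<inter> S \<noteq> {} \<longrightarrow> (\<exists>n. (case_prod v) (prod_decode n) t \<in> S)"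
  proof eventually_elim
    case (elim t)
    show ?case
    proof (intro impI)
      assume t: "0 \<le> t" "U t \<inter> S \<noteq> {}"
      obtain N where "t \<le> real N" using real_arch_simple by blast
      with t have "t \<in> fst ` B N" by (force simp: B_def graph_def)
      with elim obtain k where "t \<in> Z N k" by blast
      then have "v N k t \<in> S" by (rule Z(3))
      then show "\<exists>n. (case_prod v) (prod_decode n) t \<in> S"
        by (intro exI[of _ "prod_encode (N, k)"]) simp
    qed
  qed
  moreover have "case_prod v (prod_decode n) \<in> selectors U" for n
    using v by (cases "prod_decode n") simp
  ultimately show ?thesis by (intro exI[of _ "\<lambda>n. case_prod v (prod_decode n)"] conjI allI)
qed

section \<open>Absolutely continuous functions and Gronwall inequalities\<close>

text \<open>
  The Bochner integral has lemmas of the same names.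
\<close>

lemmas HK_integral_combine = Henstock_Kurzweil_Integration.integral_combine
  and HK_integral_nonneg = Henstock_Kurzweil_Integration.integral_nonneg
  and HK_integral_norm_bound_integral = Henstock_Kurzweil_Integration.integral_norm_bound_integral
  and HK_integral_diff = Henstock_Kurzweil_Integration.integral_diff
  and HK_integral_mult_left = Henstock_Kurzweil_Integration.integral_mult_left
  and HK_integral_reflect_real = Henstock_Kurzweil_Integration.integral_reflect_real

lemma AE_lebesgue_on_iff_negligible:
  assumes "S \<in> sets lebesgue"
  shows "(AE t in lebesgue_on S. P t) \<longleftrightarrow> (\<exists>N. negligible N \<and> (\<forall>t\<in>S - N. P t))"
proof -
  have "(AE t in lebesgue_on S. P t) \<longleftrightarrow> (AE t in lebesgue. t \<in> S \<longrightarrow> P t)"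
    using assms by (intro AE_restrict_space_iff) auto
  also have "\<dots> \<longleftrightarrow> (\<exists>N\<in>null_sets lebesgue. {t. \<not> (t \<in> S \<longrightarrow> P t)} \<subseteq> N)"
    by (subst eventually_ae_filter) auto
  also have "\<dots> \<longleftrightarrow> (\<exists>N. negligible N \<and> (\<forall>t\<in>S - N. P t))"
    unfolding negligible_iff_null_sets by blast
  finally show ?thesis .
qed

lemma sum_lengths_division:
  fixes d :: "real set set"
  assumes "d division_of \<Union>d"
  shows "(\<Sum>k\<in>d. Sup k - Inf k) = measure lebesgue (\<Union>d)" "\<Union>d \<in> lmeasurable"
proof -
  have k: "Sup k - Inf k = measure lborel k" "k \<in> lmeasurable" "\<exists>a b. k = cbox a b" if kd: "k \<in> d" for k
  proof -
    obtain a b where "k = cbox a b" "k \<noteq> {}" using division_ofD(3,4)[OF assms kd] by blast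
    then show "Sup k - Inf k = measure lborel k" "k \<in> lmeasurable" "\<exists>a b. k = cbox a b" by auto
  qed
  show l: "\<Union>d \<in> lmeasurable"
    using k(2) division_of_finite[OF assms] by (intro fmeasurable.finite_Union) auto
  have "measure lebesgue (\<Union>d) = integral (\<Union>d) (\<lambda>_. 1)" using l by (rule lmeasure_integral)
  also have "\<dots> = (\<Sum>k\<in>d. integral k (\<lambda>_. 1 :: real))"
  proof (rule integral_combine_division_bottomup[OF assms])
    fix k assume "k \<in> d"
    from k(3)[OF this] show "(\<lambda>_. 1::real) integrable_on k" by auto
  qed
  also have "\<dots> = (\<Sum>k\<in>d. Sup k - Inf k)"
  proof (rule sum.cong)
    fix i assume "i \<in> d"
    with k(1,3)[OF this] show "integral i (\<lambda>_. 1) = Sup i - Inf i" by auto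
  qed simp
  finally show "(\<Sum>k\<in>d. Sup k - Inf k) = measure lebesgue (\<Union>d)" by simp
qed

lemma abs_cont_on_subset: "abs_cont_on S x \<Longrightarrow> T \<subseteq> S \<Longrightarrow> abs_cont_on T x"
  unfolding abs_cont_on_def by (meson order_trans)

lemma division_endpoints:
  assumes "d division_of \<Union>d" "k \<in> d"
  shows "Inf k \<in> k" "Sup k \<in> k" "Inf k \<le> (Sup k :: real)" "k = {Inf k..Sup k}"
proof -
  obtain a b where "k = cbox a b" "k \<noteq> {}" using division_ofD(3,4)[OF assms] by blast
  then show "Inf k \<in> k" "Sup k \<in> k" "Inf k \<le> Sup k" "k = {Inf k..Sup k}" by auto
qed

lemma abs_cont_onE:
  assumes "abs_cont_on S x" "\<epsilon> > 0"
  obtains \<delta> where "\<delta> > 0" "\<And>d. d division_of \<Union>d \<Longrightarrow> \<Union>d \<subseteq> S \<Longrightarrow> (\<Sum>k\<in>d. Sup k - Inf k) < \<delta>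
    \<Longrightarrow> (\<Sum>k\<in>d. norm (x (Sup k) - x (Inf k))) < \<epsilon>"
  using assms(1)[unfolded abs_cont_on_def, rule_format, OF assms(2)] by blast

text \<open>
  The criterion from which the closure properties of absolute continuity are derived: increments
  bounded by those of absolutely continuous functions.
\<close>

lemma abs_cont_on_dominated:
  fixes x :: "real \<Rightarrow> 'a::real_normed_vector" and y :: "real \<Rightarrow> 'b::real_normed_vector"
    and z :: "real \<Rightarrow> 'c::real_normed_vector"
  assumes x: "abs_cont_on S x" and y: "abs_cont_on S y"
    and le: "\<And>s t. s \<in> S \<Longrightarrow> t \<in> S \<Longrightarrow> s \<le> t \<Longrightarrow> norm (z t - z s) \<le> C * (norm (x t - x s) + norm (y t - y s))"
  shows "abs_cont_on S z"
  unfolding abs_cont_on_def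
proof (intro allI impI)
  fix \<epsilon> :: real assume "\<epsilon> > 0"
  define C' where "C' = max C 1"
  have e: "\<epsilon> / (2 * C') > 0" using \<open>\<epsilon> > 0\<close> by (simp add: C'_def)
  obtain \<delta>1 where d1: "\<delta>1 > 0" "\<And>d. d division_of \<Union>d \<Longrightarrow> \<Union>d \<subseteq> S \<Longrightarrow> (\<Sum>k\<in>d. Sup k - Inf k) < \<delta>1 \<Longrightarrow> (\<Sum>k\<in>d. norm (x (Sup k) - x (Inf k))) < \<epsilon> / (2 * C')"
    using abs_cont_onE[OF x e] by blast
  obtain \<delta>2 where d2: "\<delta>2 > 0" "\<And>d. d division_of \<Union>d \<Longrightarrow> \<Union>d \<subseteq> S \<Longrightarrow> (\<Sum>k\<in>d. Sup k - Inf k) < \<delta>2 \<Longrightarrow> (\<Sum>k\<in>d. norm (y (Sup k) - y (Inf k))) < \<epsilon> / (2 * C')"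
    using abs_cont_onE[OF y e] by blast
  show "\<exists>\<delta>>0. \<forall>d. d division_of \<Union> d \<and> \<Union> d \<subseteq> S \<and> (\<Sum>k\<in>d. Sup k - Inf k) < \<delta> \<longrightarrow>
                (\<Sum>k\<in>d. norm (z (Sup k) - z (Inf k))) < \<epsilon>"
  proof (intro exI conjI allI impI)
    show "min \<delta>1 \<delta>2 > 0" using d1 d2 by simp
    fix d assume *: "d division_of \<Union> d \<and> \<Union> d \<subseteq> S \<and> (\<Sum>k\<in>d. Sup k - Inf k) < min \<delta>1 \<delta>2"
    have "(\<Sum>k\<in>d. norm (z (Sup k) - z (Inf k))) \<le> (\<Sum>k\<in>d. C' * (norm (x (Sup k) - x (Inf k)) + norm (y (Sup k) - y (Inf k))))"
    proof (rule sum_mono)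
      fix k assume k: "k \<in> d"
      have "Inf k \<in> S" "Sup k \<in> S" "Inf k \<le> Sup k" using division_endpoints[OF _ k] * k by blast+
      then have "norm (z (Sup k) - z (Inf k)) \<le> C * (norm (x (Sup k) - x (Inf k)) + norm (y (Sup k) - y (Inf k)))"
        by (rule le)
      also have "\<dots> \<le> C' * (norm (x (Sup k) - x (Inf k)) + norm (y (Sup k) - y (Inf k)))"
        by (intro mult_right_mono) (auto simp: C'_def)
      finally show "norm (z (Sup k) - z (Inf k)) \<le> \<dots>" .
    qed
    also have "\<dots> = C' * ((\<Sum>k\<in>d. norm (x (Sup k) - x (Inf k))) + (\<Sum>k\<in>d. norm (y (Sup k) - y (Inf k))))"
      by (simp add: sum_distrib_left sum.distrib distrib_left)
    also have "\<dots> < C' * (\<epsilon> / (2 * C') + \<epsilon> / (2 * C'))"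
      using d1(2)[of d] d2(2)[of d] * by (intro mult_strict_left_mono add_strict_mono) (auto simp: C'_def)
    also have "\<dots> = \<epsilon>" by (simp add: C'_def field_simps)
    finally show "(\<Sum>k\<in>d. norm (z (Sup k) - z (Inf k))) < \<epsilon>" .
  qed
qed

lemma abs_cont_on_dominated1:
  assumes x: "abs_cont_on S x"
    and le: "\<And>s t. s \<in> S \<Longrightarrow> t \<in> S \<Longrightarrow> s \<le> t \<Longrightarrow> norm (z t - z s) \<le> C * norm (x t - x s)"
  shows "abs_cont_on S z"
  by (rule abs_cont_on_dominated[OF x x, where C = "\<bar>C\<bar>"])
     (use le in \<open>smt (verit) mult_nonneg_nonneg mult_right_mono norm_ge_zero distrib_left\<close>)

lemma abs_cont_on_cong:
  assumes "abs_cont_on S x" "\<And>t. t \<in> S \<Longrightarrow> x t = y t"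
  shows "abs_cont_on S y"
  using assms(1) by (rule abs_cont_on_dominated1[where C = 1]) (use assms(2) in simp)

lemma abs_cont_on_diff:
  "abs_cont_on S x \<Longrightarrow> abs_cont_on S y \<Longrightarrow> abs_cont_on S (\<lambda>t. x t - y t)"
  by (rule abs_cont_on_dominated[where C = 1 and x = x and y = y])
     (auto simp: algebra_simps intro: order_trans[OF _ norm_triangle_ineq4] arg_cong[where f = norm]
        intro!: order_trans[OF eq_refl norm_triangle_ineq4])

lemma abs_cont_on_bounded_linear:
  assumes "bounded_linear L" "abs_cont_on S x"
  shows "abs_cont_on S (\<lambda>t. L (x t))"
proof -
  interpret bounded_linear L by fact
  obtain K where "\<And>v. norm (L v) \<le> norm v * K" using bounded by blast
  then show ?thesis
    by (intro abs_cont_on_dominated1[OF assms(2), where C = K]) (simp add: diff[symmetric] mult.commute)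
qed

lemma abs_cont_on_imp_continuous_on:
  fixes x :: "real \<Rightarrow> 'a::real_normed_vector"
  assumes "abs_cont_on {a..b} x"
  shows "continuous_on {a..b} x"
  unfolding continuous_on_iff
proof (intro ballI allI impI)
  fix s \<epsilon> :: real assume s: "s \<in> {a..b}" and "\<epsilon> > 0"
  obtain \<delta> where d: "\<delta> > 0" "\<And>d. d division_of \<Union>d \<Longrightarrow> \<Union>d \<subseteq> {a..b} \<Longrightarrow> (\<Sum>k\<in>d. Sup k - Inf k) < \<delta>
        \<Longrightarrow> (\<Sum>k\<in>d. norm (x (Sup k) - x (Inf k))) < \<epsilon>"
    using abs_cont_onE[OF assms \<open>\<epsilon> > 0\<close>] by blast
  have *: "norm (x q - x p) < \<epsilon>" if "p \<in> {a..b}" "q \<in> {a..b}" "p \<le> q" "q - p < \<delta>" for p q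
    using d(2)[of "{{p..q}}"] that division_of_self[of p q] by auto
  show "\<exists>d>0. \<forall>x'\<in>{a..b}. dist x' s < d \<longrightarrow> dist (x x') (x s) < \<epsilon>"
  proof (intro exI conjI ballI impI)
    fix r assume "r \<in> {a..b}" "dist r s < \<delta>"
    then show "dist (x r) (x s) < \<epsilon>"
      using *[of r s] *[of s r] s by (cases "r \<le> s") (auto simp: dist_norm norm_minus_commute)
  qed (use d in auto)
qed

lemma abs_cont_on_bilinear:
  fixes x :: "real \<Rightarrow> 'a::real_normed_vector" and y :: "real \<Rightarrow> 'b::real_normed_vector"
  assumes h: "bounded_bilinear h" and x: "abs_cont_on {a..b} x" and y: "abs_cont_on {a..b} y"
  shows "abs_cont_on {a..b} (\<lambda>t. h (x t) (y t))"
proof -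
  interpret bounded_bilinear h by fact
  obtain K where K: "K > 0" "\<And>p q. norm (h p q) \<le> norm p * norm q * K" using pos_bounded by blast
  have "bounded (x ` {a..b})" "bounded (y ` {a..b})"
    using x y by (auto intro!: compact_imp_bounded compact_continuous_image abs_cont_on_imp_continuous_on)
  then obtain B1 B2 where B: "\<And>t. t \<in> {a..b} \<Longrightarrow> norm (x t) \<le> B1" "\<And>t. t \<in> {a..b} \<Longrightarrow> norm (y t) \<le> B2"
    unfolding bounded_iff by blast
  show ?thesis
  proof (rule abs_cont_on_dominated[OF x y, where C = "K * max B1 B2"])
    fix s t assume st: "s \<in> {a..b}" "t \<in> {a..b}"
    have "h (x t) (y t) - h (x s) (y s) = h (x t - x s) (y t) + h (x s) (y t - y s)"
      by (simp add: diff_left diff_right)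
    then have "norm (h (x t) (y t) - h (x s) (y s)) \<le> norm (h (x t - x s) (y t)) + norm (h (x s) (y t - y s))"
      by (simp add: norm_triangle_ineq)
    also have "\<dots> \<le> norm (x t - x s) * norm (y t) * K + norm (x s) * norm (y t - y s) * K"
      by (intro add_mono K)
    also have "\<dots> \<le> norm (x t - x s) * max B1 B2 * K + max B1 B2 * norm (y t - y s) * K"
      using B(1)[OF st(1)] B(2)[OF st(2)] K(1) by (intro add_mono mult_right_mono mult_left_mono) auto
    finally show "norm (h (x t) (y t) - h (x s) (y s)) \<le> K * max B1 B2 * (norm (x t - x s) + norm (y t - y s))"
      by (simp add: algebra_simps)
  qed
qed

text \<open>
  The fundamental theorem of calculus for absolutely continuous functions, proved with gauges. At a
  point of differentiability a fine interval is straddled as usual. The exceptional null set, on which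
  the integrand is set to \<open>0\<close>, is covered by an open set of measure less than the \<open>\<delta>\<close> of absolute
  continuity; intervals tagged in it and contained in the cover contribute little.
\<close>

lemma abs_cont_FTC:
  fixes x :: "real \<Rightarrow> 'a::euclidean_space"
  assumes "a \<le> b" and ac: "abs_cont_on {a..b} x" and N: "negligible N"
    and F: "\<And>t. t \<in> {a<..<b} - N \<Longrightarrow> (x has_vector_derivative F t) (at t)"
  shows "(F has_integral (x b - x a)) {a..b}"
proof (cases "a = b")
  case True then show ?thesis by auto
next
  case False
  with \<open>a \<le> b\<close> have "a < b" by simp
  define M where "M = N \<union> {a, b}"
  have M: "negligible M" using N by (simp add: M_def)
  define G where "G t = (if t \<in> M then 0 else F t)" for t
  have "(G has_integral (x b - x a)) (cbox a b)"
    unfolding has_integral_factor_content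
  proof (intro allI impI)
    fix e :: real assume e: "e > 0"
    define e' where "e' = e * (b - a) / 2"
    have "e' > 0" using e \<open>a < b\<close> by (simp add: e'_def)
    obtain \<delta> where \<delta>: "\<delta> > 0" "\<And>d. d division_of \<Union>d \<Longrightarrow> \<Union>d \<subseteq> {a..b} \<Longrightarrow> (\<Sum>k\<in>d. Sup k - Inf k) < \<delta>
        \<Longrightarrow> (\<Sum>k\<in>d. norm (x (Sup k) - x (Inf k))) < e'"
      using abs_cont_onE[OF ac \<open>e' > 0\<close>] by blast
    obtain W where W: "open W" "M \<subseteq> W" "W - M \<in> lmeasurable" "emeasure lebesgue (W - M) < ennreal \<delta>"
      using sets_lebesgue_outer_open[OF negligible_imp_sets[OF M] \<delta>(1)] by metis
    have WM: "W = (W - M) \<union> M" using W(2) by blast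
    have Ml: "M \<in> lmeasurable" "measure lebesgue M = 0" using M by (simp_all add: negligible_iff_measure)
    have Wl: "W \<in> lmeasurable" by (subst WM) (rule fmeasurable.Un[OF W(3) Ml(1)])
    have "measure lebesgue W \<le> measure lebesgue (W - M) + measure lebesgue M"
      by (subst WM) (rule measure_Un_le; use W(3) Ml in auto)
    moreover have "measure lebesgue (W - M) < \<delta>"
      using W(3,4) \<delta>(1) by (simp add: emeasure_eq_measure2 ennreal_less_iff)
    ultimately have mW: "measure lebesgue W < \<delta>" using Ml(2) by simp
    have "\<exists>d>0. t \<in> {a..b} - M \<longrightarrow> (\<forall>y. \<bar>y - t\<bar> < d \<longrightarrow> norm (x y - x t - (y - t) *\<^sub>R F t) \<le> e / 2 * \<bar>y - t\<bar>)" for t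
    proof (cases "t \<in> {a..b} - M")
      case True
      then have "(x has_vector_derivative F t) (at t)" by (intro F) (auto simp: M_def)
      then have "\<forall>e>0. \<exists>d>0. \<forall>y. \<bar>y - t\<bar> < d \<longrightarrow> norm (x y - x t - (y - t) *\<^sub>R F t) \<le> e * \<bar>y - t\<bar>"
        unfolding has_vector_derivative_def has_derivative_within_alt by simp
      from this[rule_format, OF half_gt_zero[OF e]] show ?thesis by blast
    qed (auto intro: exI[of _ 1])
    then obtain d where d: "\<And>t. d t > 0"
      "\<And>t y. t \<in> {a..b} - M \<Longrightarrow> \<bar>y - t\<bar> < d t \<Longrightarrow> norm (x y - x t - (y - t) *\<^sub>R F t) \<le> e / 2 * \<bar>y - t\<bar>"
      by metis
    define \<gamma> where "\<gamma> t = (if t \<in> M then W else ball t (d t))" for t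
    have gauge: "gauge \<gamma>" using d(1) W(1,2) by (auto simp: gauge_def \<gamma>_def)
    have fine: "norm ((\<Sum>(t, k)\<in>p. measure lborel k *\<^sub>R G t) - (x b - x a)) \<le> e * measure lborel (cbox a b)"
      if p: "p tagged_division_of cbox a b" "\<gamma> fine p" for p
    proof -
      have fp: "finite p" using p(1) by (rule tagged_division_of_finite)
      have k: "\<exists>u v. k = {u..v} \<and> u \<le> t \<and> t \<le> v \<and> {u..v} \<subseteq> {a..b}" if "(t, k) \<in> p" for t k
        using tagged_division_ofD(2,3,4)[OF p(1) that] by fastforce
      have ba: "b - a = (\<Sum>(t, k)\<in>p. Sup k - Inf k)" "x b - x a = (\<Sum>(t, k)\<in>p. x (Sup k) - x (Inf k))"
        using additive_tagged_division_1[where f = "\<lambda>x. x"] additive_tagged_division_1[where f = x]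
            \<open>a \<le> b\<close> p(1) by auto
      define p1 where "p1 = {(t, k) \<in> p. t \<in> M}"
      have p1: "p1 \<subseteq> p" "finite p1" unfolding p1_def using fp by (auto intro: finite_subset)
      have p1d: "p1 tagged_division_of \<Union>(snd ` p1)"
        using p(1) p1 by (meson tagged_division_of_def tagged_partial_division_of_Union_self tagged_partial_division_subset)
      have bad: "(\<Sum>(t, k)\<in>p1. norm (measure lborel k *\<^sub>R G t - (x (Sup k) - x (Inf k)))) < e'"
      proof -
        have dd: "snd ` p1 division_of \<Union>(snd ` p1)" by (rule division_of_tagged_division[OF p1d])
        have "\<Union>(snd ` p1) \<subseteq> W" using p(2) unfolding fine_def p1_def \<gamma>_def by fastforce
        then have "measure lebesgue (\<Union>(snd ` p1)) \<le> measure lebesgue W"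
          using Wl sum_lengths_division(2)[OF dd] by (intro measure_mono_fmeasurable) auto
        then have "(\<Sum>k\<in>snd ` p1. Sup k - Inf k) < \<delta>" using mW sum_lengths_division(1)[OF dd] by simp
        moreover have "\<Union>(snd ` p1) \<subseteq> {a..b}" using k p1 by fastforce
        ultimately have "(\<Sum>k\<in>snd ` p1. norm (x (Sup k) - x (Inf k))) < e'" using \<delta>(2)[OF dd] by blast
        moreover have "(\<Sum>(t, k)\<in>p1. norm (measure lborel k *\<^sub>R G t - (x (Sup k) - x (Inf k))))
            = (\<Sum>(t, k)\<in>p1. norm (x (Sup k) - x (Inf k)))"
          by (intro sum.cong) (auto simp: p1_def G_def norm_minus_commute)
        moreover have "\<dots> = (\<Sum>k\<in>snd ` p1. if k = {} then 0 else norm (x (Sup k) - x (Inf k)))"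
        proof -
          have "(\<Sum>(t, k)\<in>p1. norm (x (Sup k) - x (Inf k))) = (\<Sum>(t, k)\<in>p1. if k = {} then 0 else norm (x (Sup k) - x (Inf k)))"
            using k p1 by (intro sum.cong) fastforce+
          also have "\<dots> = (\<Sum>k\<in>snd ` p1. if k = {} then 0 else norm (x (Sup k) - x (Inf k)))"
            by (rule sum.over_tagged_division_lemma[OF p1d]) (auto simp: not_less)
          finally show ?thesis .
        qed
        moreover have "\<dots> = (\<Sum>k\<in>snd ` p1. norm (x (Sup k) - x (Inf k)))"
          using k p1 by (intro sum.cong) fastforce+
        ultimately show ?thesis by simp
      qed
      have good: "(\<Sum>(t, k)\<in>p - p1. norm (measure lborel k *\<^sub>R G t - (x (Sup k) - x (Inf k)))) \<le> (\<Sum>(t, k)\<in>p - p1. e / 2 * (Sup k - Inf k))"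
      proof (rule sum_mono, clarify)
        fix t k assume tk: "(t, k) \<in> p" "(t, k) \<notin> p1"
        then have t: "t \<notin> M" by (auto simp: p1_def)
        obtain u v where uv: "k = {u..v}" "u \<le> t" "t \<le> v" "{u..v} \<subseteq> {a..b}" using k[OF tk(1)] by blast
        have kb: "k \<subseteq> ball t (d t)" using p(2) tk(1) t unfolding fine_def \<gamma>_def by fastforce
        have "u \<in> k" "v \<in> k" using uv by auto
        then have "u \<in> ball t (d t)" "v \<in> ball t (d t)" using kb by blast+
        then have du: "\<bar>u - t\<bar> < d t" "\<bar>v - t\<bar> < d t" by (auto simp: dist_real_def abs_minus_commute)
        have tM: "t \<in> {a..b} - M" using t uv by auto
        have "measure lborel k *\<^sub>R G t - (x (Sup k) - x (Inf k)) = (x u - x t - (u - t) *\<^sub>R F t) - (x v - x t - (v - t) *\<^sub>R F t)"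
          using uv t by (simp add: G_def algebra_simps)
        then have "norm (measure lborel k *\<^sub>R G t - (x (Sup k) - x (Inf k))) \<le> norm (x u - x t - (u - t) *\<^sub>R F t) + norm (x v - x t - (v - t) *\<^sub>R F t)"
          by (simp only: norm_triangle_ineq4)
        also have "\<dots> \<le> e / 2 * \<bar>u - t\<bar> + e / 2 * \<bar>v - t\<bar>" by (intro add_mono d(2) tM du)
        also have "\<dots> = e / 2 * (Sup k - Inf k)" using uv by (simp add: field_simps)
        finally show "norm (measure lborel k *\<^sub>R G t - (x (Sup k) - x (Inf k))) \<le> e / 2 * (Sup k - Inf k)" .
      qed
      have "(\<Sum>(t, k)\<in>p - p1. e / 2 * (Sup k - Inf k)) \<le> (\<Sum>(t, k)\<in>p. e / 2 * (Sup k - Inf k))"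
      proof (rule sum_mono2[OF fp])
        fix q assume "q \<in> p - (p - p1)"
        then obtain t k where q: "q = (t, k)" "(t, k) \<in> p" by (cases q) auto
        from k[OF q(2)] e show "0 \<le> (case q of (t, k) \<Rightarrow> e / 2 * (Sup k - Inf k))" by (auto simp: q(1))
      qed auto
      also have "\<dots> = e / 2 * (b - a)" unfolding ba(1) by (simp add: sum_distrib_left case_prod_beta)
      finally have good': "(\<Sum>(t, k)\<in>p - p1. norm (measure lborel k *\<^sub>R G t - (x (Sup k) - x (Inf k)))) \<le> e / 2 * (b - a)"
        using good by simp
      have "norm ((\<Sum>(t, k)\<in>p. measure lborel k *\<^sub>R G t) - (x b - x a)) = norm (\<Sum>(t, k)\<in>p. measure lborel k *\<^sub>R G t - (x (Sup k) - x (Inf k)))"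
        unfolding ba(2) by (simp add: sum_subtractf case_prod_beta)
      also have "\<dots> \<le> (\<Sum>(t, k)\<in>p. norm (measure lborel k *\<^sub>R G t - (x (Sup k) - x (Inf k))))"
        by (rule sum_norm_le) auto
      also have "\<dots> = (\<Sum>(t, k)\<in>p - p1. norm (measure lborel k *\<^sub>R G t - (x (Sup k) - x (Inf k)))) + (\<Sum>(t, k)\<in>p1. norm (measure lborel k *\<^sub>R G t - (x (Sup k) - x (Inf k))))"
        by (rule sum.subset_diff[OF p1(1) fp])
      also have "\<dots> \<le> e / 2 * (b - a) + e'" using good' bad by simp
      also have "\<dots> = e * measure lborel (cbox a b)" using \<open>a < b\<close> by (simp add: e'_def field_simps)
      finally show ?thesis .
    qed
    show "\<exists>\<gamma>. gauge \<gamma> \<and> (\<forall>p. p tagged_division_of cbox a b \<and> \<gamma> fine p \<longrightarrow>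
       norm ((\<Sum>(t, k)\<in>p. measure lborel k *\<^sub>R G t) - (x b - x a)) \<le> e * measure lborel (cbox a b))"
      by (intro exI[of _ \<gamma>] conjI allI impI gauge) (elim conjE, rule fine)
  qed
  then show ?thesis
    using has_integral_spike[OF M, of "{a..b}" F G] by (auto simp: G_def)
qed


text \<open>
  Truncate the norm of \<open>F\<close> at a level \<open>n\<close> for which the truncated part has small integral; what is left is
  bounded by \<open>n\<close>, so its integral is small over sets of small measure.
\<close>

lemma abs_cont_on_integral:
  fixes F :: "real \<Rightarrow> 'a::euclidean_space"
  assumes F: "F absolutely_integrable_on {a..b}"
  shows "abs_cont_on {a..b} (\<lambda>t. integral {a..t} F)"
  unfolding abs_cont_on_def
proof (intro allI impI)
  fix \<epsilon> :: real assume "\<epsilon> > 0"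
  have G: "(\<lambda>t. norm (F t)) absolutely_integrable_on {a..b}" using F by (rule absolutely_integrable_norm[unfolded o_def])
  define H where "H n t = min (norm (F t)) (real n)" for n t
  have H: "H n absolutely_integrable_on {a..b}" for n
    unfolding H_def by (intro absolutely_integrable_min_1 G absolutely_integrable_on_const) auto
  have Hle: "H n t \<le> norm (F t)" "H n t \<le> real n" for n t by (auto simp: H_def)
  have "(\<lambda>n. integral {a..b} (H n)) \<longlonglongrightarrow> integral {a..b} (\<lambda>t. norm (F t))"
  proof (rule dominated_convergence(2))
    fix t
    obtain m where m: "norm (F t) \<le> real m" using real_arch_simple by blast
    show "(\<lambda>n. H n t) \<longlonglongrightarrow> norm (F t)"
      by (rule tendsto_eventually, rule eventually_sequentiallyI[of m]) (use m in \<open>auto simp: H_def\<close>)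
  qed (use H G in \<open>auto simp: H_def absolutely_integrable_on_def\<close>)
  then obtain n where n: "dist (integral {a..b} (H n)) (integral {a..b} (\<lambda>t. norm (F t))) < \<epsilon> / 2"
    using \<open>\<epsilon> > 0\<close> by (metis LIMSEQ_def half_gt_zero order_refl)
  show "\<exists>\<delta>>0. \<forall>d. d division_of \<Union> d \<and> \<Union> d \<subseteq> {a..b} \<and> (\<Sum>k\<in>d. Sup k - Inf k) < \<delta> \<longrightarrow>
                (\<Sum>k\<in>d. norm (integral {a..Sup k} F - integral {a..Inf k} F)) < \<epsilon>"
  proof (intro exI conjI allI impI)
    let ?\<delta> = "\<epsilon> / (2 * (real n + 1))"
    show "?\<delta> > 0" using \<open>\<epsilon> > 0\<close> by simp
    fix d assume *: "d division_of \<Union> d \<and> \<Union> d \<subseteq> {a..b} \<and> (\<Sum>k\<in>d. Sup k - Inf k) < ?\<delta>"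
    note d = division_endpoints[OF conjunct1[OF *]] sum_lengths_division[OF conjunct1[OF *]]
    have sub: "(\<lambda>t. norm (F t)) integrable_on S" "H n integrable_on S" "F integrable_on S"
      if "S \<in> sets lebesgue" "S \<subseteq> {a..b}" for S
      using set_integrable_subset[OF G that] set_integrable_subset[OF F that] set_integrable_subset[OF H[of n] that]
      by (auto simp: absolutely_integrable_on_def)
    have ud: "\<Union>d \<in> sets lebesgue" using d(6) by (rule fmeasurableD)
    have "(\<Sum>k\<in>d. norm (integral {a..Sup k} F - integral {a..Inf k} F)) \<le> (\<Sum>k\<in>d. integral k (\<lambda>t. norm (F t)))"
    proof (rule sum_mono)
      fix k assume k: "k \<in> d"
      have kab: "k \<subseteq> {a..b}" using * k by blast
      then have "Inf k \<in> {a..b}" "Sup k \<in> {a..b}" using d(1,2)[OF k] by blast+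
      then have "integral {a..Inf k} F + integral {Inf k..Sup k} F = integral {a..Sup k} F"
        using d(3)[OF k] by (intro HK_integral_combine sub(3)) auto
      then have "integral {a..Sup k} F - integral {a..Inf k} F = integral k F"
        using d(4)[OF k] by (metis add_diff_cancel_left')
      also have "norm \<dots> \<le> integral k (\<lambda>t. norm (F t))"
      proof (rule HK_integral_norm_bound_integral)
        have "k \<in> sets lebesgue" by (subst d(4)[OF k]) simp
        then show "F integrable_on k" "(\<lambda>t. norm (F t)) integrable_on k" using kab sub by auto
      qed simp
      finally show "norm (integral {a..Sup k} F - integral {a..Inf k} F) \<le> integral k (\<lambda>t. norm (F t))" .
    qed
    also have "\<dots> = integral (\<Union>d) (\<lambda>t. norm (F t))"
      using * ud by (intro integral_combine_division_topdown[symmetric] sub(1)) auto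
    also have "\<dots> = integral (\<Union>d) (\<lambda>t. norm (F t) - H n t) + integral (\<Union>d) (H n)"
      using * ud by (simp add: HK_integral_diff sub)
    also have "\<dots> \<le> integral {a..b} (\<lambda>t. norm (F t) - H n t) + integral (\<Union>d) (\<lambda>_. real n)"
    proof (intro add_mono integral_subset_le integral_le)
      show "(\<lambda>_. real n) integrable_on \<Union>d" using d(6) by (rule integrable_on_const)
    qed (use * ud Hle in \<open>auto intro!: integrable_diff sub\<close>)
    also have "\<dots> = (integral {a..b} (\<lambda>t. norm (F t)) - integral {a..b} (H n)) + real n * measure lebesgue (\<Union>d)"
      using d(6) by (simp add: HK_integral_diff sub lmeasure_integral
          Henstock_Kurzweil_Integration.integral_mult_right[symmetric, where f = "\<lambda>_. 1"])
    also have "\<dots> \<le> (integral {a..b} (\<lambda>t. norm (F t)) - integral {a..b} (H n)) + real n * ?\<delta>"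
      using * d(5) by (intro add_left_mono mult_left_mono) auto
    also have "\<dots> < \<epsilon> / 2 + \<epsilon> / 2"
    proof (rule add_less_le_mono)
      show "integral {a..b} (\<lambda>t. norm (F t)) - integral {a..b} (H n) < \<epsilon> / 2" using n unfolding dist_real_def by linarith
      show "real n * ?\<delta> \<le> \<epsilon> / 2" using \<open>\<epsilon> > 0\<close> by (simp add: field_simps)
    qed
    finally show "(\<Sum>k\<in>d. norm (integral {a..Sup k} F - integral {a..Inf k} F)) < \<epsilon>" by simp
  qed
qed

text \<open>
  The result \<open>integrable_ccontinuous_explicit\<close> is the differentiability from the right. Applied also to the
  time-reversed function, it gives the two-sided derivative.
\<close>

lemma integral_has_derivative_ae:
  fixes F :: "real \<Rightarrow> 'a::euclidean_space"
  assumes F: "F integrable_on {a..b}"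
  obtains N where "negligible N"
    "\<And>t. t \<in> {a<..<b} - N \<Longrightarrow> ((\<lambda>s. integral {a..s} F) has_vector_derivative F t) (at t)"
proof -
  define F0 where "F0 t = (if t \<in> {a..b} then F t else 0)" for t
  have "F0 integrable_on UNIV" unfolding F0_def using F by (simp only: integrable_restrict_UNIV)
  then have F0: "F0 integrable_on {p..q}" for p q
    using integrable_on_subcbox[of F0 UNIV p q] by simp
  then have F1: "(\<lambda>t. F0 (- t)) integrable_on {p..q}" for p q
    using Henstock_Kurzweil_Integration.integrable_reflect_real[of F0 "-p" "-q"] by simp
  have ex: "\<exists>N. negligible N \<and> (\<forall>x e. x \<notin> N \<longrightarrow> 0 < e \<longrightarrow>
      (\<exists>d>0. \<forall>h. 0 < h \<and> h < d \<longrightarrow> norm (integral {x..x + h} f - h *\<^sub>R f x) \<le> e * h))"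
    if "\<And>p q. f integrable_on {p..q}" for f :: "real \<Rightarrow> 'a"
  proof -
    have "f integrable_on cbox p q" for p q using that by simp
    from integrable_ccontinuous_explicit[OF this] obtain N where N: "negligible N"
       "\<And>x e. \<lbrakk>x \<notin> N; 0 < e\<rbrakk> \<Longrightarrow> \<exists>d>0. \<forall>h. 0 < h \<and> h < d \<longrightarrow> norm (integral {x..x + h} f /\<^sub>R h - f x) < e"
      by auto
    have *: "norm (integral {x..x + h} f - h *\<^sub>R f x) \<le> e * h"
      if "0 < h" "norm (integral {x..x + h} f /\<^sub>R h - f x) < e" for x e h
    proof -
      have "integral {x..x + h} f - h *\<^sub>R f x = h *\<^sub>R (integral {x..x + h} f /\<^sub>R h - f x)"
        using that by (simp add: scaleR_right_diff_distrib)
      then have "norm (integral {x..x + h} f - h *\<^sub>R f x) = h * norm (integral {x..x + h} f /\<^sub>R h - f x)"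
        using that(1) by simp
      also have "\<dots> \<le> h * e" using that by (intro mult_left_mono) auto
      finally show ?thesis by (simp add: mult.commute)
    qed
    show ?thesis using N * by (intro exI[of _ N]) meson
  qed
  obtain N1 where N1: "negligible N1" "\<And>x e. x \<notin> N1 \<Longrightarrow> 0 < e \<Longrightarrow>
      \<exists>d>0. \<forall>h. 0 < h \<and> h < d \<longrightarrow> norm (integral {x..x + h} F0 - h *\<^sub>R F0 x) \<le> e * h"
    using ex[of F0, OF F0] by blast
  obtain N2 where N2: "negligible N2" "\<And>x e. x \<notin> N2 \<Longrightarrow> 0 < e \<Longrightarrow>
      \<exists>d>0. \<forall>h. 0 < h \<and> h < d \<longrightarrow> norm (integral {x..x + h} (\<lambda>t. F0 (- t)) - h *\<^sub>R F0 (- x)) \<le> e * h"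
    using ex[of "\<lambda>t. F0 (- t)", OF F1] by blast
  show ?thesis
  proof
    have "negligible {t \<in> UNIV. - t \<in> N2}"
      by (rule negligible_differentiable_vimage[OF N2(1), where f' = "\<lambda>_. uminus"]) (auto intro!: derivative_eq_intros simp: inj_def)
    moreover have "uminus ` N2 = {t \<in> UNIV. - t \<in> N2}" by force
    ultimately show "negligible (N1 \<union> uminus ` N2)" using N1(1) by simp
    fix t assume t: "t \<in> {a<..<b} - (N1 \<union> uminus ` N2)"
    have IF: "integral {p..q} F = integral {p..q} F0" if "p \<ge> a" "q \<le> b" for p q
      using that by (intro Henstock_Kurzweil_Integration.integral_cong) (auto simp: F0_def)
    show "((\<lambda>s. integral {a..s} F) has_vector_derivative F t) (at t)"
      unfolding has_vector_derivative_def has_derivative_within_alt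
    proof (intro conjI allI impI)
      show "bounded_linear (\<lambda>h. h *\<^sub>R F t)" by (rule bounded_linear_scaleR_left)
      fix e :: real assume "0 < e"
      obtain d1 where d1: "d1 > 0" "\<And>h. 0 < h \<Longrightarrow> h < d1 \<Longrightarrow> norm (integral {t..t + h} F0 - h *\<^sub>R F0 t) \<le> e * h"
        using N1(2)[OF _ \<open>0 < e\<close>, of t] t by blast
      have "- t \<notin> N2" using t by (auto simp: image_iff)
      then obtain d2 where d2: "d2 > 0" "\<And>h. 0 < h \<Longrightarrow> h < d2 \<Longrightarrow> norm (integral {-t..-t + h} (\<lambda>t. F0 (- t)) - h *\<^sub>R F0 t) \<le> e * h"
        using N2(2)[OF _ \<open>0 < e\<close>, of "-t"] by auto
      show "\<exists>d>0. \<forall>y\<in>UNIV. norm (y - t) < d \<longrightarrow>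
          norm (integral {a..y} F - integral {a..t} F - (y - t) *\<^sub>R F t) \<le> e * norm (y - t)"
      proof (intro exI conjI ballI impI)
        show "Min {d1, d2, b - t, t - a} > 0" using d1 d2 t by auto
        fix y assume y: "norm (y - t) < Min {d1, d2, b - t, t - a}"
        consider "y = t" | "t < y" | "y < t" by linarith
        then show "norm (integral {a..y} F - integral {a..t} F - (y - t) *\<^sub>R F t) \<le> e * norm (y - t)"
        proof cases
          case 2
          have "integral {a..t} F + integral {t..y} F = integral {a..y} F"
            using y t 2 by (intro HK_integral_combine integrable_on_subinterval[OF F]) auto
          moreover have "integral {t..y} F = integral {t..t + (y - t)} F0" using y t 2 by (subst IF) auto
          ultimately have "integral {a..y} F - integral {a..t} F - (y - t) *\<^sub>R F t
             = integral {t..t + (y - t)} F0 - (y - t) *\<^sub>R F0 t"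
            using t by (simp add: F0_def algebra_simps)
          then show ?thesis using d1(2)[of "y - t"] y t 2 by simp
        next
          case 3
          have "integral {a..y} F + integral {y..t} F = integral {a..t} F"
            using y t 3 by (intro HK_integral_combine integrable_on_subinterval[OF F]) auto
          moreover have "integral {y..t} F = integral {-t..-t + (t - y)} (\<lambda>t. F0 (- t))"
            using y t 3 by (subst IF) (auto simp: HK_integral_reflect_real[where a = y and b = t, of F0])
          ultimately have "integral {a..y} F - integral {a..t} F - (y - t) *\<^sub>R F t
             = - (integral {-t..-t + (t - y)} (\<lambda>t. F0 (- t)) - (t - y) *\<^sub>R F0 t)"
            using t by (simp add: F0_def algebra_simps)
          then have "norm (integral {a..y} F - integral {a..t} F - (y - t) *\<^sub>R F t)
             = norm (integral {-t..-t + (t - y)} (\<lambda>t. F0 (- t)) - (t - y) *\<^sub>R F0 t)"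
            by (simp only: norm_minus_cancel)
          also have "\<dots> \<le> e * (t - y)" using y 3 by (intro d2(2)) auto
          also have "t - y = norm (y - t)" using 3 by simp
          finally show ?thesis .
        qed simp
      qed
    qed
  qed
qed

text \<open>
  With \<open>W\<close> the right-hand side of the hypothesis and \<open>\<Lambda>\<close> the integral of \<open>l\<close>, the function \<open>W * exp (- \<Lambda>)\<close>
  is absolutely continuous and its derivative is nonpositive almost everywhere.
\<close>

lemma gronwall:
  fixes w l :: "real \<Rightarrow> real"
  assumes w: "continuous_on {a..b} w" and l: "l integrable_on {a..b}" "\<And>t. t \<in> {a..b} \<Longrightarrow> 0 \<le> l t"
    and le: "\<And>t. t \<in> {a..b} \<Longrightarrow> w t \<le> c + integral {a..t} (\<lambda>s. l s * w s)" and t: "t \<in> {a..b}"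
  shows "w t \<le> c * exp (integral {a..t} l)"
proof -
  have l': "l absolutely_integrable_on {a..b}"
    using l by (intro nonnegative_absolutely_integrable_1)
  have lw: "(\<lambda>s. l s * w s) absolutely_integrable_on {a..b}"
  proof -
    have "(\<lambda>s. w s * l s) absolutely_integrable_on {a..b}"
      using w l' by (intro absolutely_integrable_bounded_measurable_product_real compact_imp_bounded compact_continuous_image
         continuous_imp_measurable_on_sets_lebesgue) auto
    then show ?thesis by (simp add: mult.commute)
  qed
  define W where "W t = c + integral {a..t} (\<lambda>s. l s * w s)" for t
  define \<Lambda> where "\<Lambda> t = integral {a..t} l" for t
  have Wac: "abs_cont_on {a..b} W"
    by (rule abs_cont_on_dominated1[OF abs_cont_on_integral[OF lw], where C = 1]) (simp add: W_def)
  have Lac: "abs_cont_on {a..b} \<Lambda>" unfolding \<Lambda>_def by (rule abs_cont_on_integral[OF l'])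
  have L0: "0 \<le> \<Lambda> t" if "t \<in> {a..b}" for t
    unfolding \<Lambda>_def using that by (intro HK_integral_nonneg integrable_on_subinterval[OF l(1)] l(2)) auto
  have Eac: "abs_cont_on {a..b} (\<lambda>t. exp (- \<Lambda> t))"
  proof (rule abs_cont_on_dominated1[OF Lac, where C = 1])
    fix s t assume "s \<in> {a..b}" "t \<in> {a..b}"
    have *: "\<bar>exp (- p) - exp (- q)\<bar> \<le> \<bar>p - q\<bar>" if "0 \<le> p" "0 \<le> q" "p \<le> q" for p q :: real
    proof -
      have "exp (- q) = exp (- p) * exp (- (q - p))" by (simp add: exp_add[symmetric])
      moreover have "1 - (q - p) \<le> exp (- (q - p))" using exp_ge_add_one_self[of "- (q - p)"] by linarith
      ultimately have "exp (- p) - exp (- q) \<le> exp (- p) * (q - p)"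
        using mult_left_mono[of "1 - (q - p)" "exp (- (q - p))" "exp (- p)"] by (simp add: algebra_simps)
      also have "\<dots> \<le> 1 * (q - p)" using that by (intro mult_right_mono) auto
      finally show ?thesis using that by simp
    qed
    show "norm (exp (- \<Lambda> t) - exp (- \<Lambda> s)) \<le> 1 * norm (\<Lambda> t - \<Lambda> s)"
      using *[of "\<Lambda> t" "\<Lambda> s"] *[of "\<Lambda> s" "\<Lambda> t"] L0[OF \<open>s \<in> {a..b}\<close>] L0[OF \<open>t \<in> {a..b}\<close>]
      by (cases "\<Lambda> t \<le> \<Lambda> s") (auto simp: abs_minus_commute)
  qed
  have Zac: "abs_cont_on {a..b} (\<lambda>t. W t * exp (- \<Lambda> t))"
    by (rule abs_cont_on_bilinear[OF bounded_bilinear_mult Wac Eac])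
  obtain N1 where N1: "negligible N1" "\<And>t. t \<in> {a<..<b} - N1 \<Longrightarrow> ((\<lambda>s. integral {a..s} (\<lambda>s. l s * w s)) has_vector_derivative l t * w t) (at t)"
    using integral_has_derivative_ae[of "\<lambda>s. l s * w s" a b] lw by (auto simp: absolutely_integrable_on_def)
  obtain N2 where N2: "negligible N2" "\<And>t. t \<in> {a<..<b} - N2 \<Longrightarrow> (\<Lambda> has_vector_derivative l t) (at t)"
    using integral_has_derivative_ae[OF l(1)] unfolding \<Lambda>_def by blast
  have at: "a \<le> t" using t by simp
  have "((\<lambda>s. - (l s * exp (- \<Lambda> s) * (W s - w s))) has_integral (W t * exp (- \<Lambda> t) - W a * exp (- \<Lambda> a))) {a..t}"
  proof (rule abs_cont_FTC[OF at _ negligible_Un[OF N1(1) N2(1)]])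
    show "abs_cont_on {a..t} (\<lambda>t. W t * exp (- \<Lambda> t))" using Zac by (rule abs_cont_on_subset) (use t in auto)
    fix s assume s: "s \<in> {a<..<t} - (N1 \<union> N2)"
    have "(W has_real_derivative l s * w s) (at s)"
      using N1(2)[of s] s t unfolding W_def
      by (auto intro!: derivative_eq_intros simp: has_real_derivative_iff_has_vector_derivative)
    moreover have "(\<Lambda> has_real_derivative l s) (at s)"
      using N2(2)[of s] s t by (auto simp: has_real_derivative_iff_has_vector_derivative)
    ultimately show "((\<lambda>t. W t * exp (- \<Lambda> t)) has_vector_derivative - (l s * exp (- \<Lambda> s) * (W s - w s))) (at s)"
      unfolding has_real_derivative_iff_has_vector_derivative[symmetric]
      by (auto intro!: derivative_eq_intros simp: algebra_simps)
  qed
  then have "W t * exp (- \<Lambda> t) - W a * exp (- \<Lambda> a) \<le> 0"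
  proof (rule has_integral_le[OF _ has_integral_0])
    fix s assume "s \<in> {a..t}"
    then have "s \<in> {a..b}" using t by auto
    then show "- (l s * exp (- \<Lambda> s) * (W s - w s)) \<le> 0" using le[of s] l(2)[of s] by (simp add: W_def)
  qed
  then have "W t * exp (- \<Lambda> t) \<le> c" by (simp add: W_def \<Lambda>_def)
  then have "W t * exp (- \<Lambda> t) * exp (\<Lambda> t) \<le> c * exp (\<Lambda> t)" by (intro mult_right_mono) auto
  then have "W t \<le> c * exp (\<Lambda> t)" by (simp add: mult.assoc exp_add[symmetric])
  then show ?thesis using le[OF t] by (simp add: W_def \<Lambda>_def)
qed

text \<open>
  The times \<open>s\<close> and \<open>t\<close> may be in either order, since the hypothesis is invariant under reversal of
  time. The backward estimate is what makes flows injective and variational matrices invertible.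
\<close>

lemma abs_cont_gronwall:
  fixes z :: "real \<Rightarrow> 'a::euclidean_space"
  assumes z: "abs_cont_on {a..b} z" and N: "negligible N"
    and D: "\<And>t. t \<in> {a<..<b} - N \<Longrightarrow> (z has_vector_derivative D t) (at t)"
    and le: "\<And>t. t \<in> {a<..<b} - N \<Longrightarrow> norm (D t) \<le> l t * norm (z t) + e t"
    and l: "l integrable_on {a..b}" "\<And>t. t \<in> {a..b} \<Longrightarrow> 0 \<le> l t"
    and e: "e integrable_on {a..b}" "\<And>t. t \<in> {a..b} \<Longrightarrow> 0 \<le> e t"
    and st: "s \<in> {a..b}" "t \<in> {a..b}"
  shows "norm (z t) \<le> (norm (z s) + integral {a..b} e) * exp (integral {a..b} l)"
proof -
  have zc: "continuous_on {a..b} z" using z by (rule abs_cont_on_imp_continuous_on)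
  have l': "l absolutely_integrable_on {a..b}"
    using l by (intro nonnegative_absolutely_integrable_1)
  have lz: "(\<lambda>s. l s * norm (z s)) integrable_on {a..b}"
  proof -
    have "(\<lambda>s. norm (z s) * l s) absolutely_integrable_on {a..b}"
      using zc l' by (intro absolutely_integrable_bounded_measurable_product_real compact_imp_bounded compact_continuous_image
         continuous_imp_measurable_on_sets_lebesgue) (auto intro!: continuous_intros)
    then show ?thesis by (simp add: mult.commute absolutely_integrable_on_def)
  qed
  have step: "norm (z q - z p) \<le> integral {p..q} (\<lambda>s. l s * norm (z s)) + integral {a..b} e"
    if pq: "p \<in> {a..b}" "q \<in> {a..b}" "p \<le> q" for p q
  proof -
    define D' where "D' t = (if t \<in> N \<union> {p, q} then 0 else D t)" for t
    have "(D' has_integral (z q - z p)) {p..q}"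
    proof (rule abs_cont_FTC[OF pq(3)])
      show "abs_cont_on {p..q} z" using z by (rule abs_cont_on_subset) (use pq in auto)
      show "negligible (N \<union> {p, q})" using N by simp
    qed (use D pq in \<open>auto simp: D'_def\<close>)
    then have D': "D' integrable_on {p..q}" and zi: "integral {p..q} D' = z q - z p"
      by (auto simp: integral_unique)
    have "norm (z q - z p) = norm (integral {p..q} D')" unfolding zi ..
    also have "\<dots> \<le> integral {p..q} (\<lambda>s. l s * norm (z s) + e s)"
    proof (rule HK_integral_norm_bound_integral[OF D'])
      show "(\<lambda>s. l s * norm (z s) + e s) integrable_on {p..q}"
        using pq by (intro integrable_on_subinterval[OF integrable_add[OF lz e(1)]]) auto
      fix r assume "r \<in> {p..q}"
      then show "norm (D' r) \<le> l r * norm (z r) + e r"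
        using le[of r] l(2)[of r] e(2)[of r] pq by (auto simp: D'_def)
    qed
    also have "\<dots> = integral {p..q} (\<lambda>s. l s * norm (z s)) + integral {p..q} e"
      using pq by (intro Henstock_Kurzweil_Integration.integral_add integrable_on_subinterval[OF lz] integrable_on_subinterval[OF e(1)]) auto
    also have "integral {p..q} e \<le> integral {a..b} e"
      using pq e by (intro integral_subset_le integrable_on_subinterval[OF e(1)]) auto
    finally show ?thesis by simp
  qed
  have e0: "0 \<le> norm (z s) + integral {a..b} e"
    using e by (intro add_nonneg_nonneg HK_integral_nonneg) auto
  have mono: "(norm (z s) + integral {a..b} e) * exp (integral {p..q} l) \<le> (norm (z s) + integral {a..b} e) * exp (integral {a..b} l)"
    if "p \<in> {a..b}" "q \<in> {a..b}" for p q
    using that l e0 by (intro mult_left_mono) (auto intro!: integral_subset_le integrable_on_subinterval[OF l(1)])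
  show ?thesis
  proof (cases "s \<le> t")
    case True
    have "norm (z t) \<le> (norm (z s) + integral {a..b} e) * exp (integral {s..t} l)"
    proof (rule gronwall[where b = t and l = l])
      show "continuous_on {s..t} (\<lambda>t. norm (z t))"
        using st by (intro continuous_on_norm continuous_on_subset[OF zc]) auto
      show "l integrable_on {s..t}" using st by (intro integrable_on_subinterval[OF l(1)]) auto
      fix r assume "r \<in> {s..t}"
      then show "norm (z r) \<le> norm (z s) + integral {a..b} e + integral {s..r} (\<lambda>t. l t * norm (z t))"
        using step[of s r] st norm_triangle_sub[of "z r" "z s"] by auto
    qed (use st True l(2) in auto)
    then show ?thesis using mono[OF st] by linarith
  next
    case False
    have "norm (z (- (- t))) \<le> (norm (z s) + integral {a..b} e) * exp (integral {-s..-t} (\<lambda>r. l (- r)))"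
    proof (rule gronwall[where b = "-t" and l = "\<lambda>r. l (- r)" and w = "\<lambda>r. norm (z (- r))"])
      show "continuous_on {-s..-t} (\<lambda>t. norm (z (- t)))"
        using st by (intro continuous_on_norm continuous_on_compose2[OF zc] continuous_intros) auto
      show "(\<lambda>r. l (- r)) integrable_on {-s..-t}" using st by (auto intro!: integrable_on_subinterval[OF l(1)])
      fix r assume r: "r \<in> {-s..-t}"
      have "integral {-s..-(-r)} (\<lambda>t. l (-t) * norm (z (-t))) = integral {-r..s} (\<lambda>t. l t * norm (z t))"
        by (rule HK_integral_reflect_real)
      then show "norm (z (- r)) \<le> norm (z s) + integral {a..b} e + integral {-s..r} (\<lambda>t. l (-t) * norm (z (-t)))"
        using step[of "-r" s] st r norm_triangle_sub[of "z (-r)" "z s"] by (auto simp: norm_minus_commute)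
    qed (use st False l(2) in auto)
    then have "norm (z t) \<le> (norm (z s) + integral {a..b} e) * exp (integral {t..s} l)"
      unfolding HK_integral_reflect_real minus_minus .
    then show ?thesis using mono[OF st(2,1)] by linarith
  qed
qed

section \<open>Linearisation and Caratheodory equations\<close>

lemma loc_summable_integrable:
  assumes "L \<in> loc_summable" "0 \<le> a" "b \<le> T" "0 \<le> T"
  shows "L integrable_on {a..b}" "L absolutely_integrable_on {a..b}" "\<And>t. t \<in> {a..b} \<Longrightarrow> 0 \<le> L t"
proof -
  show nn: "\<And>t. t \<in> {a..b} \<Longrightarrow> 0 \<le> L t" using assms by (simp add: loc_summable_def)
  have "integrable (lebesgue_on {0..T}) L" using assms by (simp add: loc_summable_def)
  then have "L integrable_on {0..T}" by (rule integrable_on_lebesgue_on) simp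
  then show i: "L integrable_on {a..b}" by (rule integrable_on_subinterval) (use assms in auto)
  show "L absolutely_integrable_on {a..b}" by (rule nonnegative_absolutely_integrable_1[OF i nn])
qed

lemma norm_matrix_vector_le:
  fixes M :: "real ^ 'n ^ 'm"
  shows "norm (M *v h) \<le> norm M * norm h"
proof -
  have "norm (M *v h) \<le> L2_set (\<lambda>i. norm (M $ i) * norm h) UNIV"
    unfolding norm_vec_def[of "M *v h"]
    by (intro L2_set_mono) (auto simp: matrix_vector_mul_component Cauchy_Schwarz_ineq2)
  also have "\<dots> = norm M * norm h"
    by (simp add: norm_vec_def[of M] L2_set_left_distrib[symmetric] L2_set_right_distrib[symmetric])
  finally show ?thesis .
qed

lemma norm_vector_matrix_le:
  fixes M :: "real ^ 'n ^ 'm"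
  shows "norm (h v* M) \<le> norm h * norm M"
proof -
  have "h v* M = (\<Sum>i\<in>UNIV. h $ i *\<^sub>R M $ i)"
    by (simp add: vec_eq_iff vector_matrix_mult_def mult.commute)
  then have "norm (h v* M) \<le> (\<Sum>i\<in>UNIV. \<bar>h $ i\<bar> * \<bar>norm (M $ i)\<bar>)"
    using norm_sum[of "\<lambda>i. h $ i *\<^sub>R M $ i" UNIV] by simp
  also have "\<dots> \<le> L2_set (\<lambda>i. h $ i) UNIV * L2_set (\<lambda>i. norm (M $ i)) UNIV" by (rule L2_set_mult_ineq)
  finally show ?thesis by (simp add: norm_vec_def[of M] norm_vec_def[of h] L2_set_def)
qed

lemma bounded_bilinear_matrix_vector: "bounded_bilinear (\<lambda>(M :: real ^ 'n ^ 'm) h. M *v h)"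
  by (rule bounded_bilinear.intro)
     (auto simp: matrix_vector_mult_add_rdistrib matrix_vector_right_distrib scaleR_matrix_vector_assoc[symmetric]
        matrix_vector_mult_scaleR intro!: exI[of _ 1] norm_matrix_vector_le)

lemma bounded_bilinear_vector_matrix: "bounded_bilinear (\<lambda>h (M :: real ^ 'n ^ 'm). h v* M)"
proof (rule bounded_bilinear.intro)
  show "\<exists>K. \<forall>a b. norm (a v* (b :: real ^ 'n ^ 'm)) \<le> norm a * norm b * K"
    using norm_vector_matrix_le by (intro exI[of _ 1]) auto
qed (auto simp: vec_eq_iff vector_matrix_mult_def algebra_simps sum.distrib sum_distrib_left)

lemma inner_vector_matrix: "(p v* M) \<bullet> h = p \<bullet> (M *v (h :: real ^ 'n))" for M :: "real ^ 'n ^ 'm"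
  by (simp add: dot_lmul_matrix)

text \<open>
  The mean value inequality for \<open>\<lambda>z. F z - F' x z\<close> on the segment from \<open>x\<close> to \<open>y\<close>.
\<close>

lemma linearisation_error:
  fixes F :: "'a::euclidean_space \<Rightarrow> 'b::euclidean_space"
  assumes S: "convex S" and F: "\<And>y. y \<in> S \<Longrightarrow> (F has_derivative F' y) (at y)"
    and lip: "\<And>y z h. y \<in> S \<Longrightarrow> z \<in> S \<Longrightarrow> norm (F' y h - F' z h) \<le> k * norm (y - z) * norm h"
    and xy: "x \<in> S" "y \<in> S"
  shows "norm (F y - F x - F' x (y - x)) \<le> k * (norm (y - x))\<^sup>2"
proof (cases "k * norm (y - x) < 0")
  case True
  then have "k < 0" "norm (y - x) > 0" by (auto simp: mult_less_0_iff)
  then have "k * norm (y - x) * norm (y - x) < 0" using True by (simp add: mult_less_0_iff)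
  with lip[OF xy(2,1), of "y - x"] show ?thesis using norm_ge_zero order_trans by (smt (verit))
next
  case False
  have lin: "bounded_linear (F' x)" using F[OF xy(1)] by (rule has_derivative_bounded_linear)
  have seg: "closed_segment x y \<subseteq> S" by (rule closed_segment_subset[OF xy S])
  have "norm ((\<lambda>z. F z - F' x z) y - (\<lambda>z. F z - F' x z) x) \<le> (k * norm (y - x)) * norm (y - x)"
  proof (rule differentiable_bound[OF convex_closed_segment[of x y]])
    fix z assume z: "z \<in> closed_segment x y"
    then have zS: "z \<in> S" using seg by blast
    show "((\<lambda>z. F z - F' x z) has_derivative (\<lambda>h. F' z h - F' x h)) (at z within closed_segment x y)"
      by (rule has_derivative_at_withinI[OF has_derivative_diff[OF F[OF zS] bounded_linear_imp_has_derivative[OF lin]]])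
    show "onorm (\<lambda>h. F' z h - F' x h) \<le> k * norm (y - x)"
    proof (rule onorm_bound)
      show "0 \<le> k * norm (y - x)" using False by simp
      fix h
      have le: "norm (z - x) \<le> norm (y - x)" using segment_bound1[OF z] by (simp add: norm_minus_commute)
      have "norm (F' z h - F' x h) \<le> k * norm (z - x) * norm h" by (rule lip[OF zS xy(1)])
      also have "\<dots> \<le> k * norm (y - x) * norm h"
      proof (cases "y = x")
        case True then show ?thesis using le by simp
      next
        case ne: False
        then have "0 \<le> k" using False by (simp add: not_less zero_le_mult_iff)
        then show ?thesis using le by (intro mult_right_mono mult_left_mono) auto
      qed
      finally show "norm (F' z h - F' x h) \<le> k * norm (y - x) * norm h" .
    qed
  qed auto
  moreover have "(\<lambda>z. F z - F' x z) y - (\<lambda>z. F z - F' x z) x = F y - F x - F' x (y - x)"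
    using linear_diff[OF bounded_linear.linear[OF lin]] by simp
  ultimately show ?thesis by (simp add: power2_eq_square mult.assoc)
qed

text \<open>
  Solutions on one interval, without an initial value: a trajectory of a control that is changed on an
  interval solves different equations before, on and after it.
\<close>

definition ode_on :: "(real \<Rightarrow> 'a \<Rightarrow> 'a) \<Rightarrow> real \<Rightarrow> real \<Rightarrow> (real \<Rightarrow> 'a::real_normed_vector) \<Rightarrow> bool" where
  "ode_on F a b x \<longleftrightarrow> abs_cont_on {a..b} x \<and>
     (\<exists>N. negligible N \<and> (\<forall>t\<in>{a<..<b} - N. (x has_vector_derivative F t (x t)) (at t)))"

lemma ode_solution_imp_ode_on:
  assumes "ode_solution F \<xi> x" "0 \<le> a" 
  shows "ode_on F a b x"
proof -
  have "loc_abs_cont x" using assms by (simp add: ode_solution_def)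
  then have "abs_cont_on {0..max 0 b} x" unfolding loc_abs_cont_def by simp
  then have "abs_cont_on {a..b} x" by (rule abs_cont_on_subset) (use assms in auto)
  moreover have "AE t in lebesgue_on {0..}. (x has_vector_derivative F t (x t)) (at t)"
    using assms by (simp add: ode_solution_def)
  then obtain N where N: "negligible N" "\<forall>t\<in>{0..} - N. (x has_vector_derivative F t (x t)) (at t)"
    by (subst (asm) AE_lebesgue_on_iff_negligible) auto
  moreover have "\<forall>t\<in>{a<..<b} - N. (x has_vector_derivative F t (x t)) (at t)"
    using N(2) assms(2) by auto
  ultimately show ?thesis unfolding ode_on_def by blast
qed

lemma ode_on_cong:
  assumes "ode_on F a b x" "\<And>t y. t \<in> {a<..<b} \<Longrightarrow> F t y = G t y"
  shows "ode_on G a b x"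
  using assms unfolding ode_on_def by auto

lemma ode_on_has_integral:
  fixes x :: "real \<Rightarrow> 'a::euclidean_space"
  assumes "ode_on F a b x" "a \<le> b"
  shows "((\<lambda>t. F t (x t)) has_integral (x b - x a)) {a..b}"
proof -
  obtain N where "negligible N" "\<forall>t\<in>{a<..<b} - N. (x has_vector_derivative F t (x t)) (at t)"
    using assms(1) by (auto simp: ode_on_def)
  then show ?thesis using assms by (intro abs_cont_FTC[of a b x N]) (auto simp: ode_on_def)
qed

lemma ode_on_diff_gronwall:
  fixes x y :: "real \<Rightarrow> 'a::euclidean_space"
  assumes x: "ode_on F a b x" and y: "ode_on G a b y"
    and le: "\<And>t. t \<in> {a<..<b} \<Longrightarrow> norm (F t (x t) - G t (y t)) \<le> l t * norm (x t - y t) + e t"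
    and l: "l integrable_on {a..b}" "\<And>t. t \<in> {a..b} \<Longrightarrow> 0 \<le> l t"
    and e: "e integrable_on {a..b}" "\<And>t. t \<in> {a..b} \<Longrightarrow> 0 \<le> e t"
    and st: "s \<in> {a..b}" "t \<in> {a..b}"
  shows "norm (x t - y t) \<le> (norm (x s - y s) + integral {a..b} e) * exp (integral {a..b} l)"
proof -
  obtain N where N: "negligible N" "\<forall>t\<in>{a<..<b} - N. (x has_vector_derivative F t (x t)) (at t)"
    using x by (auto simp: ode_on_def)
  obtain N' where N': "negligible N'" "\<forall>t\<in>{a<..<b} - N'. (y has_vector_derivative G t (y t)) (at t)"
    using y by (auto simp: ode_on_def)
  show ?thesis
  proof (rule abs_cont_gronwall[where D = "\<lambda>t. F t (x t) - G t (y t)" and N = "N \<union> N'" and z = "\<lambda>t. x t - y t", OF _ _ _ _ l e st])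
    show "abs_cont_on {a..b} (\<lambda>t. x t - y t)" using x y by (intro abs_cont_on_diff) (auto simp: ode_on_def)
    show "negligible (N \<union> N')" using N N' by simp
    show "\<And>t. t \<in> {a<..<b} - (N \<union> N') \<Longrightarrow> ((\<lambda>t. x t - y t) has_vector_derivative F t (x t) - G t (y t)) (at t)"
      using N(2) N'(2) by (auto intro!: derivative_intros)
  qed (use le in auto)
qed

lemma ode_on_lipschitz:
  fixes x y :: "real \<Rightarrow> 'a::euclidean_space"
  assumes x: "ode_on F a b x" and y: "ode_on F a b y"
    and le: "\<And>t p q. t \<in> {a<..<b} \<Longrightarrow> norm (F t p - F t q) \<le> l t * norm (p - q)"
    and l: "l integrable_on {a..b}" "\<And>t. t \<in> {a..b} \<Longrightarrow> 0 \<le> l t"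
    and st: "s \<in> {a..b}" "t \<in> {a..b}"
  shows "norm (x t - y t) \<le> norm (x s - y s) * exp (integral {a..b} l)"
  using ode_on_diff_gronwall[OF x y _ l integrable_0 _ st] le by simp

text \<open>
  The range is open by invariance of domain and closed because \<open>\<Phi>\<close> does not contract distances by more
  than a constant factor.
\<close>

lemma expanding_continuous_surj:
  fixes \<Phi> :: "'a::euclidean_space \<Rightarrow> 'a"
  assumes cont: "continuous_on UNIV \<Phi>" and C: "\<And>p q. norm (p - q) \<le> C * norm (\<Phi> p - \<Phi> q)"
  shows "surj \<Phi>"
proof -
  have "inj \<Phi>" using C by (metis diff_self eq_iff_diff_eq_0 injI mult_zero_right norm_le_zero_iff norm_zero)
  then have "open (range \<Phi>)" by (intro invariance_of_domain cont) auto
  moreover have "closed (range \<Phi>)"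
    unfolding closed_sequential_limits
  proof (intro allI impI)
    fix y l assume "(\<forall>n::nat. y n \<in> range \<Phi>) \<and> y \<longlonglongrightarrow> l"
    then have y: "\<And>n. y n \<in> range \<Phi>" "y \<longlonglongrightarrow> l" by auto
    have "\<forall>n. \<exists>p. y n = \<Phi> p" using y(1) by blast
    then obtain p where p: "\<And>n. y n = \<Phi> (p n)" unfolding choice_iff by blast
    have "Cauchy p"
    proof (rule metric_CauchyI)
      fix e :: real assume "e > 0"
      define C' where "C' = max C 1"
      have "e / C' > 0" using \<open>e > 0\<close> by (simp add: C'_def)
      then obtain M where M: "\<And>m n. m \<ge> M \<Longrightarrow> n \<ge> M \<Longrightarrow> dist (y m) (y n) < e / C'"
        using LIMSEQ_imp_Cauchy[OF y(2)] unfolding Cauchy_def by blast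
      have "dist (p m) (p n) < e" if "m \<ge> M" "n \<ge> M" for m n
      proof -
        have "dist (p m) (p n) \<le> C * dist (y m) (y n)" using C by (simp add: dist_norm p)
        also have "\<dots> \<le> C' * dist (y m) (y n)" by (intro mult_right_mono) (auto simp: C'_def)
        also have "\<dots> < C' * (e / C')" using M[OF that] by (intro mult_strict_left_mono) (auto simp: C'_def)
        finally show ?thesis by (simp add: C'_def)
      qed
      then show "\<exists>M. \<forall>m\<ge>M. \<forall>n\<ge>M. dist (p m) (p n) < e" by blast
    qed
    then obtain q where "p \<longlonglongrightarrow> q" using Cauchy_convergent convergent_def by blast
    then have "(\<lambda>n. \<Phi> (p n)) \<longlonglongrightarrow> \<Phi> q" using continuous_on_tendsto_compose[OF cont] by auto
    then have "l = \<Phi> q" using y(2) LIMSEQ_unique unfolding p by blast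
    then show "l \<in> range \<Phi>" by blast
  qed
  ultimately have "range \<Phi> = {} \<or> range \<Phi> = UNIV" by (simp only: clopen[symmetric])
  then show "surj \<Phi>" by simp
qed

section \<open>The flow of the reference control\<close>

text \<open>
  Bounds on compact sets are used on tubes \<open>{0..T} \<times> cball 0 \<rho>\<close> that contain all trajectories under
  consideration.
\<close>

lemma locally_lipschitz_tube:
  fixes a :: "real \<Rightarrow> 'a::euclidean_space \<Rightarrow> 'u \<Rightarrow> 'b::euclidean_space"
  assumes "locally_lipschitz U a"
  shows "\<exists>L\<in>loc_summable. \<forall>t\<in>{0..T}. \<forall>v\<in>U t. \<forall>x\<in>cball 0 \<rho>. \<forall>y\<in>cball 0 \<rho>.
           norm (a t x v - a t y v) \<le> L t * norm (x - y)"
proof -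
  have "compact ({0..T} \<times> cball (0 :: 'a) \<rho>)" "{0..T} \<times> cball 0 \<rho> \<subseteq> {0..} \<times> UNIV"
    by (intro compact_Times compact_Icc compact_cball) auto
  then obtain L where "L \<in> loc_summable" "lipschitz_with U a ({0..T} \<times> cball 0 \<rho>) L"
    using assms unfolding locally_lipschitz_def by blast
  then show ?thesis unfolding lipschitz_with_def by (intro bexI[of _ L]) auto
qed

lemma integrally_bounded_tube:
  fixes a :: "real \<Rightarrow> 'a::euclidean_space \<Rightarrow> 'u \<Rightarrow> 'b::euclidean_space"
  assumes "integrally_bounded U a"
  shows "\<exists>M\<in>loc_summable. \<forall>t\<in>{0..T}. \<forall>x\<in>cball 0 \<rho>. \<forall>v\<in>U t. norm (a t x v) \<le> M t"
proof -
  have "compact ({0..T} \<times> cball (0 :: 'a) \<rho>)" "{0..T} \<times> cball 0 \<rho> \<subseteq> {0..} \<times> UNIV"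
    by (intro compact_Times compact_Icc compact_cball) auto
  then obtain M where "M \<in> loc_summable" "\<forall>(t, x)\<in>{0..T} \<times> cball 0 \<rho>. \<forall>v\<in>U t. norm (a t x v) \<le> M t"
    using assms unfolding integrally_bounded_def by blast
  then show ?thesis by (intro bexI[of _ M]) auto
qed

lemma caratheodory_continuous:
  assumes "caratheodory U a" "0 \<le> t" "v \<in> U t"
  shows "continuous_on UNIV (\<lambda>y. a t y v)"
proof -
  have "continuous_on (UNIV \<times> U t) (\<lambda>(y, v). a t y v)" using assms by (simp add: caratheodory_def)
  moreover have "continuous_on UNIV (\<lambda>y. (y, v))"
    by (intro continuous_on_Pair continuous_on_id continuous_on_const)
  ultimately have "continuous_on UNIV (\<lambda>y. case (y, v) of (y, v) \<Rightarrow> a t y v)"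
    by (rule continuous_on_compose2) (use assms(3) in auto)
  then show ?thesis by simp
qed

lemma caratheodory_continuous_control:
  assumes "caratheodory U a" "0 \<le> t"
  shows "continuous_on (U t) (\<lambda>v. a t y v)"
proof -
  have "continuous_on (UNIV \<times> U t) (\<lambda>(y, v). a t y v)" using assms by (simp add: caratheodory_def)
  moreover have "continuous_on (U t) (\<lambda>v. (y, v))"
    by (intro continuous_on_Pair continuous_on_id continuous_on_const)
  ultimately have "continuous_on (U t) (\<lambda>v. case (y, v) of (y, v) \<Rightarrow> a t y v)"
    by (rule continuous_on_compose2) auto
  then show ?thesis by simp
qed

lemma Df_has_derivative:
  assumes "(\<lambda>y. f t y v) differentiable (at x)"
  shows "((\<lambda>y. f t y v) has_derivative (\<lambda>h. Df f t x v *v h)) (at x)"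
  using assms unfolding Df_def jacobian_works .

lemma has_derivative_imp_gradient:
  fixes F :: "'a::euclidean_space \<Rightarrow> real"
  assumes "(F has_derivative (\<lambda>h. h \<bullet> D)) (at x)"
  shows "gradient F x = D"
  unfolding gradient_def gderiv_def
proof (rule the_equality)
  show "(F has_derivative (\<lambda>h. h \<bullet> D)) (at x)" by (rule assms)
  fix E assume "(F has_derivative (\<lambda>h. h \<bullet> E)) (at x)"
  then have "(\<lambda>h. h \<bullet> E) = (\<lambda>h. h \<bullet> D)" using assms by (rule has_derivative_unique)
  then show "E = D" by (metis inner_commute vector_eq_ldot)
qed

lemma differentiable_imp_gradient:
  fixes F :: "'a::euclidean_space \<Rightarrow> real"
  assumes "F differentiable (at x)"
  shows "(F has_derivative (\<lambda>h. gradient F x \<bullet> h)) (at x)"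
proof -
  obtain F' where F': "(F has_derivative F') (at x)" using assms by (auto simp: differentiable_def)
  then have lin: "linear F'" by (rule has_derivative_linear)
  have "F' h = h \<bullet> adjoint F' 1" for h using adjoint_works[OF lin, of h 1] by simp
  then have "F' = (\<lambda>h. h \<bullet> adjoint F' 1)" by blast
  then have "(F has_derivative (\<lambda>h. h \<bullet> adjoint F' 1)) (at x)" using F' by simp
  then show ?thesis using has_derivative_imp_gradient by (metis (no_types, lifting) ext inner_commute)
qed

text \<open>
  The control system with a distinguished control \<open>u0\<close>, the trajectories \<open>X \<xi>\<close> that \<open>u0\<close> generates from the
  initial states \<open>\<xi>\<close>, the variational matrices \<open>A \<xi>\<close> and the payoff derivatives \<open>I \<xi>\<close>. The reference
  trajectory is \<open>X 0\<close>.
\<close>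

locale regular_control_system =
  fixes U :: "real \<Rightarrow> 'u::euclidean_space set"
    and f :: "real \<Rightarrow> real ^ 'm \<Rightarrow> 'u \<Rightarrow> real ^ 'm"
    and g :: "real \<Rightarrow> real ^ 'm \<Rightarrow> 'u \<Rightarrow> real"
    and u0 :: "real \<Rightarrow> 'u"
    and \<phi> :: "(real \<Rightarrow> 'u) \<Rightarrow> real \<Rightarrow> real ^ 'm"
    and J :: "real \<Rightarrow> (real \<Rightarrow> 'u) \<Rightarrow> real"
    and X :: "real ^ 'm \<Rightarrow> real \<Rightarrow> real ^ 'm"
    and A :: "real ^ 'm \<Rightarrow> real \<Rightarrow> real ^ 'm ^ 'm"
    and I :: "real ^ 'm \<Rightarrow> real \<Rightarrow> real ^ 'm"
  assumes fg: "cond_fg U f g"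
    and partial: "cond_partial U f g"
    and u0: "u0 \<in> selectors U"
    and phi: "\<And>u. u \<in> selectors U \<Longrightarrow> ode_solution (\<lambda>t y. f t y (u t)) 0 (\<phi> u)"
    and J: "\<And>u T. u \<in> selectors U \<Longrightarrow> T \<ge> 0 \<Longrightarrow>
              has_bochner_integral (lebesgue_on {0..T}) (\<lambda>t. g t (\<phi> u t) (u t)) (J T u)"
    and X: "\<And>\<xi>. ode_solution (\<lambda>t y. f t y (u0 t)) \<xi> (X \<xi>)"
    and A: "\<And>\<xi>. ode_solution (\<lambda>t M. Df f t (X \<xi> t) (u0 t) ** M) (mat 1) (A \<xi>)"
    and I: "\<And>\<xi> T. T \<ge> 0 \<Longrightarrow>
              has_bochner_integral (lebesgue_on {0..T}) (\<lambda>t. Dg g t (X \<xi> t) (u0 t) v* A \<xi> t) (I \<xi> T)"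
begin

lemma selector_in: "u \<in> selectors U \<Longrightarrow> 0 \<le> t \<Longrightarrow> u t \<in> U t"
  by (simp add: selectors_def)

lemma u0_in: "0 \<le> t \<Longrightarrow> u0 t \<in> U t" using selector_in[OF u0] .

text \<open>
  A Lipschitz function of \<open>f\<close> in the state that serves all compact sets at once.
\<close>

definition L :: "real \<Rightarrow> real" where
  "L = (SOME L. L \<in> loc_summable \<and> (\<forall>t\<ge>0. \<forall>v\<in>U t. \<forall>x y. norm (f t x v - f t y v) \<le> L t * norm (x - y)))"

lemma L: "L \<in> loc_summable"
  and f_lipschitz: "0 \<le> t \<Longrightarrow> v \<in> U t \<Longrightarrow> norm (f t x v - f t y v) \<le> L t * norm (x - y)"
proof -
  obtain K where K: "K \<in> loc_summable" "\<And>S. compact S \<Longrightarrow> S \<subseteq> {0..} \<times> UNIV \<Longrightarrow> lipschitz_with U f S K"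
    using fg unfolding cond_fg_def continuability_def by blast
  have "norm (f t x v - f t y v) \<le> K t * norm (x - y)" if "0 \<le> t" "v \<in> U t" for t v x y
    using K(2)[of "{(t, x), (t, y)}"] that unfolding lipschitz_with_def by auto
  then have "\<exists>L. L \<in> loc_summable \<and> (\<forall>t\<ge>0. \<forall>v\<in>U t. \<forall>x y. norm (f t x v - f t y v) \<le> L t * norm (x - y))"
    using K(1) by blast
  from someI_ex[OF this] show "L \<in> loc_summable"
    "0 \<le> t \<Longrightarrow> v \<in> U t \<Longrightarrow> norm (f t x v - f t y v) \<le> L t * norm (x - y)"
    unfolding L_def by blast+
qed

lemma f_regular: "regular_map U f" and g_regular: "regular_map U g"
  and Df_regular: "regular_map U (Df f)" and Dg_regular: "regular_map U (Dg g)"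
  using fg partial by (auto simp: cond_fg_def cond_partial_def)

lemma f_derivative: "0 \<le> t \<Longrightarrow> ((\<lambda>y. f t y v) has_derivative (\<lambda>h. Df f t x v *v h)) (at x)"
  using partial by (intro Df_has_derivative) (simp add: cond_partial_def)

lemma g_derivative: "0 \<le> t \<Longrightarrow> ((\<lambda>y. g t y v) has_derivative (\<lambda>h. Dg g t x v \<bullet> h)) (at x)"
  using partial unfolding Dg_def by (intro differentiable_imp_gradient) (simp add: cond_partial_def)

lemma X_0: "X \<xi> 0 = \<xi>" using X[of \<xi>] by (simp add: ode_solution_def)

lemma X_ode: "0 \<le> a \<Longrightarrow> ode_on (\<lambda>t y. f t y (u0 t)) a b (X \<xi>)"
  by (rule ode_solution_imp_ode_on[OF X])

lemma phi_ode: "u \<in> selectors U \<Longrightarrow> 0 \<le> a \<Longrightarrow> ode_on (\<lambda>t y. f t y (u t)) a b (\<phi> u)"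
  by (rule ode_solution_imp_ode_on[OF phi])

lemma phi_0: "u \<in> selectors U \<Longrightarrow> \<phi> u 0 = 0" using phi[of u] by (simp add: ode_solution_def)

text \<open>
  Gronwall's inequality against the zero function; the constant depends neither on the control nor
  on the trajectory.
\<close>

lemma trajectory_bound:
  assumes T: "0 \<le> T"
  shows "\<exists>\<rho>. \<forall>u\<in>selectors U. \<forall>x. ode_on (\<lambda>t y. f t y (u t)) 0 T x \<longrightarrow> norm (x 0) \<le> R \<longrightarrow>
           (\<forall>t\<in>{0..T}. norm (x t) \<le> \<rho>)"
proof -
  obtain M where M: "M \<in> loc_summable" "\<And>t v. t \<in> {0..T} \<Longrightarrow> v \<in> U t \<Longrightarrow> norm (f t 0 v) \<le> M t"
    using integrally_bounded_tube[of U f T 0] f_regular unfolding regular_map_def by auto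
  note Ml = loc_summable_integrable[OF M(1) order_refl order_refl T]
  note Ll = loc_summable_integrable[OF L order_refl order_refl T]
  show ?thesis
  proof (intro exI ballI allI impI)
    fix u x t assume u: "u \<in> selectors U" and x: "ode_on (\<lambda>t y. f t y (u t)) 0 T x" "norm (x 0) \<le> R" and t: "t \<in> {0..T}"
    have z: "ode_on (\<lambda>t y. 0) 0 T (\<lambda>t. 0 :: real ^ 'm)"
      unfolding ode_on_def by (auto simp: abs_cont_on_def intro!: exI[of _ "{}"] exI[of _ 1])
    have "norm (x t - 0) \<le> (norm (x 0 - 0) + integral {0..T} M) * exp (integral {0..T} L)"
    proof (rule ode_on_diff_gronwall[OF x(1) z _ Ll(1,3) Ml(1,3) _ t])
      fix t assume t: "t \<in> {0<..<T}"
      have "f t (x t) (u t) = (f t (x t) (u t) - f t 0 (u t)) + f t 0 (u t)" by simp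
      also have "norm \<dots> \<le> L t * norm (x t - 0) + M t"
        using t selector_in[OF u, of t] M(2)[of t "u t"] by (intro norm_triangle_mono f_lipschitz) auto
      finally show "norm (f t (x t) (u t) - 0) \<le> L t * norm (x t - 0) + M t" by simp
    qed (use T in auto)
    also have "\<dots> \<le> (R + integral {0..T} M) * exp (integral {0..T} L)"
      using x(2) by (intro mult_right_mono) auto
    finally show "norm (x t) \<le> (R + integral {0..T} M) * exp (integral {0..T} L)" by simp
  qed
qed

definition flow_const :: "real \<Rightarrow> real" where "flow_const T = exp (integral {0..T} L)"

lemma flow_const_ge_1: "0 \<le> T \<Longrightarrow> 1 \<le> flow_const T"
  unfolding flow_const_def one_le_exp_iff
  by (rule HK_integral_nonneg) (rule loc_summable_integrable[OF L order_refl order_refl]; assumption)+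

lemma exp_L_le_flow_const:
  assumes "0 \<le> a" "b \<le> T" "0 \<le> T"
  shows "exp (integral {a..b} L) \<le> flow_const T"
proof -
  have "integral {a..b} L \<le> integral {0..T} L"
    by (rule integral_subset_le[OF _ loc_summable_integrable(1)[OF L assms] loc_summable_integrable(1)[OF L order_refl order_refl assms(3)]])
       (use loc_summable_integrable(3)[OF L order_refl order_refl assms(3)] assms in auto)
  then show ?thesis by (simp add: flow_const_def)
qed

lemma trajectories_lipschitz:
  assumes u: "u \<in> selectors U" and ab: "0 \<le> a" "b \<le> T" "0 \<le> T"
    and x: "ode_on (\<lambda>t y. f t y (u t)) a b x" and y: "ode_on (\<lambda>t y. f t y (u t)) a b y"
    and st: "s \<in> {a..b}" "t \<in> {a..b}"
  shows "norm (x t - y t) \<le> flow_const T * norm (x s - y s)"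
proof -
  have "norm (x t - y t) \<le> norm (x s - y s) * exp (integral {a..b} L)"
    using selector_in[OF u] ab
    by (intro ode_on_lipschitz[OF x y _ loc_summable_integrable(1,3)[OF L ab] st] f_lipschitz) auto
  also have "\<dots> \<le> norm (x s - y s) * flow_const T"
    by (intro mult_left_mono exp_L_le_flow_const ab) auto
  finally show ?thesis by (simp add: mult.commute)
qed

lemma X_lipschitz:
  assumes "t \<in> {0..T}"
  shows "norm (X \<xi> t - X \<eta> t) \<le> flow_const T * norm (\<xi> - \<eta>)"
    and "norm (\<xi> - \<eta>) \<le> flow_const T * norm (X \<xi> t - X \<eta> t)"
  using trajectories_lipschitz[OF u0 order_refl order_refl _ X_ode[OF order_refl, of _ \<xi>] X_ode[OF order_refl, of _ \<eta>], of T 0 t]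
    trajectories_lipschitz[OF u0 order_refl order_refl _ X_ode[OF order_refl, of _ \<xi>] X_ode[OF order_refl, of _ \<eta>], of T t 0] assms
  by (auto simp: X_0)

text \<open>
  Every state at time \<open>T\<close> lies on a trajectory of \<open>u0\<close>. Hence a trajectory that has left the reference
  trajectory and is controlled by \<open>u0\<close> from \<open>T\<close> on continues as some \<open>X \<xi>\<close>.
\<close>

lemma X_surj:
  assumes "0 \<le> T"
  shows "surj (\<lambda>\<xi>. X \<xi> T)"
proof (rule expanding_continuous_surj)
  show "continuous_on UNIV (\<lambda>\<xi>. X \<xi> T)"
    by (rule continuous_on_subset[OF lipschitz_on_continuous_on[OF lipschitz_onI[where L = "flow_const T"]] order_refl])
       (use X_lipschitz(1)[of T T] flow_const_ge_1[OF assms] assms in \<open>auto simp: dist_norm\<close>)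
  show "norm (p - q) \<le> flow_const T * norm (X p T - X q T)" for p q
    using X_lipschitz(2)[of T T p q] assms by simp
qed

lemma phi_u0: "0 \<le> t \<Longrightarrow> \<phi> u0 t = X 0 t"
  using trajectories_lipschitz[OF u0 order_refl order_refl _ phi_ode[OF u0 order_refl] X_ode[OF order_refl, of _ 0], of t 0 t]
  by (simp add: X_0 phi_0 u0)

lemma X_bound:
  assumes "0 \<le> T"
  shows "\<exists>\<rho>. \<forall>\<xi>\<in>cball 0 R. \<forall>t\<in>{0..T}. norm (X \<xi> t) \<le> \<rho>"
  using trajectory_bound[OF assms, of R] u0 X_ode[OF order_refl] X_0 by fastforce

lemma A_vector_ode:
  assumes "0 \<le> a"
  shows "ode_on (\<lambda>t z. Df f t (X \<xi> t) (u0 t) *v z) a b (\<lambda>t. A \<xi> t *v h)"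
proof -
  have bl: "bounded_linear (\<lambda>M :: real ^ 'm ^ 'm. M *v h)"
    by (rule bounded_bilinear.bounded_linear_left[OF bounded_bilinear_matrix_vector])
  obtain N where N: "abs_cont_on {a..b} (A \<xi>)" "negligible N"
      "\<forall>t\<in>{a<..<b} - N. (A \<xi> has_vector_derivative Df f t (X \<xi> t) (u0 t) ** A \<xi> t) (at t)"
    using ode_solution_imp_ode_on[OF A[of \<xi>] assms, of b] by (auto simp: ode_on_def)
  have "((\<lambda>t. A \<xi> t *v h) has_vector_derivative Df f t (X \<xi> t) (u0 t) *v (A \<xi> t *v h)) (at t)" if "t \<in> {a<..<b} - N" for t
    using bounded_linear.has_vector_derivative[OF bl N(3)[rule_format, OF that]]
    by (simp add: matrix_vector_mul_assoc)
  then show ?thesis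
    unfolding ode_on_def using abs_cont_on_bounded_linear[OF bl N(1)] N(2) by blast
qed

lemma A_0: "A \<xi> 0 = mat 1" using A[of \<xi>] by (simp add: ode_solution_def)

lemma A_bounds:
  assumes T: "0 \<le> T"
  shows "\<exists>C>0. \<forall>\<xi>\<in>cball 0 R. \<forall>t\<in>{0..T}. \<forall>h. norm (A \<xi> t *v h) \<le> C * norm h \<and> norm h \<le> C * norm (A \<xi> t *v h)"
proof -
  obtain \<rho> where \<rho>: "\<And>\<xi> t. \<xi> \<in> cball 0 R \<Longrightarrow> t \<in> {0..T} \<Longrightarrow> norm (X \<xi> t) \<le> \<rho>" using X_bound[OF T] by blast
  obtain M where M: "M \<in> loc_summable" "\<And>t x v. t \<in> {0..T} \<Longrightarrow> x \<in> cball 0 \<rho> \<Longrightarrow> v \<in> U t \<Longrightarrow> norm (Df f t x v) \<le> M t"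
    using integrally_bounded_tube[of U "Df f" T \<rho>] Df_regular unfolding regular_map_def by blast
  note Ml = loc_summable_integrable[OF M(1) order_refl order_refl T]
  show ?thesis
  proof (intro exI[of _ "exp (integral {0..T} M)"] conjI ballI allI)
    fix \<xi> h :: "real ^ 'm" and t assume \<xi>: "\<xi> \<in> cball 0 R" and t: "t \<in> {0..T}"
    have z: "ode_on (\<lambda>t z. Df f t (X \<xi> t) (u0 t) *v z) 0 T (\<lambda>t. 0)"
      unfolding ode_on_def by (auto simp: abs_cont_on_def intro!: exI[of _ "{}"] exI[of _ 1])
    have "norm (Df f t (X \<xi> t) (u0 t) *v p - Df f t (X \<xi> t) (u0 t) *v q) \<le> M t * norm (p - q)" if t: "t \<in> {0<..<T}" for t p q
    proof -
      have "norm (Df f t (X \<xi> t) (u0 t) *v (p - q)) \<le> norm (Df f t (X \<xi> t) (u0 t)) * norm (p - q)"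
        by (rule norm_matrix_vector_le)
      also have "\<dots> \<le> M t * norm (p - q)"
        using \<rho>[OF \<xi>, of t] t u0_in[of t] by (intro mult_right_mono M(2)) auto
      finally show ?thesis by (simp add: matrix_vector_mult_diff_distrib)
    qed
    from ode_on_lipschitz[OF A_vector_ode[OF order_refl, of \<xi> T h] z this Ml(1,3)]
    have "norm (A \<xi> r *v h) \<le> norm (A \<xi> s *v h) * exp (integral {0..T} M)" if "s \<in> {0..T}" "r \<in> {0..T}" for s r
      using that by simp
    from this[of 0 t] this[of t 0] show "norm (A \<xi> t *v h) \<le> exp (integral {0..T} M) * norm h"
       "norm h \<le> exp (integral {0..T} M) * norm (A \<xi> t *v h)"
      using t T by (simp_all add: A_0 mult.commute)
  qed simp
qed

text \<open>
  Since \<open>Df f\<close> is Lipschitz in the state, the deviation of \<open>X\<close> from its linearisation solves the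
  variational equation up to an inhomogeneity of second order in \<open>\<eta> - \<xi>\<close>.
\<close>

lemma X_linearised:
  assumes T: "0 \<le> T"
  shows "\<exists>C\<ge>0. \<forall>\<xi>\<in>cball 0 R. \<forall>\<eta>\<in>cball 0 R. \<forall>t\<in>{0..T}.
           norm (X \<eta> t - X \<xi> t - A \<xi> t *v (\<eta> - \<xi>)) \<le> C * (norm (\<eta> - \<xi>))\<^sup>2"
proof -
  obtain \<rho> where \<rho>: "\<And>\<xi> t. \<xi> \<in> cball 0 R \<Longrightarrow> t \<in> {0..T} \<Longrightarrow> norm (X \<xi> t) \<le> \<rho>" using X_bound[OF T] by blast
  obtain M where M: "M \<in> loc_summable" "\<And>t x v. t \<in> {0..T} \<Longrightarrow> x \<in> cball 0 \<rho> \<Longrightarrow> v \<in> U t \<Longrightarrow> norm (Df f t x v) \<le> M t"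
    using integrally_bounded_tube[of U "Df f" T \<rho>] Df_regular unfolding regular_map_def by blast
  obtain K where K: "K \<in> loc_summable" "\<And>t x y v. t \<in> {0..T} \<Longrightarrow> v \<in> U t \<Longrightarrow> x \<in> cball 0 \<rho> \<Longrightarrow> y \<in> cball 0 \<rho> \<Longrightarrow>
       norm (Df f t x v - Df f t y v) \<le> K t * norm (x - y)"
    using locally_lipschitz_tube[of U "Df f" T \<rho>] Df_regular unfolding regular_map_def by blast
  note Ml = loc_summable_integrable[OF M(1) order_refl order_refl T]
  note Kl = loc_summable_integrable[OF K(1) order_refl order_refl T]
  define c where "c = (flow_const T)\<^sup>2"
  show ?thesis
  proof (intro exI[of _ "c * integral {0..T} K * exp (integral {0..T} M)"] conjI ballI)
    show "0 \<le> c * integral {0..T} K * exp (integral {0..T} M)"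
      using Kl by (auto simp: c_def intro!: mult_nonneg_nonneg HK_integral_nonneg)
    fix \<xi> \<eta> :: "real ^ 'm" and t assume xi: "\<xi> \<in> cball 0 R" and eta: "\<eta> \<in> cball 0 R" and t: "t \<in> {0..T}"
    let ?e = "\<lambda>t. K t * (c * (norm (\<eta> - \<xi>))\<^sup>2)"
    obtain N1 where N1: "negligible N1" "\<forall>t\<in>{0<..<T} - N1. (X \<xi> has_vector_derivative f t (X \<xi> t) (u0 t)) (at t)"
      using X_ode[OF order_refl, of T \<xi>] by (auto simp: ode_on_def)
    obtain N2 where N2: "negligible N2" "\<forall>t\<in>{0<..<T} - N2. (X \<eta> has_vector_derivative f t (X \<eta> t) (u0 t)) (at t)"
      using X_ode[OF order_refl, of T \<eta>] by (auto simp: ode_on_def)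
    have D: "ode_on (\<lambda>t _. f t (X \<eta> t) (u0 t) - f t (X \<xi> t) (u0 t)) 0 T (\<lambda>t. X \<eta> t - X \<xi> t)"
      unfolding ode_on_def
    proof (intro conjI exI[of _ "N1 \<union> N2"] ballI)
      show "abs_cont_on {0..T} (\<lambda>t. X \<eta> t - X \<xi> t)"
        using X_ode[OF order_refl, of T] by (intro abs_cont_on_diff) (auto simp: ode_on_def)
    qed (use N1 N2 in \<open>auto intro!: derivative_intros\<close>)
    have "norm (X \<eta> t - X \<xi> t - A \<xi> t *v (\<eta> - \<xi>)) \<le>
      (norm (X \<eta> 0 - X \<xi> 0 - A \<xi> 0 *v (\<eta> - \<xi>)) + integral {0..T} ?e) * exp (integral {0..T} M)"
    proof (rule ode_on_diff_gronwall[OF D A_vector_ode[OF order_refl] _ Ml(1,3) _ _ _ t])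
      show "?e integrable_on {0..T}" by (rule integrable_on_mult_left[OF Kl(1)])
      show "\<And>t. t \<in> {0..T} \<Longrightarrow> 0 \<le> ?e t" using Kl(3) by (auto simp: c_def)
      show "0 \<in> {0..T}" using T by simp
      fix t assume t: "t \<in> {0<..<T}"
      let ?D = "Df f t (X \<xi> t) (u0 t)"
      have tT: "t \<in> {0..T}" "u0 t \<in> U t" "0 \<le> t" using t u0_in by auto
      have ball: "X \<xi> t \<in> cball 0 \<rho>" "X \<eta> t \<in> cball 0 \<rho>" using \<rho> xi eta tT by auto
      have "norm (f t (X \<eta> t) (u0 t) - f t (X \<xi> t) (u0 t) - ?D *v (X \<eta> t - X \<xi> t)) \<le> K t * (norm (X \<eta> t - X \<xi> t))\<^sup>2"
      proof (rule linearisation_error[where S = "cball 0 \<rho>" and F = "\<lambda>y. f t y (u0 t)" and F' = "\<lambda>y h. Df f t y (u0 t) *v h"])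
        fix y z h :: "real ^ 'm" assume "y \<in> cball 0 \<rho>" "z \<in> cball (0 :: real ^ 'm) \<rho>"
        then have "norm (Df f t y (u0 t) - Df f t z (u0 t)) * norm h \<le> K t * norm (y - z) * norm h"
          using tT by (intro mult_right_mono K(2)) auto
        then show "norm (Df f t y (u0 t) *v h - Df f t z (u0 t) *v h) \<le> K t * norm (y - z) * norm h"
          using norm_matrix_vector_le[of "Df f t y (u0 t) - Df f t z (u0 t)" h]
          by (simp add: matrix_vector_mult_diff_rdistrib)
      qed (use ball f_derivative[OF tT(3)] in auto)
      also have "\<dots> \<le> K t * (c * (norm (\<eta> - \<xi>))\<^sup>2)"
        using X_lipschitz(1)[OF tT(1), of \<eta> \<xi>] Kl(3)[OF tT(1)] unfolding c_def power_mult_distrib[symmetric]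
        by (intro mult_left_mono power_mono) auto
      finally have 1: "norm (f t (X \<eta> t) (u0 t) - f t (X \<xi> t) (u0 t) - ?D *v (X \<eta> t - X \<xi> t)) \<le> ?e t" .
      have "norm (?D *v (X \<eta> t - X \<xi> t - A \<xi> t *v (\<eta> - \<xi>))) \<le> norm ?D * norm (X \<eta> t - X \<xi> t - A \<xi> t *v (\<eta> - \<xi>))"
        by (rule norm_matrix_vector_le)
      also have "\<dots> \<le> M t * norm (X \<eta> t - X \<xi> t - A \<xi> t *v (\<eta> - \<xi>))"
        using tT ball by (intro mult_right_mono M(2)) auto
      finally have 2: "norm (?D *v (X \<eta> t - X \<xi> t - A \<xi> t *v (\<eta> - \<xi>))) \<le> M t * norm (X \<eta> t - X \<xi> t - A \<xi> t *v (\<eta> - \<xi>))" .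
      have eq: "f t (X \<eta> t) (u0 t) - f t (X \<xi> t) (u0 t) - ?D *v (A \<xi> t *v (\<eta> - \<xi>))
         = ?D *v (X \<eta> t - X \<xi> t - A \<xi> t *v (\<eta> - \<xi>)) + (f t (X \<eta> t) (u0 t) - f t (X \<xi> t) (u0 t) - ?D *v (X \<eta> t - X \<xi> t))"
        by (simp add: matrix_vector_mult_diff_distrib)
      show "norm (f t (X \<eta> t) (u0 t) - f t (X \<xi> t) (u0 t) - ?D *v (A \<xi> t *v (\<eta> - \<xi>)))
          \<le> M t * norm (X \<eta> t - X \<xi> t - A \<xi> t *v (\<eta> - \<xi>)) + ?e t"
        unfolding eq by (rule norm_triangle_mono[OF 2 1])
    qed
    also have "\<dots> = c * integral {0..T} K * exp (integral {0..T} M) * (norm (\<eta> - \<xi>))\<^sup>2"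
      by (simp add: X_0 A_0)
    finally show "norm (X \<eta> t - X \<xi> t - A \<xi> t *v (\<eta> - \<xi>)) \<le> \<dots>" .
  qed
qed

text \<open>
  By the chain rule, the gradient of the running payoff with respect to the initial state.
\<close>

abbreviation payoff_gradient :: "real ^ 'm \<Rightarrow> real \<Rightarrow> real ^ 'm" where
  "payoff_gradient \<xi> t \<equiv> Dg g t (X \<xi> t) (u0 t) v* A \<xi> t"

abbreviation payoff_increment :: "real ^ 'm \<Rightarrow> real \<Rightarrow> real" where
  "payoff_increment \<xi> t \<equiv> g t (X \<xi> t) (u0 t) - g t (X 0 t) (u0 t)"

lemma I_has_integral: "0 \<le> T \<Longrightarrow> (payoff_gradient \<xi> has_integral I \<xi> T) {0..T}"
  and payoff_gradient_integrable: "0 \<le> T \<Longrightarrow> payoff_gradient \<xi> absolutely_integrable_on {0..T}"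
proof -
  assume T: "0 \<le> T"
  have i: "integrable (lebesgue_on {0..T}) (payoff_gradient \<xi>)" "integral\<^sup>L (lebesgue_on {0..T}) (payoff_gradient \<xi>) = I \<xi> T"
    using I[OF T, of \<xi>] by (auto simp: has_bochner_integral_iff)
  then show "(payoff_gradient \<xi> has_integral I \<xi> T) {0..T}"
    using has_integral_integral_lebesgue_on[OF i(1)] by simp
  show "payoff_gradient \<xi> absolutely_integrable_on {0..T}"
    using i(1) by (simp add: set_integrable_def integrable_restrict_space)
qed

text \<open>
  The chain rule with a remainder of second order whose coefficient is integrable in time.
\<close>

lemma payoff_linearised:
  assumes T: "0 \<le> T"
  shows "\<exists>\<kappa>. \<kappa> integrable_on {0..T} \<and> (\<forall>t\<in>{0..T}. 0 \<le> \<kappa> t) \<and>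
     (\<forall>\<xi>\<in>cball 0 R. \<forall>\<eta>\<in>cball 0 R. \<forall>t\<in>{0..T}.
        \<bar>g t (X \<eta> t) (u0 t) - g t (X \<xi> t) (u0 t) - payoff_gradient \<xi> t \<bullet> (\<eta> - \<xi>)\<bar> \<le> \<kappa> t * (norm (\<eta> - \<xi>))\<^sup>2)"
proof -
  obtain \<rho> where \<rho>: "\<And>\<xi> t. \<xi> \<in> cball 0 R \<Longrightarrow> t \<in> {0..T} \<Longrightarrow> norm (X \<xi> t) \<le> \<rho>" using X_bound[OF T] by blast
  obtain M where M: "M \<in> loc_summable" "\<And>t x v. t \<in> {0..T} \<Longrightarrow> x \<in> cball 0 \<rho> \<Longrightarrow> v \<in> U t \<Longrightarrow> norm (Dg g t x v) \<le> M t"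
    using integrally_bounded_tube[of U "Dg g" T \<rho>] Dg_regular unfolding regular_map_def by blast
  obtain K where K: "K \<in> loc_summable" "\<And>t x y v. t \<in> {0..T} \<Longrightarrow> v \<in> U t \<Longrightarrow> x \<in> cball 0 \<rho> \<Longrightarrow> y \<in> cball 0 \<rho> \<Longrightarrow>
       norm (Dg g t x v - Dg g t y v) \<le> K t * norm (x - y)"
    using locally_lipschitz_tube[of U "Dg g" T \<rho>] Dg_regular unfolding regular_map_def by blast
  obtain C where C: "0 \<le> C" "\<And>\<xi> \<eta> t. \<xi> \<in> cball 0 R \<Longrightarrow> \<eta> \<in> cball 0 R \<Longrightarrow> t \<in> {0..T} \<Longrightarrow>
       norm (X \<eta> t - X \<xi> t - A \<xi> t *v (\<eta> - \<xi>)) \<le> C * (norm (\<eta> - \<xi>))\<^sup>2"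
    using X_linearised[OF T, of R] by blast
  note Ml = loc_summable_integrable[OF M(1) order_refl order_refl T]
  note Kl = loc_summable_integrable[OF K(1) order_refl order_refl T]
  define c where "c = (flow_const T)\<^sup>2"
  show ?thesis
  proof (intro exI[of _ "\<lambda>t. K t * c + M t * C"] conjI ballI)
    show "(\<lambda>t. K t * c + M t * C) integrable_on {0..T}"
      by (intro integrable_add integrable_on_mult_left Kl(1) Ml(1))
    show "0 \<le> K t * c + M t * C" if "t \<in> {0..T}" for t
      using Kl(3)[OF that] Ml(3)[OF that] C(1) by (simp add: c_def)
    fix \<xi> \<eta> :: "real ^ 'm" and t assume xi: "\<xi> \<in> cball 0 R" and eta: "\<eta> \<in> cball 0 R" and t: "t \<in> {0..T}"
    let ?D = "Dg g t (X \<xi> t) (u0 t)"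
    have tT: "u0 t \<in> U t" "0 \<le> t" using t u0_in by auto
    have ball: "X \<xi> t \<in> cball 0 \<rho>" "X \<eta> t \<in> cball 0 \<rho>" using \<rho> xi eta t by auto
    have "norm (g t (X \<eta> t) (u0 t) - g t (X \<xi> t) (u0 t) - ?D \<bullet> (X \<eta> t - X \<xi> t)) \<le> K t * (norm (X \<eta> t - X \<xi> t))\<^sup>2"
    proof (rule linearisation_error[where S = "cball 0 \<rho>" and F = "\<lambda>y. g t y (u0 t)" and F' = "\<lambda>y h. Dg g t y (u0 t) \<bullet> h"])
      fix y z h :: "real ^ 'm" assume "y \<in> cball 0 \<rho>" "z \<in> cball (0 :: real ^ 'm) \<rho>"
      then have "norm (Dg g t y (u0 t) - Dg g t z (u0 t)) * norm h \<le> K t * norm (y - z) * norm h"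
        using tT t by (intro mult_right_mono K(2)) auto
      then show "norm (Dg g t y (u0 t) \<bullet> h - Dg g t z (u0 t) \<bullet> h) \<le> K t * norm (y - z) * norm h"
        using Cauchy_Schwarz_ineq2[of "Dg g t y (u0 t) - Dg g t z (u0 t)" h]
        by (simp add: inner_diff_left)
    qed (use ball g_derivative[OF tT(2)] in auto)
    also have "\<dots> \<le> K t * (c * (norm (\<eta> - \<xi>))\<^sup>2)"
      using X_lipschitz(1)[OF t, of \<eta> \<xi>] Kl(3)[OF t] unfolding c_def power_mult_distrib[symmetric]
      by (intro mult_left_mono power_mono) auto
    finally have 1: "\<bar>g t (X \<eta> t) (u0 t) - g t (X \<xi> t) (u0 t) - ?D \<bullet> (X \<eta> t - X \<xi> t)\<bar> \<le> K t * (c * (norm (\<eta> - \<xi>))\<^sup>2)" by simp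
    have "\<bar>?D \<bullet> (X \<eta> t - X \<xi> t - A \<xi> t *v (\<eta> - \<xi>))\<bar> \<le> norm ?D * norm (X \<eta> t - X \<xi> t - A \<xi> t *v (\<eta> - \<xi>))"
      by (rule Cauchy_Schwarz_ineq2)
    also have "\<dots> \<le> M t * (C * (norm (\<eta> - \<xi>))\<^sup>2)"
      using t tT ball Ml(3)[OF t] by (intro mult_mono M(2) C(2) xi eta) auto
    finally have 2: "\<bar>?D \<bullet> (X \<eta> t - X \<xi> t - A \<xi> t *v (\<eta> - \<xi>))\<bar> \<le> M t * (C * (norm (\<eta> - \<xi>))\<^sup>2)" .
    have "payoff_gradient \<xi> t \<bullet> (\<eta> - \<xi>) = ?D \<bullet> (A \<xi> t *v (\<eta> - \<xi>))" by (rule inner_vector_matrix)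
    then show "\<bar>g t (X \<eta> t) (u0 t) - g t (X \<xi> t) (u0 t) - payoff_gradient \<xi> t \<bullet> (\<eta> - \<xi>)\<bar> \<le> (K t * c + M t * C) * (norm (\<eta> - \<xi>))\<^sup>2"
      using 1 2 by (simp add: inner_diff_right algebra_simps)
  qed
qed

text \<open>
  Telescoping along the points \<open>(k / N) *\<^sub>R \<xi>\<close> and linearising each step exhibits the payoff increment as
  the pointwise limit of means of payoff gradients, with an error of order \<open>1 / N\<close>. This yields its
  measurability, which is known of the gradients but not of \<open>g\<close> along \<open>X \<xi>\<close>, and, by dominated
  convergence, expresses its integral through the functions \<open>I\<close>.
\<close>

lemma payoff_increment_integral:
  assumes T: "0 \<le> T"
  shows "payoff_increment \<xi> integrable_on {0..T}"
    and "(\<lambda>N. (\<Sum>k<Suc N. I ((real k / real (Suc N)) *\<^sub>R \<xi>) T \<bullet> \<xi>) / real (Suc N)) \<longlonglongrightarrow> integral {0..T} (payoff_increment \<xi>)"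
proof -
  obtain \<kappa> where \<kappa>: "\<kappa> integrable_on {0..T}" "\<And>t. t \<in> {0..T} \<Longrightarrow> 0 \<le> \<kappa> t"
     "\<And>\<zeta> \<eta> t. \<zeta> \<in> cball 0 (norm \<xi>) \<Longrightarrow> \<eta> \<in> cball 0 (norm \<xi>) \<Longrightarrow> t \<in> {0..T} \<Longrightarrow>
        \<bar>g t (X \<eta> t) (u0 t) - g t (X \<zeta> t) (u0 t) - payoff_gradient \<zeta> t \<bullet> (\<eta> - \<zeta>)\<bar> \<le> \<kappa> t * (norm (\<eta> - \<zeta>))\<^sup>2"
    using payoff_linearised[OF T, of "norm \<xi>"] by blast
  define \<zeta> where "\<zeta> N k = (real k / real (Suc N)) *\<^sub>R \<xi>" for N k :: nat
  define S where "S N t = (\<Sum>k<Suc N. payoff_gradient (\<zeta> N k) t \<bullet> \<xi>) / real (Suc N)" for N t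
  have S: "(S N has_integral (\<Sum>k<Suc N. I (\<zeta> N k) T \<bullet> \<xi>) / real (Suc N)) {0..T}" for N
    unfolding S_def divide_inverse
    by (intro has_integral_mult_left has_integral_sum finite_lessThan has_integral_linear[OF I_has_integral[OF T] bounded_linear_inner_left, unfolded o_def])
  have err: "\<bar>payoff_increment \<xi> t - S N t\<bar> \<le> \<kappa> t * (norm \<xi>)\<^sup>2 / real (Suc N)" if t: "t \<in> {0..T}" for N t
  proof -
    have "payoff_increment \<xi> t = (\<Sum>k<Suc N. g t (X (\<zeta> N (Suc k)) t) (u0 t) - g t (X (\<zeta> N k) t) (u0 t))"
      by (subst sum_lessThan_telescope) (simp add: \<zeta>_def)
    moreover have "S N t = (\<Sum>k<Suc N. payoff_gradient (\<zeta> N k) t \<bullet> (\<zeta> N (Suc k) - \<zeta> N k))"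
      unfolding S_def sum_divide_distrib
      by (intro sum.cong) (auto simp: \<zeta>_def add_divide_distrib diff_divide_distrib scaleR_left_diff_distrib[symmetric])
    ultimately have "\<bar>payoff_increment \<xi> t - S N t\<bar> = \<bar>\<Sum>k<Suc N. g t (X (\<zeta> N (Suc k)) t) (u0 t) - g t (X (\<zeta> N k) t) (u0 t)
         - payoff_gradient (\<zeta> N k) t \<bullet> (\<zeta> N (Suc k) - \<zeta> N k)\<bar>"
      by (simp only: sum_subtractf)
    also have "\<dots> \<le> (\<Sum>k<Suc N. \<bar>g t (X (\<zeta> N (Suc k)) t) (u0 t) - g t (X (\<zeta> N k) t) (u0 t)
         - payoff_gradient (\<zeta> N k) t \<bullet> (\<zeta> N (Suc k) - \<zeta> N k)\<bar>)"
      by (rule sum_abs)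
    also have "\<dots> \<le> (\<Sum>k<Suc N. \<kappa> t * (norm (\<zeta> N (Suc k) - \<zeta> N k))\<^sup>2)"
    proof (rule sum_mono)
      fix k assume "k \<in> {..<Suc N}"
      then have "\<zeta> N k \<in> cball 0 (norm \<xi>)" "\<zeta> N (Suc k) \<in> cball 0 (norm \<xi>)"
        by (auto simp: \<zeta>_def divide_le_eq mult.commute[of "norm \<xi>"] intro!: mult_right_mono)
      then show "\<bar>g t (X (\<zeta> N (Suc k)) t) (u0 t) - g t (X (\<zeta> N k) t) (u0 t)
         - payoff_gradient (\<zeta> N k) t \<bullet> (\<zeta> N (Suc k) - \<zeta> N k)\<bar> \<le> \<kappa> t * (norm (\<zeta> N (Suc k) - \<zeta> N k))\<^sup>2"
        using t by (rule \<kappa>(3))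
    qed
    also have "\<dots> = (\<Sum>k<Suc N. \<kappa> t * (norm \<xi> / real (Suc N))\<^sup>2)"
      by (intro sum.cong) (auto simp: \<zeta>_def add_divide_distrib diff_divide_distrib scaleR_left_diff_distrib[symmetric])
    also have "\<dots> = \<kappa> t * (norm \<xi>)\<^sup>2 / real (Suc N)"
      by (simp add: power2_eq_square divide_simps del: of_nat_Suc)
    finally show ?thesis .
  qed
  have dom: "norm (S N t) \<le> \<bar>S 0 t\<bar> + \<kappa> t * (2 * (norm \<xi>)\<^sup>2)" if t: "t \<in> {0..T}" for N t
  proof -
    have "\<kappa> t * (norm \<xi>)\<^sup>2 / real (Suc N) \<le> \<kappa> t * (norm \<xi>)\<^sup>2"
      using \<kappa>(2)[OF t] divide_left_mono[of 1 "real (Suc N)" "\<kappa> t * (norm \<xi>)\<^sup>2"] by simp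
    then show ?thesis using err[OF t, of N] err[OF t, of 0] by (simp add: abs_le_iff) linarith
  qed
  have S0: "S 0 absolutely_integrable_on {0..T}"
    unfolding S_def using payoff_gradient_integrable[OF T, of 0]
    by (simp add: \<zeta>_def) (rule absolutely_integrable_linear[OF _ bounded_linear_inner_left, unfolded o_def])
  have conv: "(\<lambda>N. S N t) \<longlonglongrightarrow> payoff_increment \<xi> t" if t: "t \<in> {0..T}" for t
  proof (rule LIMSEQ_I)
    have "(\<lambda>N. \<kappa> t * (norm \<xi>)\<^sup>2 * inverse (real (Suc N))) \<longlonglongrightarrow> \<kappa> t * (norm \<xi>)\<^sup>2 * 0"
      by (intro tendsto_mult tendsto_const LIMSEQ_inverse_real_of_nat)
    then have lim: "(\<lambda>N. \<kappa> t * (norm \<xi>)\<^sup>2 / real (Suc N)) \<longlonglongrightarrow> 0" by (simp add: divide_inverse)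
    fix r :: real assume "0 < r"
    from order_tendstoD(2)[OF lim this] obtain M where "\<And>N. N \<ge> M \<Longrightarrow> \<kappa> t * (norm \<xi>)\<^sup>2 / real (Suc N) < r"
      unfolding eventually_sequentially by blast
    then show "\<exists>M. \<forall>N\<ge>M. norm (S N t - payoff_increment \<xi> t) < r"
      using err[OF t] by (intro exI[of _ M]) (auto simp: abs_minus_commute intro: le_less_trans)
  qed
  have h: "(\<lambda>t. \<bar>S 0 t\<bar> + \<kappa> t * (2 * (norm \<xi>)\<^sup>2)) integrable_on {0..T}"
    using S0 by (intro integrable_add integrable_on_mult_left \<kappa>(1)) (auto simp: absolutely_integrable_on_def)
  have Si: "S N integrable_on {0..T}" for N using S[of N] by (rule has_integral_integrable)
  show "payoff_increment \<xi> integrable_on {0..T}" by (rule dominated_convergence(1)[OF Si h dom conv])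
  have "(\<lambda>N. integral {0..T} (S N)) \<longlonglongrightarrow> integral {0..T} (payoff_increment \<xi>)"
    by (rule dominated_convergence(2)[OF Si h dom conv])
  then show "(\<lambda>N. (\<Sum>k<Suc N. I ((real k / real (Suc N)) *\<^sub>R \<xi>) T \<bullet> \<xi>) / real (Suc N)) \<longlonglongrightarrow> integral {0..T} (payoff_increment \<xi>)"
    by (simp only: integral_unique[OF S] \<zeta>_def)
qed

lemma payoff_increment_linearised:
  assumes T: "0 \<le> T"
  shows "\<exists>C\<ge>0. \<forall>\<xi>\<in>cball 0 R. \<forall>s\<in>{0..T}. \<bar>integral {0..s} (payoff_increment \<xi>) - I 0 s \<bullet> \<xi>\<bar> \<le> C * (norm \<xi>)\<^sup>2"
proof (cases "R < 0")
  case False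
  obtain \<kappa> where \<kappa>: "\<kappa> integrable_on {0..T}" "\<And>t. t \<in> {0..T} \<Longrightarrow> 0 \<le> \<kappa> t"
     "\<And>\<zeta> \<eta> t. \<zeta> \<in> cball 0 R \<Longrightarrow> \<eta> \<in> cball 0 R \<Longrightarrow> t \<in> {0..T} \<Longrightarrow>
        \<bar>g t (X \<eta> t) (u0 t) - g t (X \<zeta> t) (u0 t) - payoff_gradient \<zeta> t \<bullet> (\<eta> - \<zeta>)\<bar> \<le> \<kappa> t * (norm (\<eta> - \<zeta>))\<^sup>2"
    using payoff_linearised[OF T, of R] by blast
  show ?thesis
  proof (intro exI[of _ "integral {0..T} \<kappa>"] conjI ballI)
    show "0 \<le> integral {0..T} \<kappa>" using \<kappa> by (intro HK_integral_nonneg)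
    fix \<xi> :: "real ^ 'm" and s assume xi: "\<xi> \<in> cball 0 R" and s: "s \<in> {0..T}"
    then have s0: "0 \<le> s" by simp
    have "((\<lambda>t. payoff_gradient 0 t \<bullet> \<xi>) has_integral I 0 s \<bullet> \<xi>) {0..s}"
      by (rule has_integral_linear[OF I_has_integral[OF s0] bounded_linear_inner_left, unfolded o_def])
    with payoff_increment_integral(1)[OF s0, of \<xi>]
    have "((\<lambda>t. payoff_increment \<xi> t - payoff_gradient 0 t \<bullet> \<xi>) has_integral integral {0..s} (payoff_increment \<xi>) - I 0 s \<bullet> \<xi>) {0..s}"
      by (intro has_integral_diff integrable_integral)
    then have i: "(\<lambda>t. payoff_increment \<xi> t - payoff_gradient 0 t \<bullet> \<xi>) integrable_on {0..s}"
      and e: "integral {0..s} (\<lambda>t. payoff_increment \<xi> t - payoff_gradient 0 t \<bullet> \<xi>) = integral {0..s} (payoff_increment \<xi>) - I 0 s \<bullet> \<xi>"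
      by (auto simp: integral_unique)
    have \<kappa>s: "(\<lambda>t. \<kappa> t * (norm \<xi>)\<^sup>2) integrable_on {0..s}" "\<kappa> integrable_on {0..s}"
      using s by (auto intro!: integrable_on_mult_left integrable_on_subinterval[OF \<kappa>(1)])
    have "norm (integral {0..s} (\<lambda>t. payoff_increment \<xi> t - payoff_gradient 0 t \<bullet> \<xi>)) \<le> integral {0..s} (\<lambda>t. \<kappa> t * (norm \<xi>)\<^sup>2)"
      using \<kappa>(3)[of 0 \<xi>] xi s False by (intro HK_integral_norm_bound_integral i \<kappa>s) auto
    also have "\<dots> = integral {0..s} \<kappa> * (norm \<xi>)\<^sup>2" by simp
    also have "\<dots> \<le> integral {0..T} \<kappa> * (norm \<xi>)\<^sup>2"
      using s \<kappa> \<kappa>s by (intro mult_right_mono integral_subset_le) auto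
    finally show "\<bar>integral {0..s} (payoff_increment \<xi>) - I 0 s \<bullet> \<xi>\<bar> \<le> integral {0..T} \<kappa> * (norm \<xi>)\<^sup>2" using e by simp
  qed
qed (auto intro: exI[of _ 0])

end

section \<open>Needle variations and the costate\<close>

text \<open>
  A product rule in which one factor is merely continuous: where the other factor vanishes, the
  missing term is of lower order.
\<close>

lemma has_vector_derivative_bilinear_at_zero:
  fixes \<psi> :: "real \<Rightarrow> 'a::real_normed_vector" and y :: "real \<Rightarrow> 'b::real_normed_vector"
    and h :: "'a \<Rightarrow> 'b \<Rightarrow> 'c::real_normed_vector"
  assumes h: "bounded_bilinear h" and \<psi>: "isCont \<psi> t" and y: "(y has_vector_derivative y') (at t)" "y t = 0"
  shows "((\<lambda>r. h (\<psi> r) (y r)) has_vector_derivative h (\<psi> t) y') (at t)"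
proof -
  interpret bounded_bilinear h by fact
  obtain K where K: "K > 0" "\<And>p q. norm (h p q) \<le> norm p * norm q * K" using pos_bounded by blast
  have lin: "((\<lambda>r. h (\<psi> t) (y r)) has_vector_derivative h (\<psi> t) y') (at t)"
    by (rule bounded_linear.has_vector_derivative[OF bounded_linear_right y(1)])
  have small: "((\<lambda>r. h (\<psi> r - \<psi> t) (y r)) has_vector_derivative 0) (at t)"
    unfolding has_vector_derivative_def has_derivative_within_alt
  proof (intro conjI allI impI)
    show "bounded_linear (\<lambda>r::real. r *\<^sub>R (0::'c))" by (rule bounded_linear_scaleR_left)
    fix e :: real assume e: "0 < e"
    define c where "c = norm y' + 1"
    have c: "c > 0" by (simp add: c_def add_nonneg_pos)
    obtain d1 where d1: "d1 > 0" "\<And>r. \<bar>r - t\<bar> < d1 \<Longrightarrow> norm (y r - y t - (r - t) *\<^sub>R y') \<le> 1 * \<bar>r - t\<bar>"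
      using y(1) zero_less_one unfolding has_vector_derivative_def has_derivative_within_alt real_norm_def by blast
    have "e / (c * K) > 0" using e c K by simp
    then obtain d2 where d2: "d2 > 0" "\<And>r. \<bar>r - t\<bar> < d2 \<Longrightarrow> norm (\<psi> r - \<psi> t) < e / (c * K)"
      using \<psi> unfolding continuous_at_eps_delta by (metis dist_norm real_norm_def)
    show "\<exists>d>0. \<forall>r\<in>UNIV. norm (r - t) < d \<longrightarrow>
        norm (h (\<psi> r - \<psi> t) (y r) - h (\<psi> t - \<psi> t) (y t) - (r - t) *\<^sub>R 0) \<le> e * norm (r - t)"
    proof (intro exI conjI ballI impI)
      show "min d1 d2 > 0" using d1 d2 by simp
      fix r assume r: "norm (r - t) < min d1 d2"
      have "norm (y r) \<le> norm (y r - y t - (r - t) *\<^sub>R y') + norm ((r - t) *\<^sub>R y')"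
        using norm_triangle_ineq[of "y r - y t - (r - t) *\<^sub>R y'" "(r - t) *\<^sub>R y'"] y(2) by simp
      also have "\<dots> \<le> 1 * \<bar>r - t\<bar> + \<bar>r - t\<bar> * norm y'" using d1(2)[of r] r by (intro add_mono) auto
      finally have yr: "norm (y r) \<le> c * \<bar>r - t\<bar>" by (simp add: c_def algebra_simps)
      have "norm (h (\<psi> r - \<psi> t) (y r)) \<le> norm (\<psi> r - \<psi> t) * norm (y r) * K" by (rule K(2))
      also have "\<dots> \<le> e / (c * K) * (c * \<bar>r - t\<bar>) * K"
        using d2(2)[of r] r yr K(1) e c by (intro mult_right_mono mult_mono) auto
      also have "\<dots> = e * \<bar>r - t\<bar>" using c K by simp
      finally show "norm (h (\<psi> r - \<psi> t) (y r) - h (\<psi> t - \<psi> t) (y t) - (r - t) *\<^sub>R 0) \<le> e * norm (r - t)"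
        by (simp add: zero_left)
    qed
  qed
  have "((\<lambda>r. h (\<psi> t) (y r) + h (\<psi> r - \<psi> t) (y r)) has_vector_derivative h (\<psi> t) y' + 0) (at t)"
    by (intro has_vector_derivative_add lin small)
  then show ?thesis by (simp add: diff_left)
qed

lemma matrix_inv_works:
  fixes M :: "real ^ 'n ^ 'n"
  assumes "\<And>h. norm h \<le> C * norm (M *v h)"
  shows "M ** matrix_inv M = mat 1" "matrix_inv M ** M = mat 1"
proof -
  have "inj ((*v) M)"
  proof (rule injI)
    fix p q assume "M *v p = M *v q"
    then have "M *v (p - q) = 0" by (simp add: matrix_vector_mult_diff_distrib)
    then show "p = q" using assms[of "p - q"] by simp
  qed
  then have "invertible M" by (simp add: invertible_left_inverse matrix_left_invertible_injective)
  then have "\<exists>B. M ** B = mat 1 \<and> B ** M = mat 1" by (simp add: invertible_def)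
  from someI_ex[OF this] show "M ** matrix_inv M = mat 1" "matrix_inv M ** M = mat 1"
    by (simp_all add: matrix_inv_def)
qed

text \<open>
  The operator \<open>p \<mapsto> p v* matrix_inv M\<close> is the transpose of the inverse of \<open>M\<close>, so it inherits the bound of
  the inverse.
\<close>

lemma norm_vector_matrix_inv_le:
  fixes M :: "real ^ 'n ^ 'n"
  assumes le: "\<And>h. norm h \<le> C * norm (M *v h)"
  shows "norm (p v* matrix_inv M) \<le> C * norm p"
proof -
  let ?B = "matrix_inv M"
  have B: "norm (?B *v h) \<le> C * norm h" for h
    using le[of "?B *v h"] by (simp add: matrix_vector_mul_assoc matrix_inv_works[OF le])
  let ?q = "p v* ?B"
  have "norm ?q * norm ?q = p \<bullet> (?B *v ?q)"
    using inner_vector_matrix[of p ?B ?q] by (simp add: power2_norm_eq_inner[symmetric] power2_eq_square)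
  also have "\<dots> \<le> norm p * norm (?B *v ?q)" by (rule norm_cauchy_schwarz)
  also have "\<dots> \<le> norm p * (C * norm ?q)" by (intro mult_left_mono B) auto
  finally have "norm ?q * norm ?q \<le> (C * norm p) * norm ?q" by (simp add: mult_ac)
  then show ?thesis
    using order_trans[OF norm_ge_zero B[of p]] by (cases "norm ?q = 0") (auto simp: mult_le_cancel_right)
qed

context regular_control_system
begin

definition needle :: "(real \<Rightarrow> 'u) \<Rightarrow> real \<Rightarrow> real \<Rightarrow> real \<Rightarrow> 'u" where
  "needle u s t r = (if r \<in> {s..t} then u r else u0 r)"

lemma needle_selector: "u \<in> selectors U \<Longrightarrow> needle u s t \<in> selectors U"
proof -
  assume u: "u \<in> selectors U"
  have "(\<lambda>r. if r \<in> {s..t} then u r else u0 r) \<in> borel_measurable (restrict_space borel {0..})"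
  proof (rule measurable_If_set)
    show "{s..t} \<inter> space (restrict_space borel {0..}) \<in> sets (restrict_space borel {0..})"
      by (auto simp: sets_restrict_space space_restrict_space intro!: image_eqI[of _ _ "{s..t}"])
  qed (use u u0 in \<open>auto simp: selectors_def\<close>)
  then show ?thesis using u u0 by (auto simp: selectors_def needle_def[abs_def])
qed

lemma needle_ode:
  assumes u: "u \<in> selectors U" and s: "0 \<le> s"
  shows "ode_on (\<lambda>r y. f r y (u0 r)) 0 s (\<phi> (needle u s t))"
    and "ode_on (\<lambda>r y. f r y (u r)) s t (\<phi> (needle u s t))"
    and "s \<le> t \<Longrightarrow> ode_on (\<lambda>r y. f r y (u0 r)) t T (\<phi> (needle u s t))"
  using s by (auto intro!: ode_on_cong[OF phi_ode[OF needle_selector[OF u]]] simp: needle_def)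

lemma needle_before:
  assumes u: "u \<in> selectors U" and r: "r \<in> {0..s}"
  shows "\<phi> (needle u s t) r = X 0 r"
  using trajectories_lipschitz[OF u0 order_refl order_refl _ needle_ode(1)[OF u] X_ode[OF order_refl], of s 0 r t 0] r
  by (simp add: X_0 phi_0 needle_selector[OF u])

lemma phi_bound:
  assumes "0 \<le> T"
  shows "\<exists>\<rho>. \<forall>u\<in>selectors U. \<forall>t\<in>{0..T}. norm (\<phi> u t) \<le> \<rho>"
proof -
  obtain \<rho> where "\<forall>u\<in>selectors U. \<forall>x. ode_on (\<lambda>t y. f t y (u t)) 0 T x \<longrightarrow> norm (x 0) \<le> 0 \<longrightarrow>
           (\<forall>t\<in>{0..T}. norm (x t) \<le> \<rho>)"
    using trajectory_bound[OF assms] by blast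
  then show ?thesis using phi_ode[OF _ order_refl] phi_0 by (intro exI[of _ \<rho>]) simp
qed

text \<open>
  The deviation is at most twice the integral of a bound of \<open>f\<close> over the needle, whatever the control. It
  tends to \<open>0\<close> with the length of the needle, and it is available before \<open>f\<close> along the reference
  trajectory with another control inserted is known to be measurable.
\<close>

lemma needle_deviation:
  assumes T: "0 \<le> T"
  shows "\<exists>M\<in>loc_summable. \<forall>u\<in>selectors U. \<forall>s t r. 0 \<le> s \<longrightarrow> s \<le> r \<longrightarrow> r \<le> t \<longrightarrow> t \<le> T \<longrightarrow>
           norm (\<phi> (needle u s t) r - X 0 r) \<le> 2 * integral {s..t} M"
proof -
  obtain \<rho> where \<rho>: "\<And>u t. u \<in> selectors U \<Longrightarrow> t \<in> {0..T} \<Longrightarrow> norm (\<phi> u t) \<le> \<rho>" using phi_bound[OF T] by blast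
  obtain M where M: "M \<in> loc_summable" "\<And>t x v. t \<in> {0..T} \<Longrightarrow> x \<in> cball 0 \<rho> \<Longrightarrow> v \<in> U t \<Longrightarrow> norm (f t x v) \<le> M t"
    using integrally_bounded_tube[of U f T \<rho>] f_regular unfolding regular_map_def by blast
  show ?thesis
  proof (intro bexI[OF _ M(1)] ballI allI impI)
    fix u s t r assume u: "u \<in> selectors U" and st: "0 \<le> s" "s \<le> r" "r \<le> t" "t \<le> T"
    note Ml = loc_summable_integrable[OF M(1) st(1) st(4) T]
    have *: "norm (\<phi> w r - \<phi> w s) \<le> integral {s..t} M" if w: "w \<in> selectors U" for w
    proof -
      have i: "((\<lambda>q. f q (\<phi> w q) (w q)) has_integral (\<phi> w r - \<phi> w s)) {s..r}"
        using phi_ode[OF w st(1)] st(2) by (rule ode_on_has_integral)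
      have Mr: "M integrable_on {s..r}" by (rule integrable_on_subinterval[OF Ml(1)]) (use st in auto)
      have "norm (integral {s..r} (\<lambda>q. f q (\<phi> w q) (w q))) \<le> integral {s..r} M"
      proof (rule HK_integral_norm_bound_integral[OF has_integral_integrable[OF i] Mr])
        fix q assume "q \<in> {s..r}"
        then show "norm (f q (\<phi> w q) (w q)) \<le> M q" using st \<rho>[OF w, of q] selector_in[OF w, of q] by (intro M(2)) auto
      qed
      also have "\<dots> \<le> integral {s..t} M" using st Ml Mr by (intro integral_subset_le) auto
      finally show ?thesis by (simp add: integral_unique[OF i])
    qed
    have "\<phi> (needle u s t) s = X 0 s" using needle_before[OF u, of s s t] st by simp
    moreover have "\<phi> u0 r = X 0 r" "\<phi> u0 s = X 0 s" using phi_u0 st by auto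
    ultimately have eq: "\<phi> (needle u s t) r - X 0 r = (\<phi> (needle u s t) r - \<phi> (needle u s t) s) - (\<phi> u0 r - \<phi> u0 s)" by simp
    have "norm (\<phi> (needle u s t) r - X 0 r) \<le> norm (\<phi> (needle u s t) r - \<phi> (needle u s t) s) + norm (\<phi> u0 r - \<phi> u0 s)"
      unfolding eq by (rule norm_triangle_ineq4)
    also have "\<dots> \<le> integral {s..t} M + integral {s..t} M"
      by (rule add_mono[OF *[OF needle_selector[OF u]] *[OF u0]])
    finally show "norm (\<phi> (needle u s t) r - X 0 r) \<le> 2 * integral {s..t} M" by (simp only: mult_2)
  qed
qed

text \<open>
  The equations and payoffs are known to be measurable along the trajectories of the controls
  themselves, not along \<open>X 0\<close> with another control \<open>u\<close> inserted. Cut time into intervals of length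
  \<open>1 / (N + 1)\<close> and, at a time \<open>t\<close>, use the trajectory of the needle on the interval that contains \<open>t\<close>: its
  control value at \<open>t\<close> is \<open>u t\<close>, its state is close to \<open>X 0 t\<close>, and continuity in the state gives the limit.
\<close>

lemma measurable_along_base:
  fixes a :: "real \<Rightarrow> real ^ 'm \<Rightarrow> 'u \<Rightarrow> 'b::euclidean_space"
  assumes a: "caratheodory U a" and u: "u \<in> selectors U" and T: "0 \<le> T"
    and meas: "\<And>w. w \<in> selectors U \<Longrightarrow> (\<lambda>t. a t (\<phi> w t) (w t)) \<in> borel_measurable (lebesgue_on {0..T})"
  shows "(\<lambda>t. a t (X 0 t) (u t)) \<in> borel_measurable (lebesgue_on {0..T})"
proof -
  \<comment> \<open>The interval that contains a time up to \<open>T\<close> may end after \<open>T\<close>, but not after \<open>T + 1\<close>.\<close>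
  have T1: "0 \<le> T + 1" using T by simp
  obtain M where M: "M \<in> loc_summable" "\<And>u s t r. u \<in> selectors U \<Longrightarrow> 0 \<le> s \<Longrightarrow> s \<le> r \<Longrightarrow> r \<le> t \<Longrightarrow> t \<le> T + 1 \<Longrightarrow>
           norm (\<phi> (needle u s t) r - X 0 r) \<le> 2 * integral {s..t} M"
    using needle_deviation[OF T1] by blast
  define j where "j N t = nat \<lfloor>t * real (Suc N)\<rfloor>" for N t
  define lo where "lo N k = real k / real (Suc N)" for N k
  define w where "w N k = needle u (lo N k) (lo N (Suc k))" for N k
  have j: "lo N (j N t) \<le> t" "t \<le> lo N (Suc (j N t))" "0 \<le> lo N (j N t)" "t - lo N (j N t) \<le> inverse (real (Suc N))"
       "lo N (Suc (j N t)) - t \<le> inverse (real (Suc N))" if "0 \<le> t" for N t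
  proof -
    define n where "n = real (Suc N)"
    have n: "0 < n" by (simp add: n_def)
    have "0 \<le> t * n" using that n by simp
    then have k: "real (j N t) \<le> t * n" "t * n \<le> real (j N t) + 1"
      unfolding j_def n_def[symmetric] by linarith+
    have lo: "lo N k = real k / n" for k by (simp add: lo_def n_def)
    have t: "t = t * n / n" using n by simp
    show "lo N (j N t) \<le> t" "t \<le> lo N (Suc (j N t))" "0 \<le> lo N (j N t)"
      using k n by (auto simp: lo pos_divide_le_eq pos_le_divide_eq)
    have "t - lo N (j N t) = (t * n - real (j N t)) / n" "lo N (Suc (j N t)) - t = (real (Suc (j N t)) - t * n) / n"
      using n by (simp_all add: lo diff_divide_distrib)
    moreover have "(t * n - real (j N t)) / n \<le> 1 / n" "(real (Suc (j N t)) - t * n) / n \<le> 1 / n"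
      using k n by (intro divide_right_mono; simp)+
    ultimately show "t - lo N (j N t) \<le> inverse (real (Suc N))" "lo N (Suc (j N t)) - t \<le> inverse (real (Suc N))"
      by (simp_all only: n_def[symmetric] inverse_eq_divide)
  qed
  show ?thesis
  proof (rule borel_measurable_LIMSEQ_metric)
    fix N
    have "(\<lambda>t. t * real (Suc N)) \<in> borel_measurable (lebesgue_on {0..T})"
      by (intro continuous_imp_measurable_on_sets_lebesgue continuous_intros) simp
    then have jm: "j N \<in> measurable (lebesgue_on {0..T}) (count_space UNIV)"
      unfolding j_def by measurable
    have "w N k \<in> selectors U" for k by (simp add: w_def needle_selector[OF u])
    from meas[OF this] jm
    show "(\<lambda>t. a t (\<phi> (w N (j N t)) t) (w N (j N t) t)) \<in> borel_measurable (lebesgue_on {0..T})"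
      by (rule measurable_compose_countable)
  next
    fix t assume "t \<in> space (lebesgue_on {0..T})"
    then have t: "0 \<le> t" "t \<le> T" by auto
    have wt: "w N (j N t) t = u t" for N using j(1,2)[OF t(1), of N] by (simp add: w_def needle_def)
    define \<Lambda> where "\<Lambda> r = integral {0..r} M" for r
    note Ml = loc_summable_integrable[OF M(1) order_refl order_refl T1]
    have \<Lambda>: "continuous_on {0..T + 1} \<Lambda>" unfolding \<Lambda>_def by (rule indefinite_integral_continuous_1[OF Ml(1)])
    have inv: "inverse (real (Suc N)) \<le> 1" for N by (simp add: divide_simps)
    have lo01: "lo N (j N t) \<in> {0..T + 1}" "lo N (Suc (j N t)) \<in> {0..T + 1}" for N
      using j[OF t(1), of N] t inv[of N] by auto
    have lim1: "(\<lambda>N. lo N (j N t)) \<longlonglongrightarrow> t"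
      by (rule metric_tendsto_imp_tendsto[OF LIMSEQ_inverse_real_of_nat])
         (use j[OF t(1)] in \<open>auto intro!: always_eventually simp: dist_real_def simp del: of_nat_Suc\<close>)
    have lim2: "(\<lambda>N. lo N (Suc (j N t))) \<longlonglongrightarrow> t"
      by (rule metric_tendsto_imp_tendsto[OF LIMSEQ_inverse_real_of_nat])
         (use j[OF t(1)] in \<open>auto intro!: always_eventually simp: dist_real_def simp del: of_nat_Suc\<close>)
    have "(\<lambda>N. \<Lambda> (lo N (j N t))) \<longlonglongrightarrow> \<Lambda> t" "(\<lambda>N. \<Lambda> (lo N (Suc (j N t)))) \<longlonglongrightarrow> \<Lambda> t"
      using t lo01 by (auto intro!: continuous_on_tendsto_compose[OF \<Lambda>] lim1 lim2 always_eventually)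
    then have "(\<lambda>N. 2 * (\<Lambda> (lo N (Suc (j N t))) - \<Lambda> (lo N (j N t)))) \<longlonglongrightarrow> 2 * (\<Lambda> t - \<Lambda> t)"
      by (intro tendsto_intros)
    then have lim0: "(\<lambda>N. 2 * (\<Lambda> (lo N (Suc (j N t))) - \<Lambda> (lo N (j N t)))) \<longlonglongrightarrow> 0" by simp
    have dev: "norm (\<phi> (w N (j N t)) t - X 0 t) \<le> 2 * (\<Lambda> (lo N (Suc (j N t))) - \<Lambda> (lo N (j N t)))" for N
    proof -
      have "norm (\<phi> (w N (j N t)) t - X 0 t) \<le> 2 * integral {lo N (j N t)..lo N (Suc (j N t))} M"
        unfolding w_def using j[OF t(1), of N] lo01[of N] by (intro M(2) u) auto
      moreover have "\<Lambda> (lo N (j N t)) + integral {lo N (j N t)..lo N (Suc (j N t))} M = \<Lambda> (lo N (Suc (j N t)))"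
        unfolding \<Lambda>_def using j[OF t(1), of N] lo01[of N]
        by (intro HK_integral_combine integrable_on_subinterval[OF Ml(1)]) auto
      ultimately show ?thesis by simp
    qed
    have "(\<lambda>N. \<phi> (w N (j N t)) t - X 0 t) \<longlonglongrightarrow> 0"
      by (rule Lim_null_comparison[OF _ lim0]) (use dev in \<open>auto intro: always_eventually\<close>)
    then have "(\<lambda>N. \<phi> (w N (j N t)) t) \<longlonglongrightarrow> X 0 t" by (simp add: LIM_zero_iff)
    then have "(\<lambda>N. a t (\<phi> (w N (j N t)) t) (u t)) \<longlonglongrightarrow> a t (X 0 t) (u t)"
      using caratheodory_continuous[OF a t(1) selector_in[OF u t(1)]]
      by (intro continuous_on_tendsto_compose[where s = UNIV and f = "\<lambda>y. a t y (u t)"]) auto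
    then show "(\<lambda>N. a t (\<phi> (w N (j N t)) t) (w N (j N t) t)) \<longlonglongrightarrow> a t (X 0 t) (u t)" by (simp add: wt)
  qed
qed

lemma regular_along_base_integrable:
  fixes a :: "real \<Rightarrow> real ^ 'm \<Rightarrow> 'u \<Rightarrow> 'b::euclidean_space"
  assumes a: "regular_map U a" and u: "u \<in> selectors U" and T: "0 \<le> T"
    and meas: "\<And>w. w \<in> selectors U \<Longrightarrow> (\<lambda>t. a t (\<phi> w t) (w t)) \<in> borel_measurable (lebesgue_on {0..T})"
  shows "(\<lambda>t. a t (X 0 t) (u t)) absolutely_integrable_on {0..T}"
proof -
  obtain \<rho> where \<rho>: "\<And>\<xi> t. \<xi> \<in> cball 0 0 \<Longrightarrow> t \<in> {0..T} \<Longrightarrow> norm (X \<xi> t) \<le> \<rho>" using X_bound[OF T] by blast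
  obtain M where M: "M \<in> loc_summable" "\<And>t x v. t \<in> {0..T} \<Longrightarrow> x \<in> cball 0 \<rho> \<Longrightarrow> v \<in> U t \<Longrightarrow> norm (a t x v) \<le> M t"
    using integrally_bounded_tube[OF conjunct2[OF conjunct2[OF a[unfolded regular_map_def]]], of T \<rho>] by blast
  show ?thesis
  proof (rule measurable_bounded_by_integrable_imp_absolutely_integrable)
    show "(\<lambda>t. a t (X 0 t) (u t)) \<in> borel_measurable (lebesgue_on {0..T})"
      by (rule measurable_along_base[OF conjunct1[OF a[unfolded regular_map_def]] u T meas])
    show "M integrable_on {0..T}" by (rule loc_summable_integrable[OF M(1) order_refl order_refl T])
    fix t assume "t \<in> {0..T}"
    then show "norm (a t (X 0 t) (u t)) \<le> M t" using \<rho>[of 0 t] selector_in[OF u, of t] by (intro M(2)) auto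
  qed simp
qed

lemma f_along_base: "u \<in> selectors U \<Longrightarrow> 0 \<le> T \<Longrightarrow> (\<lambda>t. f t (X 0 t) (u t)) absolutely_integrable_on {0..T}"
proof (rule regular_along_base_integrable[OF f_regular])
  fix w assume w: "w \<in> selectors U" and T: "0 \<le> T"
  show "(\<lambda>t. f t (\<phi> w t) (w t)) \<in> borel_measurable (lebesgue_on {0..T})"
    by (rule integrable_imp_measurable[OF has_integral_integrable[OF ode_on_has_integral[OF phi_ode[OF w order_refl] T]]])
qed

lemma g_along_base: "u \<in> selectors U \<Longrightarrow> 0 \<le> T \<Longrightarrow> (\<lambda>t. g t (X 0 t) (u t)) absolutely_integrable_on {0..T}"
proof (rule regular_along_base_integrable[OF g_regular])
  fix w assume w: "w \<in> selectors U" and T: "0 \<le> T"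
  show "(\<lambda>t. g t (\<phi> w t) (w t)) \<in> borel_measurable (lebesgue_on {0..T})"
    using J[OF w T] by (auto simp: has_bochner_integral_iff)
qed

lemma J_has_integral: "u \<in> selectors U \<Longrightarrow> 0 \<le> T \<Longrightarrow> ((\<lambda>t. g t (\<phi> u t) (u t)) has_integral J T u) {0..T}"
  using J[of u T] has_integral_integral_lebesgue_on[of "{0..T}" "\<lambda>t. g t (\<phi> u t) (u t)"] by (auto simp: has_bochner_integral_iff)

text \<open>
  The solution of the adjoint equation with multiplier \<open>1\<close> and initial value \<open>q\<close>.
\<close>

definition costate :: "real ^ 'm \<Rightarrow> real \<Rightarrow> real ^ 'm" where
  "costate q t = (q - I 0 t) v* matrix_inv (A 0 t)"

lemma A_lower:
  assumes T: "0 \<le> T"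
  obtains C where "0 < C" "\<And>t h. t \<in> {0..T} \<Longrightarrow> norm h \<le> C * norm (A 0 t *v h)"
  using A_bounds[OF T, of 0] by auto

lemma A_inverse:
  assumes "0 \<le> t"
  shows "A 0 t ** matrix_inv (A 0 t) = mat 1" "matrix_inv (A 0 t) ** A 0 t = mat 1"
proof -
  obtain C where "\<And>h. norm h \<le> C * norm (A 0 t *v h)" using A_lower[OF assms] assms by (metis atLeastAtMost_iff order_refl)
  from matrix_inv_works[OF this] show "A 0 t ** matrix_inv (A 0 t) = mat 1" "matrix_inv (A 0 t) ** A 0 t = mat 1" .
qed

lemma costate_A: "0 \<le> t \<Longrightarrow> costate q t v* A 0 t = q - I 0 t"
  by (simp add: costate_def vector_matrix_mul_assoc A_inverse)

lemma I_0: "I \<xi> 0 = 0"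
  using has_integral_unique[OF I_has_integral[of 0 \<xi>], of 0] has_integral_refl(2)[of "payoff_gradient \<xi>" 0] by simp

lemma I_indefinite:
  assumes "0 \<le> T"
  shows "abs_cont_on {0..T} (I \<xi>)"
    and "\<exists>N. negligible N \<and> (\<forall>t\<in>{0<..<T} - N. (I \<xi> has_vector_derivative payoff_gradient \<xi> t) (at t))"
proof -
  have eq: "I \<xi> t = integral {0..t} (payoff_gradient \<xi>)" if "0 \<le> t" for t
    using integral_unique[OF I_has_integral[OF that, of \<xi>]] by simp
  show "abs_cont_on {0..T} (I \<xi>)"
    by (rule abs_cont_on_cong[OF abs_cont_on_integral[OF payoff_gradient_integrable[OF assms]]]) (simp add: eq)
  obtain N where N: "negligible N"
    "\<And>t. t \<in> {0<..<T} - N \<Longrightarrow> ((\<lambda>s. integral {0..s} (payoff_gradient \<xi>)) has_vector_derivative payoff_gradient \<xi> t) (at t)"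
    using integral_has_derivative_ae[OF has_integral_integrable[OF I_has_integral[OF assms, of \<xi>]]] by blast
  have "(I \<xi> has_vector_derivative payoff_gradient \<xi> t) (at t)" if t: "t \<in> {0<..<T} - N" for t
    by (rule has_vector_derivative_transform_within_open[OF N(2)[OF t], of "{0<..<T}"]) (use t in \<open>auto simp: eq\<close>)
  with N(1) show "\<exists>N. negligible N \<and> (\<forall>t\<in>{0<..<T} - N. (I \<xi> has_vector_derivative payoff_gradient \<xi> t) (at t))" by blast
qed

text \<open>
  This form keeps the inverse matrix at the fixed time \<open>t\<close>. Hence the derivative of the costate can be
  computed without differentiating the inverse.
\<close>

lemma costate_increment:
  assumes "0 \<le> s" "0 \<le> t"
  shows "costate q t - costate q s = ((I 0 s - I 0 t) - costate q s v* (A 0 t - A 0 s)) v* matrix_inv (A 0 t)"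
proof -
  have eq: "(I 0 s - I 0 t) - costate q s v* (A 0 t - A 0 s) = (q - I 0 t) - costate q s v* A 0 t"
    using costate_A[OF assms(1), of q] by (simp add: vector_matrix_mult_diff_rdistrib)
  show ?thesis
    unfolding eq vector_matrix_mult_diff_distrib[of "q - I 0 t"] vector_matrix_mul_assoc
      A_inverse(1)[OF assms(2)] vector_matrix_mul_rid costate_def[of q t] ..
qed

lemma A_abs_cont: "abs_cont_on {0..T} (A \<xi>)"
  using ode_solution_imp_ode_on[OF A order_refl] by (auto simp: ode_on_def)

lemma costate_abs_cont:
  assumes T: "0 \<le> T"
  shows "abs_cont_on {0..T} (costate q)"
proof -
  obtain C where C: "0 < C" "\<And>t h. t \<in> {0..T} \<Longrightarrow> norm h \<le> C * norm (A 0 t *v h)" using A_lower[OF T] by blast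
  have inv: "norm (p v* matrix_inv (A 0 t)) \<le> C * norm p" if "t \<in> {0..T}" for p t
    by (rule norm_vector_matrix_inv_le[OF C(2)[OF that]])
  have "bounded (I 0 ` {0..T})"
    by (intro compact_imp_bounded compact_continuous_image abs_cont_on_imp_continuous_on I_indefinite T) auto
  then obtain B where B: "\<And>t. t \<in> {0..T} \<Longrightarrow> norm (I 0 t) \<le> B" unfolding bounded_iff by blast
  define K where "K = C * (norm q + B)"
  have K: "norm (costate q t) \<le> K" if t: "t \<in> {0..T}" for t
  proof -
    have "norm (costate q t) \<le> C * norm (q - I 0 t)" unfolding costate_def by (rule inv[OF t])
    also have "\<dots> \<le> K" unfolding K_def
      using B[OF t] C(1) norm_triangle_ineq4[of q "I 0 t"] by (intro mult_left_mono) auto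
    finally show ?thesis .
  qed
  show ?thesis
  proof (rule abs_cont_on_dominated[OF I_indefinite(1)[OF T, of 0] A_abs_cont[of T 0], where C = "C * max 1 K"])
    fix s t assume st: "s \<in> {0..T}" "t \<in> {0..T}"
    have "norm (costate q t - costate q s) \<le> C * norm ((I 0 s - I 0 t) - costate q s v* (A 0 t - A 0 s))"
      using st by (subst costate_increment) (auto intro: inv)
    also have "\<dots> \<le> C * (norm (I 0 s - I 0 t) + norm (costate q s) * norm (A 0 t - A 0 s))"
      using C(1) norm_vector_matrix_le[of "costate q s" "A 0 t - A 0 s"]
      by (intro mult_left_mono order_trans[OF norm_triangle_ineq4]) auto
    also have "\<dots> \<le> C * (max 1 K * norm (I 0 t - I 0 s) + max 1 K * norm (A 0 t - A 0 s))"
      using C(1) K[OF st(1)] mult_right_mono[of 1 "max 1 K" "norm (I 0 t - I 0 s)"]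
      by (intro mult_left_mono add_mono mult_right_mono) (auto simp: norm_minus_commute)
    finally show "norm (costate q t - costate q s) \<le> C * max 1 K * (norm (I 0 t - I 0 s) + norm (A 0 t - A 0 s))"
      by (simp add: algebra_simps)
  qed
qed

lemma costate_derivative:
  assumes T: "0 \<le> T"
  shows "\<exists>N. negligible N \<and> (\<forall>t\<in>{0<..<T} - N.
     (costate q has_vector_derivative - (costate q t v* Df f t (X 0 t) (u0 t) + Dg g t (X 0 t) (u0 t))) (at t))"
proof -
  obtain N1 where N1: "negligible N1" "\<And>t. t \<in> {0<..<T} - N1 \<Longrightarrow> (I 0 has_vector_derivative payoff_gradient 0 t) (at t)"
    using I_indefinite(2)[OF T, of 0] by blast
  obtain N2 where N2: "negligible N2" "\<And>t. t \<in> {0<..<T} - N2 \<Longrightarrow> (A 0 has_vector_derivative Df f t (X 0 t) (u0 t) ** A 0 t) (at t)"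
    using ode_solution_imp_ode_on[OF A[of 0] order_refl, of T] by (auto simp: ode_on_def)
  show ?thesis
  proof (intro exI[of _ "N1 \<union> N2"] conjI ballI)
    show "negligible (N1 \<union> N2)" using N1 N2 by simp
    fix t assume t: "t \<in> {0<..<T} - (N1 \<union> N2)"
    let ?B = "matrix_inv (A 0 t)" and ?F = "Df f t (X 0 t) (u0 t)" and ?G = "Dg g t (X 0 t) (u0 t)"
    have "isCont (costate q) t"
      using continuous_on_interior[OF abs_cont_on_imp_continuous_on[OF costate_abs_cont[OF T]]] t by simp
    moreover have "((\<lambda>r. A 0 r - A 0 t) has_vector_derivative ?F ** A 0 t) (at t)"
      using N2(2)[of t] t by (auto intro!: derivative_eq_intros)
    ultimately have 1: "((\<lambda>r. costate q r v* (A 0 r - A 0 t)) has_vector_derivative costate q t v* (?F ** A 0 t)) (at t)"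
      by (intro has_vector_derivative_bilinear_at_zero[OF bounded_bilinear_vector_matrix]) auto
    have bl: "bounded_linear (\<lambda>p. p v* ?B)"
      by (rule bounded_bilinear.bounded_linear_left[OF bounded_bilinear_vector_matrix])
    have "((\<lambda>r. costate q t + ((I 0 t - I 0 r) - costate q r v* (A 0 r - A 0 t)) v* ?B) has_vector_derivative
        0 + (0 - payoff_gradient 0 t - costate q t v* (?F ** A 0 t)) v* ?B) (at t)"
      using N1(2)[of t] t
      by (intro has_vector_derivative_add has_vector_derivative_const bounded_linear.has_vector_derivative[OF bl]
            has_vector_derivative_diff 1) auto
    moreover have "0 + (0 - payoff_gradient 0 t - costate q t v* (?F ** A 0 t)) v* ?B = - (costate q t v* ?F + ?G)"
    proof -
      have "0 - payoff_gradient 0 t - costate q t v* (?F ** A 0 t) = (- (costate q t v* ?F + ?G)) v* A 0 t"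
        by (simp add: vector_matrix_mul_assoc[symmetric] vector_matrix_mult_diff_distrib vector_matrix_left_distrib
              bounded_bilinear.minus_left[OF bounded_bilinear_vector_matrix] algebra_simps)
      then show ?thesis using t by (simp add: vector_matrix_mul_assoc A_inverse)
    qed
    ultimately have 2: "((\<lambda>r. costate q t + ((I 0 t - I 0 r) - costate q r v* (A 0 r - A 0 t)) v* ?B) has_vector_derivative
        - (costate q t v* ?F + ?G)) (at t)" by simp
    show "(costate q has_vector_derivative - (costate q t v* ?F + ?G)) (at t)"
    proof (rule has_vector_derivative_transform_within_open[OF 2, of "{0<..<T}"])
      fix r assume r: "r \<in> {0<..<T}"
      have "costate q t - costate q r = ((I 0 r - I 0 t) - costate q r v* (A 0 t - A 0 r)) v* ?B"
        using t r by (intro costate_increment) auto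
      moreover have "(I 0 r - I 0 t) - costate q r v* (A 0 t - A 0 r) = - ((I 0 t - I 0 r) - costate q r v* (A 0 r - A 0 t))"
        by (simp add: vector_matrix_mult_diff_rdistrib)
      ultimately have "costate q t - costate q r = - (((I 0 t - I 0 r) - costate q r v* (A 0 r - A 0 t)) v* ?B)"
        by (simp only: bounded_bilinear.minus_left[OF bounded_bilinear_vector_matrix])
      then show "costate q t + ((I 0 t - I 0 r) - costate q r v* (A 0 r - A 0 t)) v* ?B = costate q r"
        by (simp add: algebra_simps)
    qed (use t in auto)
  qed
qed

text \<open>
  Variation of constants: the derivative of \<open>\<psi> t v* A 0 t\<close> is \<open>- lam\<close> times the payoff gradient, because the
  terms with \<open>Df f\<close> cancel.
\<close>

lemma adjoint_solution:
  assumes T: "0 \<le> T" and \<psi>: "abs_cont_on {0..T} \<psi>" and N: "negligible N"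
    and d: "\<And>t. t \<in> {0<..<T} - N \<Longrightarrow>
      (\<psi> has_vector_derivative - (\<psi> t v* Df f t (X 0 t) (u0 t) + lam *\<^sub>R Dg g t (X 0 t) (u0 t))) (at t)"
  shows "\<psi> T v* A 0 T = \<psi> 0 - lam *\<^sub>R I 0 T"
proof -
  obtain N2 where N2: "negligible N2" "\<And>t. t \<in> {0<..<T} - N2 \<Longrightarrow> (A 0 has_vector_derivative Df f t (X 0 t) (u0 t) ** A 0 t) (at t)"
    using ode_solution_imp_ode_on[OF A[of 0] order_refl, of T] by (auto simp: ode_on_def)
  have "((\<lambda>t. - (lam *\<^sub>R payoff_gradient 0 t)) has_integral (\<psi> T v* A 0 T - \<psi> 0 v* A 0 0)) {0..T}"
  proof (rule abs_cont_FTC[OF T _ negligible_Un[OF N N2(1)]])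
    show "abs_cont_on {0..T} (\<lambda>t. \<psi> t v* A 0 t)"
      by (rule abs_cont_on_bilinear[OF bounded_bilinear_vector_matrix \<psi> A_abs_cont])
    fix t assume t: "t \<in> {0<..<T} - (N \<union> N2)"
    let ?F = "Df f t (X 0 t) (u0 t)" and ?G = "Dg g t (X 0 t) (u0 t)"
    have "((\<lambda>t. \<psi> t v* A 0 t) has_vector_derivative \<psi> t v* (?F ** A 0 t) + (- (\<psi> t v* ?F + lam *\<^sub>R ?G)) v* A 0 t) (at t)"
      using d[of t] N2(2)[of t] t
      by (intro bounded_bilinear.has_vector_derivative[OF bounded_bilinear_vector_matrix]) auto
    moreover have "\<psi> t v* (?F ** A 0 t) + (- (\<psi> t v* ?F + lam *\<^sub>R ?G)) v* A 0 t = - (lam *\<^sub>R payoff_gradient 0 t)"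
      by (simp add: vector_matrix_mul_assoc[symmetric] vector_matrix_mult_diff_distrib vector_matrix_left_distrib
              bounded_bilinear.minus_left[OF bounded_bilinear_vector_matrix]
              bounded_bilinear.scaleR_left[OF bounded_bilinear_vector_matrix] algebra_simps)
    ultimately show "((\<lambda>t. \<psi> t v* A 0 t) has_vector_derivative - (lam *\<^sub>R payoff_gradient 0 t)) (at t)" by simp
  qed
  moreover have "((\<lambda>t. - (lam *\<^sub>R payoff_gradient 0 t)) has_integral - (lam *\<^sub>R I 0 T)) {0..T}"
    by (intro has_integral_neg has_integral_cmul I_has_integral T)
  ultimately have "\<psi> T v* A 0 T - \<psi> 0 v* A 0 0 = - (lam *\<^sub>R I 0 T)" by (rule has_integral_unique)
  then show ?thesis by (simp add: A_0 algebra_simps)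
qed

end

section \<open>The gain of a needle\<close>

lemma indefinite_integral_quotient:
  fixes F :: "real \<Rightarrow> 'a::euclidean_space"
  assumes F: "F integrable_on {0..T}" and t: "0 \<le> t" "t < T"
    and d: "((\<lambda>s. integral {0..s} F) has_vector_derivative D) (at t)"
  shows "((\<lambda>\<epsilon>. integral {t..t + \<epsilon>} F /\<^sub>R \<epsilon>) \<longlongrightarrow> D) (at_right 0)"
proof -
  have "((\<lambda>\<epsilon>. (integral {0..t + \<epsilon>} F - integral {0..t} F) /\<^sub>R \<epsilon>) \<longlongrightarrow> D) (at 0)"
  proof -
    have "((\<lambda>\<epsilon>. norm (integral {0..t + \<epsilon>} F - integral {0..t} F - \<epsilon> *\<^sub>R D) / norm \<epsilon>) \<longlongrightarrow> 0) (at 0)"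
      using d unfolding has_vector_derivative_def has_derivative_at by blast
    moreover have "\<forall>\<^sub>F \<epsilon> in at 0. norm (integral {0..t + \<epsilon>} F - integral {0..t} F - \<epsilon> *\<^sub>R D) / norm \<epsilon>
        = norm ((integral {0..t + \<epsilon>} F - integral {0..t} F) /\<^sub>R \<epsilon> - D)"
      unfolding eventually_at_filter
    proof (intro always_eventually allI impI)
      fix \<epsilon> :: real assume e: "\<epsilon> \<noteq> 0"
      let ?v = "integral {0..t + \<epsilon>} F - integral {0..t} F"
      have "?v /\<^sub>R \<epsilon> - D = (?v - \<epsilon> *\<^sub>R D) /\<^sub>R \<epsilon>" using e by (simp add: scaleR_right_diff_distrib)
      then show "norm (?v - \<epsilon> *\<^sub>R D) / norm \<epsilon> = norm (?v /\<^sub>R \<epsilon> - D)" by (simp add: divide_inverse mult.commute)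
    qed
    ultimately have "((\<lambda>\<epsilon>. norm ((integral {0..t + \<epsilon>} F - integral {0..t} F) /\<^sub>R \<epsilon> - D)) \<longlongrightarrow> 0) (at 0)"
      by (rule Lim_transform_eventually)
    then show ?thesis by (simp add: tendsto_norm_zero_iff LIM_zero_iff)
  qed
  then have "((\<lambda>\<epsilon>. (integral {0..t + \<epsilon>} F - integral {0..t} F) /\<^sub>R \<epsilon>) \<longlongrightarrow> D) (at_right 0)"
    by (rule tendsto_mono[OF at_le, rotated]) simp
  moreover have "\<forall>\<^sub>F \<epsilon> in at_right 0. (integral {0..t + \<epsilon>} F - integral {0..t} F) /\<^sub>R \<epsilon> = integral {t..t + \<epsilon>} F /\<^sub>R \<epsilon>"
  proof -
    have "\<forall>\<^sub>F \<epsilon> in at_right 0. \<epsilon> \<in> {0<..<T - t}" using t by (intro eventually_at_right_real) simp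
    then show ?thesis
    proof eventually_elim
      case (elim \<epsilon>)
      have "integral {0..t} F + integral {t..t + \<epsilon>} F = integral {0..t + \<epsilon>} F"
        using elim t by (intro HK_integral_combine integrable_on_subinterval[OF F]) auto
      then show ?case by (metis add_diff_cancel_left')
    qed
  qed
  ultimately show ?thesis by (rule Lim_transform_eventually)
qed

lemma short_integral_tendsto_0:
  fixes F :: "real \<Rightarrow> 'a::euclidean_space"
  assumes F: "F integrable_on {0..T}" and t: "0 \<le> t" "t < T"
  shows "((\<lambda>\<epsilon>. integral {t..t + \<epsilon>} F) \<longlongrightarrow> 0) (at_right 0)"
proof -
  have Ft: "F integrable_on {t..T}" by (rule integrable_on_subinterval[OF F]) (use t in auto)
  have "continuous_on {t..T} (\<lambda>s. integral {t..s} F)" by (rule indefinite_integral_continuous_1[OF Ft])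
  moreover have "((\<lambda>\<epsilon>. t + \<epsilon>) \<longlongrightarrow> t + 0) (at_right 0)" by (intro tendsto_intros)
  moreover have "\<forall>\<^sub>F \<epsilon> in at_right 0. t + \<epsilon> \<in> {t..T}"
  proof -
    have "\<forall>\<^sub>F \<epsilon> in at_right 0. \<epsilon> \<in> {0<..<T - t}" using t by (intro eventually_at_right_real) simp
    then show ?thesis by eventually_elim auto
  qed
  ultimately have "((\<lambda>\<epsilon>. integral {t..t + \<epsilon>} F) \<longlongrightarrow> integral {t..t + 0} F) (at_right 0)"
    using t by (intro continuous_on_tendsto_compose[where s = "{t..T}" and f = "\<lambda>s. integral {t..s} F"]) auto
  then show ?thesis by simp
qed

context regular_control_system
begin

text \<open>
  The changes of velocity and of running payoff when the value of \<open>u0\<close> is replaced by that of \<open>u\<close> at the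
  reference state.
\<close>

abbreviation f_jump :: "(real \<Rightarrow> 'u) \<Rightarrow> real \<Rightarrow> real ^ 'm" where
  "f_jump u t \<equiv> f t (X 0 t) (u t) - f t (X 0 t) (u0 t)"

abbreviation g_jump :: "(real \<Rightarrow> 'u) \<Rightarrow> real \<Rightarrow> real" where
  "g_jump u t \<equiv> g t (X 0 t) (u t) - g t (X 0 t) (u0 t)"

lemma f_jump_integrable: "u \<in> selectors U \<Longrightarrow> 0 \<le> T \<Longrightarrow> f_jump u absolutely_integrable_on {0..T}"
  by (rule set_integral_diff(1)[OF f_along_base f_along_base[OF u0]])

lemma g_jump_integrable: "u \<in> selectors U \<Longrightarrow> 0 \<le> T \<Longrightarrow> g_jump u absolutely_integrable_on {0..T}"
  by (rule set_integral_diff(1)[OF g_along_base g_along_base[OF u0]])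

lemma f_jump_norm_integrable: "u \<in> selectors U \<Longrightarrow> 0 \<le> T \<Longrightarrow> (\<lambda>t. norm (f_jump u t)) integrable_on {0..T}"
  using absolutely_integrable_norm[OF f_jump_integrable, of u T] by (simp add: absolutely_integrable_on_def o_def)

text \<open>
  Gronwall's inequality on the needle, where the jump of \<open>f\<close> at the reference state is the inhomogeneity.
\<close>

lemma needle_inside:
  assumes u: "u \<in> selectors U" and st: "0 \<le> s" "s \<le> t" "t \<le> T" and r: "r \<in> {s..t}"
  shows "norm (\<phi> (needle u s t) r - X 0 r) \<le> flow_const T * integral {s..t} (\<lambda>r. norm (f_jump u r))"
proof -
  have T: "0 \<le> T" using st by simp
  note Ll = loc_summable_integrable[OF L st(1) st(3) T]
  have h: "(\<lambda>r. norm (f_jump u r)) integrable_on {s..t}"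
    by (rule integrable_on_subinterval[OF f_jump_norm_integrable[OF u T]]) (use st in auto)
  have h0: "0 \<le> integral {s..t} (\<lambda>r. norm (f_jump u r))"
    by (rule HK_integral_nonneg[OF h]) simp
  have "norm (\<phi> (needle u s t) r - X 0 r) \<le>
     (norm (\<phi> (needle u s t) s - X 0 s) + integral {s..t} (\<lambda>r. norm (f_jump u r))) * exp (integral {s..t} L)"
  proof (rule ode_on_diff_gronwall[OF needle_ode(2)[OF u st(1)] X_ode[OF st(1)] _ Ll(1,3) h _ _ r])
    fix r assume r: "r \<in> {s<..<t}"
    have "norm (f r (\<phi> (needle u s t) r) (u r) - f r (X 0 r) (u0 r))
       = norm ((f r (\<phi> (needle u s t) r) (u r) - f r (X 0 r) (u r)) + f_jump u r)" by simp
    also have "\<dots> \<le> L r * norm (\<phi> (needle u s t) r - X 0 r) + norm (f_jump u r)"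
      using r st by (intro norm_triangle_mono f_lipschitz selector_in[OF u]) auto
    finally show "norm (f r (\<phi> (needle u s t) r) (u r) - f r (X 0 r) (u0 r))
       \<le> L r * norm (\<phi> (needle u s t) r - X 0 r) + norm (f_jump u r)" .
  qed (use st in auto)
  also have "\<dots> = integral {s..t} (\<lambda>r. norm (f_jump u r)) * exp (integral {s..t} L)"
    using needle_before[OF u, of s s t] st by simp
  also have "\<dots> \<le> integral {s..t} (\<lambda>r. norm (f_jump u r)) * flow_const T"
    by (intro mult_left_mono exp_L_le_flow_const st T h0)
  finally show ?thesis by (simp add: mult.commute)
qed

text \<open>
  The displacement at the end of the needle is the integral of the velocity change up to a product
  of two small factors.
\<close>

lemma needle_endpoint:
  assumes u: "u \<in> selectors U" and st: "0 \<le> s" "s \<le> t" "t \<le> T"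
  shows "norm (\<phi> (needle u s t) t - X 0 t - integral {s..t} (f_jump u))
     \<le> integral {s..t} L * (flow_const T * integral {s..t} (\<lambda>r. norm (f_jump u r)))"
proof -
  have T: "0 \<le> T" using st by simp
  let ?y = "\<phi> (needle u s t)" and ?c = "flow_const T * integral {s..t} (\<lambda>r. norm (f_jump u r))"
  have "f_jump u integrable_on {0..T}" using f_jump_integrable[OF u T] by (simp add: absolutely_integrable_on_def)
  then have h: "f_jump u integrable_on {s..t}" by (rule integrable_on_subinterval) (use st in auto)
  have "((\<lambda>r. f r (?y r) (u r) - f r (X 0 r) (u0 r) - f_jump u r) has_integral
     (?y t - ?y s) - (X 0 t - X 0 s) - integral {s..t} (f_jump u)) {s..t}"
    by (intro has_integral_diff ode_on_has_integral[OF needle_ode(2)[OF u st(1)] st(2)]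
        ode_on_has_integral[OF X_ode[OF st(1)] st(2)] integrable_integral h)
  moreover have "?y s = X 0 s" using needle_before[OF u, of s s t] st by simp
  ultimately have i: "((\<lambda>r. f r (?y r) (u r) - f r (X 0 r) (u r)) has_integral
     ?y t - X 0 t - integral {s..t} (f_jump u)) {s..t}" by (simp add: algebra_simps)
  have Lc: "(\<lambda>r. L r * ?c) integrable_on {s..t}"
    by (rule integrable_on_mult_left[OF loc_summable_integrable(1)[OF L st(1) st(3) T]])
  have "norm (integral {s..t} (\<lambda>r. f r (?y r) (u r) - f r (X 0 r) (u r))) \<le> integral {s..t} (\<lambda>r. L r * ?c)"
  proof (rule HK_integral_norm_bound_integral[OF has_integral_integrable[OF i] Lc])
    fix r assume r: "r \<in> {s..t}"
    have "norm (f r (?y r) (u r) - f r (X 0 r) (u r)) \<le> L r * norm (?y r - X 0 r)"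
      using r st by (intro f_lipschitz selector_in[OF u]) auto
    also have "\<dots> \<le> L r * ?c"
      using loc_summable_integrable(3)[OF L st(1) st(3) T r] by (intro mult_left_mono needle_inside[OF u st r])
    finally show "norm (f r (?y r) (u r) - f r (X 0 r) (u r)) \<le> L r * ?c" .
  qed
  then show ?thesis by (simp only: integral_unique[OF i] HK_integral_mult_left)
qed

text \<open>
  The gain of a needle has two parts: the change of the running payoff on the needle, up to a product
  of two small factors, and the increment of the payoff of \<open>u0\<close> along the trajectory \<open>X \<xi>\<close> that the system
  follows afterwards. The latter is a difference of two integrals from time \<open>0\<close>.
\<close>

lemma needle_payoff:
  assumes T: "0 \<le> T" and u: "u \<in> selectors U"
  shows "\<exists>K\<in>loc_summable. \<forall>s t. 0 \<le> s \<longrightarrow> s \<le> t \<longrightarrow> t \<le> T \<longrightarrow>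
    (\<forall>S \<xi>. T \<le> S \<longrightarrow> X \<xi> t = \<phi> (needle u s t) t \<longrightarrow>
      integral {s..t} (g_jump u) - integral {s..t} K * (flow_const T * integral {s..t} (\<lambda>r. norm (f_jump u r)))
        + integral {0..S} (payoff_increment \<xi>) - integral {0..t} (payoff_increment \<xi>)
      \<le> J S (needle u s t) - J S u0)"
proof -
  obtain \<rho> where \<rho>: "\<And>u t. u \<in> selectors U \<Longrightarrow> t \<in> {0..T} \<Longrightarrow> norm (\<phi> u t) \<le> \<rho>" using phi_bound[OF T] by blast
  have "locally_lipschitz U g" using g_regular by (simp add: regular_map_def)
  from locally_lipschitz_tube[OF this, of T \<rho>]
  obtain K where K: "K \<in> loc_summable" "\<And>t x y v. t \<in> {0..T} \<Longrightarrow> v \<in> U t \<Longrightarrow> x \<in> cball 0 \<rho> \<Longrightarrow> y \<in> cball 0 \<rho> \<Longrightarrow>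
       norm (g t x v - g t y v) \<le> K t * norm (x - y)" by blast
  show ?thesis
  proof (intro bexI[OF _ K(1)] allI impI)
    fix s t S :: real and \<xi>
    assume st: "0 \<le> s" "s \<le> t" "t \<le> T" and S: "T \<le> S" and \<xi>: "X \<xi> t = \<phi> (needle u s t) t"
    let ?w = "needle u s t" and ?c = "flow_const T * integral {s..t} (\<lambda>r. norm (f_jump u r))"
    let ?y = "\<phi> ?w"
    have w: "?w \<in> selectors U" by (rule needle_selector[OF u])
    have S0: "0 \<le> S" "t \<le> S" "0 \<le> t" using st S T by auto
    define \<Delta> where "\<Delta> r = g r (?y r) (?w r) - g r (\<phi> u0 r) (u0 r)" for r
    have \<Delta>: "(\<Delta> has_integral J S ?w - J S u0) {0..S}"
      unfolding \<Delta>_def by (intro has_integral_diff J_has_integral w u0 S0)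
    have \<Delta>i: "\<Delta> integrable_on {a..b}" if "0 \<le> a" "b \<le> S" for a b
      by (rule integrable_on_subinterval[OF has_integral_integrable[OF \<Delta>]]) (use that in auto)
    have "integral {0..s} \<Delta> = integral {0..s} (\<lambda>_. 0)"
    proof (rule integral_spike[of "{s}"])
      fix r assume r: "r \<in> {0..s} - {s}"
      then have "?y r = X 0 r" "\<phi> u0 r = X 0 r" using needle_before[OF u, of r s t] phi_u0[of r] by auto
      then show "0 = \<Delta> r" using r by (simp add: \<Delta>_def needle_def)
    qed simp
    then have p1: "integral {0..s} \<Delta> = 0" by simp
    have p2: "integral {s..t} (g_jump u) - integral {s..t} K * ?c \<le> integral {s..t} \<Delta>"
    proof -
      have "g_jump u integrable_on {0..T}" using g_jump_integrable[OF u T] by (simp add: absolutely_integrable_on_def)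
      then have gi: "g_jump u integrable_on {s..t}" by (rule integrable_on_subinterval) (use st in auto)
      have Ki: "(\<lambda>r. K r * ?c) integrable_on {s..t}"
        by (rule integrable_on_mult_left[OF loc_summable_integrable(1)[OF K(1) st(1) st(3) T]])
      have "integral {s..t} (\<lambda>r. g_jump u r - K r * ?c) \<le> integral {s..t} \<Delta>"
      proof (rule integral_le[OF integrable_diff[OF gi Ki] \<Delta>i])
        fix r assume r: "r \<in> {s..t}"
        have ur: "u r \<in> U r" using r st by (intro selector_in[OF u]) auto
        have X0: "\<phi> u0 r = X 0 r" using r st by (intro phi_u0) auto
        have "\<bar>g r (?y r) (u r) - g r (X 0 r) (u r)\<bar> \<le> K r * norm (?y r - X 0 r)"
          using K(2)[of r "u r" "?y r" "X 0 r"] \<rho>[OF w, of r] \<rho>[OF u0, of r] r st ur X0 by auto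
        also have "\<dots> \<le> K r * ?c"
          using loc_summable_integrable(3)[OF K(1) st(1) st(3) T r] by (intro mult_left_mono needle_inside[OF u st r])
        finally show "g_jump u r - K r * ?c \<le> \<Delta> r" using r by (simp add: \<Delta>_def needle_def X0)
      qed (use st S0 in auto)
      then show ?thesis
        by (simp only: HK_integral_diff[OF gi Ki] HK_integral_mult_left)
    qed
    have after: "?y r = X \<xi> r" if r: "r \<in> {t..S}" for r
      using trajectories_lipschitz[OF u0 S0(3) order_refl S0(1) needle_ode(3)[OF u st(1,2)] X_ode[OF S0(3)], of t r \<xi>] r S0 \<xi> by simp
    have "integral {t..S} \<Delta> = integral {t..S} (payoff_increment \<xi>)"
    proof (rule integral_spike[of "{t}"])
      fix r assume r: "r \<in> {t..S} - {t}"
      then have "?y r = X \<xi> r" "\<phi> u0 r = X 0 r" using after[of r] phi_u0[of r] S0 by auto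
      then show "payoff_increment \<xi> r = \<Delta> r" using r by (simp add: \<Delta>_def needle_def)
    qed simp
    moreover have "integral {0..t} (payoff_increment \<xi>) + integral {t..S} (payoff_increment \<xi>) = integral {0..S} (payoff_increment \<xi>)"
      by (rule HK_integral_combine[OF S0(3,2) payoff_increment_integral(1)[OF S0(1)]])
    ultimately have p3: "integral {t..S} \<Delta> = integral {0..S} (payoff_increment \<xi>) - integral {0..t} (payoff_increment \<xi>)" by simp
    have "integral {0..s} \<Delta> + integral {s..S} \<Delta> = integral {0..S} \<Delta>" "integral {s..t} \<Delta> + integral {t..S} \<Delta> = integral {s..S} \<Delta>"
      using st S0 by (auto intro!: HK_integral_combine \<Delta>i)
    moreover have "integral {0..S} \<Delta> = J S ?w - J S u0" by (rule integral_unique[OF \<Delta>])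
    ultimately show "integral {s..t} (g_jump u) - integral {s..t} K * ?c + integral {0..S} (payoff_increment \<xi>)
        - integral {0..t} (payoff_increment \<xi>) \<le> J S ?w - J S u0"
      using p1 p2 p3 by linarith
  qed
qed

end

section \<open>The maximum principle\<close>

locale optimal_control_system = regular_control_system U f g u0 \<phi> J X A I
  for U :: "real \<Rightarrow> 'u::euclidean_space set"
    and f :: "real \<Rightarrow> real ^ 'm \<Rightarrow> 'u \<Rightarrow> real ^ 'm"
    and g :: "real \<Rightarrow> real ^ 'm \<Rightarrow> 'u \<Rightarrow> real"
    and u0 \<phi> J X A I +
  fixes \<tau> :: "nat \<Rightarrow> real" and I_star :: "real ^ 'm"
  assumes graph_borel: "graph U \<in> sets borel"
    and tau_nonneg: "\<And>n. \<tau> n \<ge> 0"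
    and tau_mono: "mono \<tau>"
    and tau_unbounded: "\<not> bdd_above (range \<tau>)"
    and optimal: "\<exists>\<omega>\<in>vanishing_functions. \<forall>u\<in>selectors U. \<forall>k n. k < n \<longrightarrow>
                    J (\<tau> n) u0 \<ge> J (\<tau> n) u - \<omega> (\<tau> k)"
    and I_star: "((\<lambda>(n, \<xi>). I \<xi> (\<tau> n)) \<longlongrightarrow> I_star) (sequentially \<times>\<^sub>F at 0)"
begin

lemma tau_at_top: "filterlim \<tau> at_top sequentially"
  unfolding filterlim_at_top
proof
  fix Z
  obtain N where "Z \<le> \<tau> N" using tau_unbounded unfolding bdd_above_def by (metis imageE linear)
  then show "\<forall>\<^sub>F n in sequentially. Z \<le> \<tau> n"
    using tau_mono by (auto simp: eventually_sequentially mono_def intro: order_trans)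
qed

text \<open>
  A gain \<open>c\<close> that persists at all late times \<open>\<tau> n\<close> is bounded by each \<open>\<omega> (\<tau> k)\<close>, and these tend to \<open>0\<close>.
\<close>

lemma no_asymptotic_gain:
  assumes u: "u \<in> selectors U" and c: "\<And>n. N \<le> n \<Longrightarrow> c \<le> J (\<tau> n) u - J (\<tau> n) u0"
  shows "c \<le> 0"
proof -
  obtain \<omega> where \<omega>: "\<omega> \<in> vanishing_functions" "\<And>k n. k < n \<Longrightarrow> J (\<tau> n) u0 \<ge> J (\<tau> n) u - \<omega> (\<tau> k)"
    using optimal u by blast
  have "(\<omega> \<longlongrightarrow> 0) at_top" using \<omega>(1) by (simp add: vanishing_functions_def)
  then have "(\<lambda>k. \<omega> (\<tau> k)) \<longlonglongrightarrow> 0" by (rule filterlim_compose[OF _ tau_at_top])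
  moreover have "c \<le> \<omega> (\<tau> k)" for k
  proof -
    have "k < max N (Suc k)" "N \<le> max N (Suc k)" by auto
    from \<omega>(2)[OF this(1)] c[OF this(2)] show ?thesis by linarith
  qed
  ultimately show ?thesis by (intro LIMSEQ_le_const[of _ 0 c]) auto
qed

text \<open>
  The increment is the limit of means of \<open>I ((k / N) *\<^sub>R \<xi>) (\<tau> n) \<bullet> \<xi>\<close>, and for large \<open>n\<close> and small \<open>\<xi>\<close> all
  these values are close to \<open>I_star \<bullet> \<xi>\<close>. The point of the joint limit is that the estimate holds for all
  late \<open>n\<close> at once, with an error small compared with \<open>\<xi>\<close>.
\<close>

lemma payoff_increment_uniform:
  assumes \<eta>: "0 < \<eta>"
  shows "\<exists>\<delta>>0. \<exists>N. \<forall>n\<ge>N. \<forall>\<xi>. norm \<xi> < \<delta> \<longrightarrow>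
           \<bar>integral {0..\<tau> n} (payoff_increment \<xi>) - I_star \<bullet> \<xi>\<bar> \<le> \<eta> * norm \<xi>"
proof -
  have "\<forall>\<^sub>F p in sequentially \<times>\<^sub>F at 0. dist ((\<lambda>(n, \<xi>). I \<xi> (\<tau> n)) p) I_star < \<eta>"
    using I_star \<eta> by (rule tendstoD)
  then obtain Pf Pg where P: "eventually Pf sequentially" "eventually Pg (at (0 :: real ^ 'm))"
      "\<And>n \<xi>. Pf n \<Longrightarrow> Pg \<xi> \<Longrightarrow> dist (I \<xi> (\<tau> n)) I_star < \<eta>"
    unfolding eventually_prod_filter by auto
  obtain N where N: "\<And>n. N \<le> n \<Longrightarrow> Pf n" using P(1) by (auto simp: eventually_sequentially)
  obtain \<delta> where \<delta>: "0 < \<delta>" "\<And>\<xi>. \<xi> \<noteq> 0 \<Longrightarrow> norm \<xi> < \<delta> \<Longrightarrow> Pg \<xi>"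
    using P(2) by (auto simp: eventually_at)
  have I_near: "norm (I \<xi> (\<tau> n) - I_star) \<le> \<eta>" if "N \<le> n" "\<xi> \<noteq> 0" "norm \<xi> < \<delta>" for n \<xi>
    using P(3)[OF N[OF that(1)] \<delta>(2)[OF that(2,3)]] by (simp add: dist_norm)
  show ?thesis
  proof (intro exI conjI allI impI)
    show "0 < \<delta>" by (rule \<delta>(1))
    fix n \<xi> assume n: "N \<le> n" and \<xi>: "norm (\<xi> :: real ^ 'm) < \<delta>"
    show "\<bar>integral {0..\<tau> n} (payoff_increment \<xi>) - I_star \<bullet> \<xi>\<bar> \<le> \<eta> * norm \<xi>"
    proof (cases "\<xi> = 0")
      case False
      define S where "S M = (\<Sum>k<Suc M. I ((real k / real (Suc M)) *\<^sub>R \<xi>) (\<tau> n) \<bullet> \<xi>) / real (Suc M)" for M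
      \<comment> \<open>The term \<open>k = 0\<close> is not controlled by the limit at nonzero \<open>\<xi>\<close>; its weight \<open>1 / Suc M\<close> tends to \<open>0\<close>.\<close>
      define c where "c = \<bar>(I 0 (\<tau> n) - I_star) \<bullet> \<xi>\<bar>"
      have le: "\<bar>S M - I_star \<bullet> \<xi>\<bar> \<le> c * inverse (real (Suc M)) + \<eta> * norm \<xi>" for M
      proof -
        have "S M - I_star \<bullet> \<xi> = (\<Sum>k<Suc M. (I ((real k / real (Suc M)) *\<^sub>R \<xi>) (\<tau> n) - I_star) \<bullet> \<xi>) / real (Suc M)"
          by (simp add: S_def inner_diff_left sum_subtractf diff_divide_distrib del: of_nat_Suc sum.lessThan_Suc)
        also have "\<bar>\<dots>\<bar> \<le> (\<Sum>k<Suc M. \<bar>(I ((real k / real (Suc M)) *\<^sub>R \<xi>) (\<tau> n) - I_star) \<bullet> \<xi>\<bar>) / real (Suc M)"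
          by (simp add: divide_right_mono sum_abs del: of_nat_Suc sum.lessThan_Suc)
        also have "(\<Sum>k<Suc M. \<bar>(I ((real k / real (Suc M)) *\<^sub>R \<xi>) (\<tau> n) - I_star) \<bullet> \<xi>\<bar>)
            = c + (\<Sum>k<M. \<bar>(I ((real (Suc k) / real (Suc M)) *\<^sub>R \<xi>) (\<tau> n) - I_star) \<bullet> \<xi>\<bar>)"
          by (subst sum.lessThan_Suc_shift) (simp add: c_def)
        also have "\<dots> \<le> c + (\<Sum>k<M. \<eta> * norm \<xi>)"
        proof (intro add_left_mono sum_mono)
          fix k assume "k \<in> {..<M}"
          then have "norm ((real (Suc k) / real (Suc M)) *\<^sub>R \<xi>) \<le> 1 * norm \<xi>"
            unfolding norm_scaleR by (intro mult_right_mono) auto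
          then have "norm (I ((real (Suc k) / real (Suc M)) *\<^sub>R \<xi>) (\<tau> n) - I_star) \<le> \<eta>"
            using \<xi> False by (intro I_near n) auto
          then have "norm (I ((real (Suc k) / real (Suc M)) *\<^sub>R \<xi>) (\<tau> n) - I_star) * norm \<xi> \<le> \<eta> * norm \<xi>"
            by (intro mult_right_mono) auto
          then show "\<bar>(I ((real (Suc k) / real (Suc M)) *\<^sub>R \<xi>) (\<tau> n) - I_star) \<bullet> \<xi>\<bar> \<le> \<eta> * norm \<xi>"
            by (rule order_trans[OF Cauchy_Schwarz_ineq2])
        qed
        also have "\<dots> \<le> c + real (Suc M) * (\<eta> * norm \<xi>)" using \<eta> by (simp add: algebra_simps)
        finally have "\<bar>S M - I_star \<bullet> \<xi>\<bar> \<le> (c + real (Suc M) * (\<eta> * norm \<xi>)) / real (Suc M)"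
          by (simp add: divide_right_mono)
        also have "\<dots> = c * inverse (real (Suc M)) + \<eta> * norm \<xi>"
          by (simp add: field_simps del: of_nat_Suc)
        finally show ?thesis .
      qed
      have "(\<lambda>M. \<bar>S M - I_star \<bullet> \<xi>\<bar>) \<longlonglongrightarrow> \<bar>integral {0..\<tau> n} (payoff_increment \<xi>) - I_star \<bullet> \<xi>\<bar>"
        unfolding S_def by (intro tendsto_intros payoff_increment_integral(2) tau_nonneg)
      moreover have "(\<lambda>M. c * inverse (real (Suc M)) + \<eta> * norm \<xi>) \<longlonglongrightarrow> c * 0 + \<eta> * norm \<xi>"
        by (intro tendsto_intros LIMSEQ_inverse_real_of_nat)
      ultimately have "\<bar>integral {0..\<tau> n} (payoff_increment \<xi>) - I_star \<bullet> \<xi>\<bar> \<le> c * 0 + \<eta> * norm \<xi>"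
        by (rule LIMSEQ_le) (use le in auto)
      then show ?thesis by simp
    qed simp
  qed
qed

text \<open>
  The joint limit is taken over \<open>\<xi> \<noteq> 0\<close>. For fixed \<open>n\<close>, the vector \<open>I 0 (\<tau> n)\<close> is the gradient at \<open>0\<close> of the
  payoff increment, which is within \<open>r / 2 * norm \<xi>\<close> of \<open>I_star \<bullet> \<xi>\<close>; test this in the direction of the difference.
\<close>

lemma I_tendsto: "(\<lambda>n. I 0 (\<tau> n)) \<longlonglongrightarrow> I_star"
proof (rule LIMSEQ_I)
  fix r :: real assume "0 < r"
  then have "0 < r / 2" by simp
  from payoff_increment_uniform[OF this] obtain \<delta> N where \<delta>: "0 < \<delta>"
    and N': "\<forall>n\<ge>N. \<forall>\<xi>. norm \<xi> < \<delta> \<longrightarrow> \<bar>integral {0..\<tau> n} (payoff_increment \<xi>) - I_star \<bullet> \<xi>\<bar> \<le> r / 2 * norm \<xi>"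
    by (elim exE conjE)
  note N = N'[rule_format]
  have "norm (I 0 (\<tau> n) - I_star) \<le> r / 2" if n: "N \<le> n" for n
  proof -
    define v where "v = I 0 (\<tau> n) - I_star"
    from payoff_increment_linearised[OF tau_nonneg[of n], of 1] obtain C where C1: "0 \<le> C"
      and C2: "\<forall>\<xi>\<in>cball 0 1. \<forall>s\<in>{0..\<tau> n}. \<bar>integral {0..s} (payoff_increment \<xi>) - I 0 s \<bullet> \<xi>\<bar> \<le> C * (norm \<xi>)\<^sup>2"
      by (elim exE conjE)
    have C3: "\<bar>integral {0..\<tau> n} (payoff_increment \<xi>) - I 0 (\<tau> n) \<bullet> \<xi>\<bar> \<le> C * (norm \<xi>)\<^sup>2" if "norm \<xi> \<le> 1" for \<xi>
      using C2[rule_format, of \<xi> "\<tau> n"] that tau_nonneg[of n] by simp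
    note C = C1 C3
    have "norm v \<le> r / 2 + e" if e: "0 < e" for e
    proof (cases "v = 0")
      case False
      \<comment> \<open>The length of the test vector is below \<open>\<delta>\<close> and so small that the quadratic error is at most \<open>e\<close> times it.\<close>
      define \<epsilon> where "\<epsilon> = min (min (\<delta> / 2) 1) (e / (C + 1)) / norm v"
      have nv: "0 < norm v" using False by simp
      have \<epsilon>: "0 < \<epsilon>" using nv \<delta> e C(1) by (simp add: \<epsilon>_def)
      have \<xi>: "norm (\<epsilon> *\<^sub>R v) = min (min (\<delta> / 2) 1) (e / (C + 1))"
        using nv \<delta> e C(1) by (simp add: \<epsilon>_def)
      then have b: "norm (\<epsilon> *\<^sub>R v) < \<delta>" "norm (\<epsilon> *\<^sub>R v) \<le> 1" "norm (\<epsilon> *\<^sub>R v) \<le> e / (C + 1)" using \<delta> by auto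
      have "C * norm (\<epsilon> *\<^sub>R v) \<le> C * (e / (C + 1))" using b(3) C(1) by (rule mult_left_mono)
      also have "\<dots> \<le> e" using C(1) e by (simp add: divide_simps)
      finally have Ce: "C * norm (\<epsilon> *\<^sub>R v) \<le> e" .
      have eq: "v \<bullet> (\<epsilon> *\<^sub>R v) = I 0 (\<tau> n) \<bullet> (\<epsilon> *\<^sub>R v) - I_star \<bullet> (\<epsilon> *\<^sub>R v)"
        by (simp only: v_def inner_diff_left)
      have "v \<bullet> (\<epsilon> *\<^sub>R v) \<le> r / 2 * norm (\<epsilon> *\<^sub>R v) + C * (norm (\<epsilon> *\<^sub>R v))\<^sup>2"
        using N[OF n b(1)] C(2)[OF b(2)] unfolding eq by linarith
      also have "\<dots> \<le> (r / 2 + e) * norm (\<epsilon> *\<^sub>R v)"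
        using mult_right_mono[OF Ce norm_ge_zero[of "\<epsilon> *\<^sub>R v"]] by (simp add: power2_eq_square algebra_simps)
      finally have "\<epsilon> * (norm v * norm v) \<le> \<epsilon> * ((r / 2 + e) * norm v)"
        using \<epsilon> by (simp add: power2_norm_eq_inner[symmetric] power2_eq_square mult_ac)
      then show ?thesis using \<epsilon> nv by (simp add: mult_le_cancel_left_pos mult_le_cancel_right_pos)
    qed (use e \<open>0 < r\<close> in simp)
    then have "norm v \<le> r / 2" by (rule field_le_epsilon)
    then show ?thesis by (simp add: v_def)
  qed
  then show "\<exists>N. \<forall>n\<ge>N. norm (I 0 (\<tau> n) - I_star) < r" using \<open>0 < r\<close>
    by (intro exI[of _ N] allI impI) (rule le_less_trans[of _ "r / 2"], simp_all)
qed

end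

lemma AE_halfline_negligible:
  assumes "\<And>n::nat. \<exists>N. negligible N \<and> (\<forall>t\<in>{0<..<real (Suc n)} - N. P t)"
  shows "AE t in lebesgue_on {0..}. P t"
proof -
  obtain N where N: "\<And>n. negligible (N n)" "\<And>n t. t \<in> {0<..<real (Suc n)} - N n \<Longrightarrow> P t" using assms by metis
  have "P t" if t: "t \<in> {0..} - (insert 0 (\<Union>n. N n))" for t
  proof -
    obtain n where "t < real n" using reals_Archimedean2 by blast
    then show ?thesis using t by (intro N(2)[of t n]) (auto simp: order.order_iff_strict)
  qed
  moreover have "negligible (insert 0 (\<Union>n. N n))"
  proof -
    have "negligible (\<Union>n. N n)" using N(1) by (intro negligible_countable_Union) auto
    then show ?thesis by (simp add: negligible_insert)
  qed
  ultimately have "\<exists>N'. negligible N' \<and> (\<forall>t\<in>{0..} - N'. P t)"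
    by (intro exI[of _ "insert 0 (\<Union>n. N n)"] conjI ballI)
  then show ?thesis by (subst AE_lebesgue_on_iff_negligible) simp_all
qed

lemma AE_lebesgue_on_halfline: "(AE t in lebesgue_on {0..}. P t) \<longleftrightarrow> (AE t in lebesgue. 0 \<le> t \<longrightarrow> P (t::real))"
  by (subst AE_restrict_space_iff) auto

context optimal_control_system
begin

text \<open>
  The gain of a needle of length \<open>\<epsilon>\<close> is bounded below by \<open>q \<eta> \<epsilon>\<close> at all late times \<open>\<tau> n\<close>. Here the displaced
  state is \<open>X \<xi>\<close> for an initial state \<open>\<xi>\<close> of order \<open>\<epsilon>\<close>, and
  \<open>(I_star - I 0 s) \<bullet> \<xi> = costate I_star s \<bullet> (A 0 s *v \<xi>)\<close> turns the payoff after the needle into the costate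
  applied to the displacement \<open>d \<epsilon>\<close>. Optimality gives \<open>q \<eta> \<epsilon> \<le> 0\<close>; divided by \<open>\<epsilon>\<close>, this tends to the assertion
  up to a multiple of \<open>\<eta>\<close>.
\<close>

lemma needle_inequality:
  assumes u: "u \<in> selectors U" and t0: "0 < t0" "t0 < T"
    and dh: "((\<lambda>s. integral {0..s} (f_jump u)) has_vector_derivative f_jump u t0) (at t0)"
    and dn: "((\<lambda>s. integral {0..s} (\<lambda>r. norm (f_jump u r))) has_vector_derivative norm (f_jump u t0)) (at t0)"
    and dg: "((\<lambda>s. integral {0..s} (g_jump u)) has_vector_derivative g_jump u t0) (at t0)"
  shows "costate I_star t0 \<bullet> f_jump u t0 + g_jump u t0 \<le> 0"
proof -
  have T: "0 \<le> T" and t00: "0 \<le> t0" using t0 by auto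
  define C1 where "C1 = flow_const T"
  have C1: "1 \<le> C1" unfolding C1_def by (rule flow_const_ge_1[OF T])
  from needle_payoff[OF T u] obtain K where K: "K \<in> loc_summable"
    and gain': "\<forall>s t. 0 \<le> s \<longrightarrow> s \<le> t \<longrightarrow> t \<le> T \<longrightarrow>
    (\<forall>S \<xi>. T \<le> S \<longrightarrow> X \<xi> t = \<phi> (needle u s t) t \<longrightarrow>
      integral {s..t} (g_jump u) - integral {s..t} K * (C1 * integral {s..t} (\<lambda>r. norm (f_jump u r)))
        + integral {0..S} (payoff_increment \<xi>) - integral {0..t} (payoff_increment \<xi>)
      \<le> J S (needle u s t) - J S u0)"
    unfolding C1_def by (elim bexE)
  note gain = gain'[rule_format]
  from X_linearised[OF T, of 1] obtain C2 where C2: "0 \<le> C2" and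
    lin': "\<forall>\<xi>\<in>cball 0 1. \<forall>\<eta>\<in>cball 0 1. \<forall>t\<in>{0..T}. norm (X \<eta> t - X \<xi> t - A \<xi> t *v (\<eta> - \<xi>)) \<le> C2 * (norm (\<eta> - \<xi>))\<^sup>2"
    by (elim exE conjE)
  from payoff_increment_linearised[OF T, of 1] obtain C3 where C3: "0 \<le> C3" and
    pay': "\<forall>\<xi>\<in>cball 0 1. \<forall>s\<in>{0..T}. \<bar>integral {0..s} (payoff_increment \<xi>) - I 0 s \<bullet> \<xi>\<bar> \<le> C3 * (norm \<xi>)\<^sup>2"
    by (elim exE conjE)
  have cont: "continuous_on {0..T} (costate I_star)" by (rule abs_cont_on_imp_continuous_on[OF costate_abs_cont[OF T]])
  have "bounded (costate I_star ` {0..T})"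
    by (intro compact_imp_bounded compact_continuous_image cont compact_Icc)
  then obtain P where P: "\<And>t. t \<in> {0..T} \<Longrightarrow> norm (costate I_star t) \<le> P" unfolding bounded_iff by blast
  have P0: "0 \<le> P" using P[of 0] T norm_ge_zero[of "costate I_star 0"] by (meson atLeastAtMost_iff order_refl order_trans)
  define d where "d \<epsilon> = \<phi> (needle u t0 (t0 + \<epsilon>)) (t0 + \<epsilon>) - X 0 (t0 + \<epsilon>)" for \<epsilon>
  define H where "H \<epsilon> = integral {t0..t0 + \<epsilon>} (f_jump u)" for \<epsilon>
  define Hn where "Hn \<epsilon> = integral {t0..t0 + \<epsilon>} (\<lambda>r. norm (f_jump u r))" for \<epsilon>
  define G where "G \<epsilon> = integral {t0..t0 + \<epsilon>} (g_jump u)" for \<epsilon>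
  define KI where "KI \<epsilon> = integral {t0..t0 + \<epsilon>} K" for \<epsilon>
  define LI where "LI \<epsilon> = integral {t0..t0 + \<epsilon>} L" for \<epsilon>
  have pos: "\<forall>\<^sub>F \<epsilon> in at_right 0. \<epsilon> \<in> {0<..<T - t0}" using t0 by (intro eventually_at_right_real) simp
  have limH: "((\<lambda>\<epsilon>. H \<epsilon> /\<^sub>R \<epsilon>) \<longlongrightarrow> f_jump u t0) (at_right 0)" unfolding H_def
    by (rule indefinite_integral_quotient[OF _ t00 t0(2) dh])
       (use f_jump_integrable[OF u T] in \<open>simp add: absolutely_integrable_on_def\<close>)
  have limHn: "((\<lambda>\<epsilon>. Hn \<epsilon> /\<^sub>R \<epsilon>) \<longlongrightarrow> norm (f_jump u t0)) (at_right 0)" unfolding Hn_def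
    by (rule indefinite_integral_quotient[OF f_jump_norm_integrable[OF u T] t00 t0(2) dn])
  have limG: "((\<lambda>\<epsilon>. G \<epsilon> /\<^sub>R \<epsilon>) \<longlongrightarrow> g_jump u t0) (at_right 0)" unfolding G_def
    by (rule indefinite_integral_quotient[OF _ t00 t0(2) dg])
       (use g_jump_integrable[OF u T] in \<open>simp add: absolutely_integrable_on_def\<close>)
  have limK: "(KI \<longlongrightarrow> 0) (at_right 0)" unfolding KI_def
    by (rule short_integral_tendsto_0[OF loc_summable_integrable(1)[OF K order_refl order_refl T] t00 t0(2)])
  have limL: "(LI \<longlongrightarrow> 0) (at_right 0)" unfolding LI_def
    by (rule short_integral_tendsto_0[OF loc_summable_integrable(1)[OF L order_refl order_refl T] t00 t0(2)])
  have limd: "((\<lambda>\<epsilon>. d \<epsilon> /\<^sub>R \<epsilon>) \<longlongrightarrow> f_jump u t0) (at_right 0)"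
  proof -
    have "((\<lambda>\<epsilon>. LI \<epsilon> * (C1 * (Hn \<epsilon> /\<^sub>R \<epsilon>))) \<longlongrightarrow> 0 * (C1 * norm (f_jump u t0))) (at_right 0)"
      by (intro tendsto_intros limL limHn)
    then have lim0: "((\<lambda>\<epsilon>. LI \<epsilon> * (C1 * (Hn \<epsilon> /\<^sub>R \<epsilon>))) \<longlongrightarrow> 0) (at_right 0)" by simp
    have "((\<lambda>\<epsilon>. (d \<epsilon> - H \<epsilon>) /\<^sub>R \<epsilon>) \<longlongrightarrow> 0) (at_right 0)"
    proof (rule Lim_null_comparison[OF _ lim0])
      show "\<forall>\<^sub>F \<epsilon> in at_right 0. norm ((d \<epsilon> - H \<epsilon>) /\<^sub>R \<epsilon>) \<le> LI \<epsilon> * (C1 * (Hn \<epsilon> /\<^sub>R \<epsilon>))"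
        using pos
      proof eventually_elim
        case (elim \<epsilon>)
        have "norm (d \<epsilon> - H \<epsilon>) \<le> LI \<epsilon> * (C1 * Hn \<epsilon>)"
          unfolding d_def H_def LI_def Hn_def C1_def by (rule needle_endpoint[OF u t00]) (use elim in auto)
        then have "norm (d \<epsilon> - H \<epsilon>) * inverse \<epsilon> \<le> LI \<epsilon> * (C1 * Hn \<epsilon>) * inverse \<epsilon>"
          using elim by (intro mult_right_mono) auto
        then show ?case using elim by (simp add: mult_ac)
      qed
    qed
    from tendsto_add[OF limH this] show ?thesis by (simp add: scaleR_right_distrib[symmetric])
  qed
  have limd0: "(d \<longlongrightarrow> 0) (at_right 0)"
  proof -
    have "((\<lambda>\<epsilon>. \<epsilon> *\<^sub>R (d \<epsilon> /\<^sub>R \<epsilon>)) \<longlongrightarrow> 0 *\<^sub>R f_jump u t0) (at_right 0)" by (intro tendsto_intros limd)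
    moreover have "\<forall>\<^sub>F \<epsilon> in at_right 0. \<epsilon> *\<^sub>R (d \<epsilon> /\<^sub>R \<epsilon>) = d \<epsilon>" using pos by eventually_elim simp
    ultimately show ?thesis by (simp add: Lim_transform_eventually)
  qed
  have limc: "((\<lambda>\<epsilon>. costate I_star (t0 + \<epsilon>)) \<longlongrightarrow> costate I_star t0) (at_right 0)"
  proof -
    have "((\<lambda>\<epsilon>. t0 + \<epsilon>) \<longlongrightarrow> t0 + 0) (at_right 0)" by (intro tendsto_intros)
    moreover have "\<forall>\<^sub>F \<epsilon> in at_right 0. t0 + \<epsilon> \<in> {0..T}" using pos by eventually_elim (use t0 in auto)
    ultimately show ?thesis
      using t0 by (intro continuous_on_tendsto_compose[OF cont]) auto
  qed
  define q where "q \<eta> \<epsilon> = G \<epsilon> - KI \<epsilon> * (C1 * Hn \<epsilon>) + costate I_star (t0 + \<epsilon>) \<bullet> d \<epsilon>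
     - (P * C2 + C3) * (C1 * norm (d \<epsilon>))\<^sup>2 - \<eta> * (C1 * norm (d \<epsilon>))" for \<eta> \<epsilon>
  have q_le: "\<forall>\<^sub>F \<epsilon> in at_right 0. q \<eta> \<epsilon> \<le> 0" if \<eta>: "0 < \<eta>" for \<eta>
  proof -
    from payoff_increment_uniform[OF \<eta>] obtain \<delta> N0 where \<delta>: "0 < \<delta>" and
      N0: "\<forall>n\<ge>N0. \<forall>\<xi>. norm \<xi> < \<delta> \<longrightarrow> \<bar>integral {0..\<tau> n} (payoff_increment \<xi>) - I_star \<bullet> \<xi>\<bar> \<le> \<eta> * norm \<xi>"
      by (elim exE conjE)
    have "\<forall>\<^sub>F n in sequentially. T \<le> \<tau> n" using tau_at_top unfolding filterlim_at_top by blast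
    then obtain N1 where N1: "\<And>n. N1 \<le> n \<Longrightarrow> T \<le> \<tau> n" by (auto simp: eventually_sequentially)
    have "((\<lambda>\<epsilon>. C1 * norm (d \<epsilon>)) \<longlongrightarrow> C1 * 0) (at_right 0)" by (intro tendsto_intros tendsto_norm_zero limd0)
    then have small: "\<forall>\<^sub>F \<epsilon> in at_right 0. C1 * norm (d \<epsilon>) < min \<delta> 1"
      using \<delta> by (intro order_tendstoD(2)[where y = "C1 * 0"]) auto
    show ?thesis using pos small
    proof eventually_elim
      case (elim \<epsilon>)
      let ?s = "t0 + \<epsilon>" and ?w = "needle u t0 (t0 + \<epsilon>)"
      have s: "t0 \<le> ?s" "?s \<le> T" "?s \<in> {0..T}" "0 \<le> ?s" using elim t0 by auto
      obtain \<xi> where \<xi>: "X \<xi> ?s = \<phi> ?w ?s" using surjD[OF X_surj[OF s(4)], of "\<phi> ?w ?s"] by auto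
      have n\<xi>: "norm \<xi> \<le> C1 * norm (d \<epsilon>)"
        using X_lipschitz(2)[OF s(3), of \<xi> 0] by (simp add: \<xi> d_def C1_def)
      then have \<xi>1: "norm \<xi> < \<delta>" "\<xi> \<in> cball 0 1" using elim(2) by auto
      have n\<xi>2: "(norm \<xi>)\<^sup>2 \<le> (C1 * norm (d \<epsilon>))\<^sup>2" by (rule power_mono[OF n\<xi>]) simp
      have lin: "norm (d \<epsilon> - A 0 ?s *v \<xi>) \<le> C2 * (norm \<xi>)\<^sup>2"
        using lin'[rule_format, of 0 \<xi> ?s] \<xi>1(2) s(3) by (simp add: d_def \<xi>)
      have "(I_star - I 0 ?s) \<bullet> \<xi> = costate I_star ?s \<bullet> (A 0 ?s *v \<xi>)"
        using inner_vector_matrix[of "costate I_star ?s" "A 0 ?s" \<xi>] by (simp add: costate_A[OF s(4)])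
      also have "\<dots> = costate I_star ?s \<bullet> d \<epsilon> - costate I_star ?s \<bullet> (d \<epsilon> - A 0 ?s *v \<xi>)" by (simp add: inner_diff_right)
      also have "\<dots> \<ge> costate I_star ?s \<bullet> d \<epsilon> - P * (C2 * (norm \<xi>)\<^sup>2)"
      proof -
        have "costate I_star ?s \<bullet> (d \<epsilon> - A 0 ?s *v \<xi>) \<le> norm (costate I_star ?s) * norm (d \<epsilon> - A 0 ?s *v \<xi>)"
          by (rule norm_cauchy_schwarz)
        also have "\<dots> \<le> P * (C2 * (norm \<xi>)\<^sup>2)" by (intro mult_mono P s lin P0) auto
        finally show ?thesis by simp
      qed
      finally have cost: "costate I_star ?s \<bullet> d \<epsilon> - P * (C2 * (norm \<xi>)\<^sup>2) \<le> I_star \<bullet> \<xi> - I 0 ?s \<bullet> \<xi>"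
        by (simp add: inner_diff_left)
      have before: "integral {0..?s} (payoff_increment \<xi>) \<le> I 0 ?s \<bullet> \<xi> + C3 * (norm \<xi>)\<^sup>2"
        using pay'[rule_format, OF \<xi>1(2) s(3)] by linarith
      have "(P * C2 + C3) * (norm \<xi>)\<^sup>2 \<le> (P * C2 + C3) * (C1 * norm (d \<epsilon>))\<^sup>2"
        using P0 C2 C3 by (intro mult_left_mono n\<xi>2) auto
      moreover have "\<eta> * norm \<xi> \<le> \<eta> * (C1 * norm (d \<epsilon>))" using \<eta> by (intro mult_left_mono n\<xi>) auto
      moreover have "(P * C2 + C3) * (norm \<xi>)\<^sup>2 = P * (C2 * (norm \<xi>)\<^sup>2) + C3 * (norm \<xi>)\<^sup>2" by (simp add: algebra_simps)
      ultimately have low: "q \<eta> \<epsilon> \<le> G \<epsilon> - KI \<epsilon> * (C1 * Hn \<epsilon>) + (I_star \<bullet> \<xi> - \<eta> * norm \<xi>) - integral {0..?s} (payoff_increment \<xi>)"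
        using cost before unfolding q_def by linarith
      show ?case
      proof (rule no_asymptotic_gain[OF needle_selector[OF u]])
        fix n assume n: "max N0 N1 \<le> n"
        have "\<bar>integral {0..\<tau> n} (payoff_increment \<xi>) - I_star \<bullet> \<xi>\<bar> \<le> \<eta> * norm \<xi>" using N0 n \<xi>1(1) by auto
        then have "I_star \<bullet> \<xi> - \<eta> * norm \<xi> \<le> integral {0..\<tau> n} (payoff_increment \<xi>)" by linarith
        moreover have "G \<epsilon> - KI \<epsilon> * (C1 * Hn \<epsilon>) + integral {0..\<tau> n} (payoff_increment \<xi>) - integral {0..?s} (payoff_increment \<xi>)
            \<le> J (\<tau> n) ?w - J (\<tau> n) u0"
          unfolding G_def KI_def Hn_def using n by (intro gain t00 s(1,2) \<xi> N1) simp
        ultimately show "q \<eta> \<epsilon> \<le> J (\<tau> n) ?w - J (\<tau> n) u0" using low by linarith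
      qed
    qed
  qed
  have main: "costate I_star t0 \<bullet> f_jump u t0 + g_jump u t0 \<le> \<eta> * (C1 * norm (f_jump u t0))" if \<eta>: "0 < \<eta>" for \<eta>
  proof -
    have "((\<lambda>\<epsilon>. G \<epsilon> /\<^sub>R \<epsilon> - KI \<epsilon> * (C1 * (Hn \<epsilon> /\<^sub>R \<epsilon>)) + costate I_star (t0 + \<epsilon>) \<bullet> (d \<epsilon> /\<^sub>R \<epsilon>)
       - (P * C2 + C3) * (C1\<^sup>2 * (norm (d \<epsilon>) * norm (d \<epsilon> /\<^sub>R \<epsilon>))) - \<eta> * (C1 * norm (d \<epsilon> /\<^sub>R \<epsilon>))) \<longlongrightarrow>
       g_jump u t0 - 0 * (C1 * norm (f_jump u t0)) + costate I_star t0 \<bullet> f_jump u t0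
       - (P * C2 + C3) * (C1\<^sup>2 * (0 * norm (f_jump u t0))) - \<eta> * (C1 * norm (f_jump u t0))) (at_right 0)"
      by (intro tendsto_intros limG limK limHn limc limd tendsto_norm_zero limd0)
    moreover have "\<forall>\<^sub>F \<epsilon> in at_right 0. G \<epsilon> /\<^sub>R \<epsilon> - KI \<epsilon> * (C1 * (Hn \<epsilon> /\<^sub>R \<epsilon>)) + costate I_star (t0 + \<epsilon>) \<bullet> (d \<epsilon> /\<^sub>R \<epsilon>)
       - (P * C2 + C3) * (C1\<^sup>2 * (norm (d \<epsilon>) * norm (d \<epsilon> /\<^sub>R \<epsilon>))) - \<eta> * (C1 * norm (d \<epsilon> /\<^sub>R \<epsilon>)) \<le> 0"
      using pos q_le[OF \<eta>]
    proof eventually_elim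
      case (elim \<epsilon>)
      have "inverse \<epsilon> * q \<eta> \<epsilon> \<le> 0" using elim by (intro mult_nonneg_nonpos) auto
      moreover have "inverse \<epsilon> * q \<eta> \<epsilon> = G \<epsilon> /\<^sub>R \<epsilon> - KI \<epsilon> * (C1 * (Hn \<epsilon> /\<^sub>R \<epsilon>)) + costate I_star (t0 + \<epsilon>) \<bullet> (d \<epsilon> /\<^sub>R \<epsilon>)
       - (P * C2 + C3) * (C1\<^sup>2 * (norm (d \<epsilon>) * norm (d \<epsilon> /\<^sub>R \<epsilon>))) - \<eta> * (C1 * norm (d \<epsilon> /\<^sub>R \<epsilon>))"
        using elim(1) by (simp add: q_def algebra_simps power2_eq_square)
      ultimately show ?case by simp
    qed
    ultimately have "g_jump u t0 - 0 * (C1 * norm (f_jump u t0)) + costate I_star t0 \<bullet> f_jump u t0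
       - (P * C2 + C3) * (C1\<^sup>2 * (0 * norm (f_jump u t0))) - \<eta> * (C1 * norm (f_jump u t0)) \<le> 0"
      by (rule tendsto_upperbound) simp
    then show ?thesis by simp
  qed
  show ?thesis
  proof (rule field_le_epsilon)
    fix e :: real assume e: "0 < e"
    define c where "c = C1 * norm (f_jump u t0)"
    have c: "0 \<le> c" using C1 by (simp add: c_def)
    have "costate I_star t0 \<bullet> f_jump u t0 + g_jump u t0 \<le> e / (c + 1) * c"
      unfolding c_def by (rule main) (use e c in \<open>simp add: c_def[symmetric] add_nonneg_pos\<close>)
    also have "\<dots> \<le> e" using c e by (simp add: divide_simps)
    finally show "costate I_star t0 \<bullet> f_jump u t0 + g_jump u t0 \<le> 0 + e" by simp
  qed
qed

abbreviation H :: "real \<Rightarrow> 'u \<Rightarrow> real" where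
  "H t v \<equiv> hamiltonian f g (X 0 t) t v 1 (costate I_star t)"

lemma hamiltonian_selector:
  assumes u: "u \<in> selectors U"
  shows "AE t in lebesgue_on {0..}. H t (u t) \<le> H t (u0 t)"
proof (rule AE_halfline_negligible)
  fix n :: nat
  define T where "T = real (Suc n)"
  have T: "0 \<le> T" by (simp add: T_def)
  have h: "f_jump u integrable_on {0..T}" "g_jump u integrable_on {0..T}"
    using f_jump_integrable[OF u T] g_jump_integrable[OF u T] by (auto simp: absolutely_integrable_on_def)
  obtain N1 where N1: "negligible N1" "\<And>t. t \<in> {0<..<T} - N1 \<Longrightarrow> ((\<lambda>s. integral {0..s} (f_jump u)) has_vector_derivative f_jump u t) (at t)"
    using integral_has_derivative_ae[OF h(1)] by blast
  obtain N2 where N2: "negligible N2" "\<And>t. t \<in> {0<..<T} - N2 \<Longrightarrow>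
      ((\<lambda>s. integral {0..s} (\<lambda>r. norm (f_jump u r))) has_vector_derivative norm (f_jump u t)) (at t)"
    using integral_has_derivative_ae[OF f_jump_norm_integrable[OF u T]] by blast
  obtain N3 where N3: "negligible N3" "\<And>t. t \<in> {0<..<T} - N3 \<Longrightarrow> ((\<lambda>s. integral {0..s} (g_jump u)) has_vector_derivative g_jump u t) (at t)"
    using integral_has_derivative_ae[OF h(2)] by blast
  show "\<exists>N. negligible N \<and> (\<forall>t\<in>{0<..<real (Suc n)} - N. H t (u t) \<le> H t (u0 t))"
  proof (intro exI conjI ballI)
    show "negligible (N1 \<union> N2 \<union> N3)" using N1 N2 N3 by simp
    fix t assume "t \<in> {0<..<real (Suc n)} - (N1 \<union> N2 \<union> N3)"
    then have t: "0 < t" "t < T" "t \<in> {0<..<T} - N1" "t \<in> {0<..<T} - N2" "t \<in> {0<..<T} - N3" by (auto simp: T_def)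
    have "costate I_star t \<bullet> f_jump u t + g_jump u t \<le> 0"
      by (rule needle_inequality[OF u t(1,2) N1(2)[OF t(3)] N2(2)[OF t(4)] N3(2)[OF t(5)]])
    then show "H t (u t) \<le> H t (u0 t)" by (simp add: hamiltonian_def inner_diff_right)
  qed
qed

text \<open>
  A better value \<open>p\<close> of the Hamiltonian at a time \<open>t\<close> would be better on a whole neighbourhood of \<open>p\<close> in \<open>U t\<close>, by
  continuity in the control, hence on a basic open set that one of countably many selectors meets at
  \<open>t\<close>. This contradicts \<open>hamiltonian_selector\<close> for that selector, except on a null set.
\<close>

lemma hamiltonian_maximised: "AE t in lebesgue. 0 \<le> t \<longrightarrow> (\<forall>p\<in>U t. H t p \<le> H t (u0 t))"
proof -
  obtain \<B> :: "'u set set" where \<B>: "countable \<B>" "topological_basis \<B>" using ex_countable_basis by blast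
  have "\<exists>w. (\<forall>n::nat. w n \<in> selectors U) \<and>
    (AE t in lebesgue. 0 \<le> t \<longrightarrow> U t \<inter> S \<noteq> {} \<longrightarrow> (\<exists>n. w n t \<in> S))" if S: "S \<in> \<B>" for S
    by (rule selector_hitting_open[OF u0 graph_borel topological_basis_open[OF \<B>(2) S]])
  then have "\<forall>S\<in>\<B>. \<exists>w. (\<forall>n::nat. w n \<in> selectors U) \<and>
    (AE t in lebesgue. 0 \<le> t \<longrightarrow> U t \<inter> S \<noteq> {} \<longrightarrow> (\<exists>n. w n t \<in> S))"
    by (rule ballI)
  from bchoice[OF this] obtain w where w': "\<forall>S\<in>\<B>. (\<forall>n::nat. w S n \<in> selectors U) \<and>
    (AE t in lebesgue. 0 \<le> t \<longrightarrow> U t \<inter> S \<noteq> {} \<longrightarrow> (\<exists>n. w S n t \<in> S))" by (rule exE)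
  have w: "w S n \<in> selectors U" "AE t in lebesgue. 0 \<le> t \<longrightarrow> U t \<inter> S \<noteq> {} \<longrightarrow> (\<exists>n. w S n t \<in> S)" if "S \<in> \<B>" for S n
    using bspec[OF w' that] by simp_all
  have "AE t in lebesgue. \<forall>S\<in>\<B>. 0 \<le> t \<longrightarrow> U t \<inter> S \<noteq> {} \<longrightarrow> (\<exists>n. w S n t \<in> S)"
    unfolding AE_ball_countable[OF \<B>(1)] by (intro ballI w(2))
  moreover have "AE t in lebesgue. \<forall>S\<in>\<B>. \<forall>n. 0 \<le> t \<longrightarrow> H t (w S n t) \<le> H t (u0 t)"
    unfolding AE_ball_countable[OF \<B>(1)] AE_all_countable AE_lebesgue_on_halfline[symmetric]
    by (intro ballI allI hamiltonian_selector w(1))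
  ultimately show ?thesis
  proof eventually_elim
    case (elim t)
    show ?case
    proof (intro impI ballI, rule ccontr)
      fix p assume t: "0 \<le> t" and p: "p \<in> U t" and less: "\<not> H t p \<le> H t (u0 t)"
      have cont: "continuous_on (U t) (H t)"
        unfolding hamiltonian_def using f_regular g_regular t
        by (intro continuous_intros caratheodory_continuous_control) (auto simp: regular_map_def)
      have "\<exists>W. open W \<and> W \<inter> U t = H t -` {H t (u0 t)<..} \<inter> U t"
        using cont open_greaterThan unfolding continuous_on_open_invariant by (elim allE impE)
      then obtain W where W: "open W" "W \<inter> U t = H t -` {H t (u0 t)<..} \<inter> U t" by (elim exE conjE)
      have W_iff: "v \<in> W \<longleftrightarrow> H t (u0 t) < H t v" if "v \<in> U t" for v
      proof -
        have "v \<in> W \<longleftrightarrow> v \<in> W \<inter> U t" using that by simp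
        also have "\<dots> \<longleftrightarrow> H t (u0 t) < H t v" unfolding W(2) using that by simp
        finally show ?thesis .
      qed
      have "p \<in> W" using W_iff[OF p] less by simp
      then obtain S where S: "S \<in> \<B>" "p \<in> S" "S \<subseteq> W"
        by (rule topological_basisE[OF \<B>(2) W(1)])
      have "U t \<inter> S \<noteq> {}" using p S(2) by blast
      then obtain n where n: "w S n t \<in> S" using bspec[OF elim(1) S(1)] t by blast
      have "w S n t \<in> U t" by (rule selector_in[OF w(1)[OF S(1)] t])
      then have "H t (u0 t) < H t (w S n t)" using W_iff n S(3) by blast
      moreover have "H t (w S n t) \<le> H t (u0 t)" using bspec[OF elim(2) S(1)] t by blast
      ultimately show False by simp
    qed
  qed
qed

end

context regular_control_system
begin

lemma hamiltonian_gradient: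
  assumes "0 \<le> t"
  shows "gradient (\<lambda>y. hamiltonian f g y t v lam p) x = p v* Df f t x v + lam *\<^sub>R Dg g t x v"
proof (rule has_derivative_imp_gradient)
  have "((\<lambda>y. hamiltonian f g y t v lam p) has_derivative (\<lambda>h. p \<bullet> (Df f t x v *v h) + lam * (Dg g t x v \<bullet> h))) (at x)"
    unfolding hamiltonian_def
    by (intro has_derivative_add has_derivative_inner_right has_derivative_mult_right f_derivative g_derivative assms)
  moreover have "(\<lambda>h. p \<bullet> (Df f t x v *v h) + lam * (Dg g t x v \<bullet> h)) = (\<lambda>h. h \<bullet> (p v* Df f t x v + lam *\<^sub>R Dg g t x v))"
    by (simp add: inner_add_right inner_vector_matrix[symmetric] inner_commute)
  ultimately show "((\<lambda>y. hamiltonian f g y t v lam p) has_derivative (\<lambda>h. h \<bullet> (p v* Df f t x v + lam *\<^sub>R Dg g t x v))) (at x)"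
    by simp
qed

lemma costate_0: "costate q 0 = q"
  using costate_A[of 0 q] by (simp add: A_0 I_0)

end

lemma loc_abs_cont_continuous:
  fixes x :: "real \<Rightarrow> 'a::real_normed_vector"
  assumes "loc_abs_cont x"
  shows "continuous_on {0..} x"
  unfolding continuous_on_eq_continuous_within
proof
  fix t :: real assume t: "t \<in> {0..}"
  have "continuous_on {0..t + 1} x"
    using assms t by (intro abs_cont_on_imp_continuous_on) (simp add: loc_abs_cont_def)
  then have "continuous (at t within {0..t + 1}) x" using t by (simp add: continuous_on_eq_continuous_within)
  moreover have "at t within {0..t + 1} = at t within {0..}"
    by (rule at_within_nhd[of t "{..<t + 1}"]) (use t in auto)
  ultimately show "continuous (at t within {0..}) x" by simp
qed

theorem theorem3:
  fixes U :: "real \<Rightarrow> 'u::euclidean_space set"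
    and f :: "real \<Rightarrow> real ^ 'm \<Rightarrow> 'u \<Rightarrow> real ^ 'm"
    and g :: "real \<Rightarrow> real ^ 'm \<Rightarrow> 'u \<Rightarrow> real"
    and \<tau> :: "nat \<Rightarrow> real"
    and x0 :: "real \<Rightarrow> real ^ 'm"
    and u0 :: "real \<Rightarrow> 'u"
    and \<phi> :: "(real \<Rightarrow> 'u) \<Rightarrow> real \<Rightarrow> real ^ 'm"
    and J :: "real \<Rightarrow> (real \<Rightarrow> 'u) \<Rightarrow> real"
    and X :: "real ^ 'm \<Rightarrow> real \<Rightarrow> real ^ 'm"
    and A :: "real ^ 'm \<Rightarrow> real \<Rightarrow> real ^ 'm ^ 'm"
    and I :: "real ^ 'm \<Rightarrow> real \<Rightarrow> real ^ 'm"
    and I_star :: "real ^ 'm"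
  assumes u_sigma: "cond_u_sigma U u0"
    and fg: "cond_fg U f g"
    and partial: "cond_partial U f g"
    and phi: "\<And>u. u \<in> selectors U \<Longrightarrow> ode_solution (\<lambda>t y. f t y (u t)) 0 (\<phi> u)"
    and J: "\<And>u T. u \<in> selectors U \<Longrightarrow> T \<ge> 0 \<Longrightarrow>
              has_bochner_integral (lebesgue_on {0..T}) (\<lambda>t. g t (\<phi> u t) (u t)) (J T u)"
    and tau_nonneg: "\<And>n. \<tau> n \<ge> 0"
    and tau_mono: "mono \<tau>"
    and tau_unbounded: "\<not> bdd_above (range \<tau>)"
    and optimal: "sporadically_catching_up_optimal U \<phi> J \<tau> x0 u0"
    and X: "\<And>\<xi>. ode_solution (\<lambda>t y. f t y (u0 t)) \<xi> (X \<xi>)"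
    and A: "\<And>\<xi>. ode_solution (\<lambda>t M. Df f t (X \<xi> t) (u0 t) ** M) (mat 1) (A \<xi>)"
    and I: "\<And>\<xi> T. T \<ge> 0 \<Longrightarrow>
              has_bochner_integral (lebesgue_on {0..T})
                (\<lambda>t. Dg g t (X \<xi> t) (u0 t) v* A \<xi> t) (I \<xi> T)"
    and I_star: "((\<lambda>(n, \<xi>). I \<xi> (\<tau> n)) \<longlongrightarrow> I_star) (sequentially \<times>\<^sub>F at 0)"
  shows "\<exists>lam0 \<psi>0.
           (x0, u0, lam0, \<psi>0) \<in> max_principle_solutions U f g \<and>
           liminf (\<lambda>n. ereal (norm (\<psi>0 (\<tau> n) v* A 0 (\<tau> n)))) = 0 \<and>
           (\<forall>lam \<psi>. (x0, u0, lam, \<psi>) \<in> max_principle_solutions U f g \<longrightarrow>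
                liminf (\<lambda>n. ereal (norm (\<psi> (\<tau> n) v* A 0 (\<tau> n)))) = 0 \<longrightarrow>
                lam = lam0 \<and> (\<forall>t\<ge>0. \<psi> t = \<psi>0 t)) \<and>
           (\<exists>c>0. c * lam0 = 1 \<and>
              (\<forall>T\<ge>0. c *\<^sub>R \<psi>0 T =
                 (I_star - integral\<^sup>L (lebesgue_on {0..T})
                    (\<lambda>t. Dg g t (x0 t) (u0 t) v* A 0 t)) v* matrix_inv (A 0 T)))"
proof -
  have u0: "u0 \<in> selectors U" and x0: "\<And>t. 0 \<le> t \<Longrightarrow> x0 t = \<phi> u0 t"
    and opt: "\<exists>\<omega>\<in>vanishing_functions. \<forall>u\<in>selectors U. \<forall>k n. k < n \<longrightarrow> J (\<tau> n) u0 \<ge> J (\<tau> n) u - \<omega> (\<tau> k)"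
    using optimal unfolding sporadically_catching_up_optimal_def by blast+
  have gr: "graph U \<in> sets borel" using u_sigma by (simp add: cond_u_sigma_def)
  interpret optimal_control_system U f g u0 \<phi> J X A I \<tau> I_star
    by unfold_locales (fact fg partial u0 phi J X A I gr tau_nonneg tau_mono tau_unbounded opt I_star)+
  have xX: "x0 t = X 0 t" if "0 \<le> t" for t using x0[OF that] phi_u0[OF that] by simp
  \<comment> \<open>Division by \<open>c\<close> turns \<open>costate I_star\<close> and the multiplier \<open>1\<close> into a pair with \<open>norm (\<psi> 0) + lam = 1\<close>.\<close>
  define c where "c = 1 + norm I_star"
  have c: "0 < c" by (simp add: c_def add_pos_nonneg)
  define \<psi>0 where "\<psi>0 t = inverse c *\<^sub>R costate I_star t" for t
  have \<psi>0ac: "loc_abs_cont \<psi>0"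
    unfolding loc_abs_cont_def \<psi>0_def
    by (intro allI impI abs_cont_on_bounded_linear[OF bounded_linear_scaleR_right] costate_abs_cont)
  have x0ac: "loc_abs_cont x0"
    unfolding loc_abs_cont_def
  proof (intro allI impI)
    fix T :: real assume "0 \<le> T"
    have "abs_cont_on {0..T} (X 0)" using X_ode[OF order_refl, of T 0] by (simp add: ode_on_def)
    then show "abs_cont_on {0..T} x0" by (rule abs_cont_on_cong) (simp add: xX)
  qed
  have AE_x: "AE t in lebesgue_on {0..}. (x0 has_vector_derivative f t (x0 t) (u0 t)) (at t)"
  proof (rule AE_halfline_negligible)
    fix n :: nat
    obtain N where N: "negligible N" "\<forall>t\<in>{0<..<real (Suc n)} - N. (X 0 has_vector_derivative f t (X 0 t) (u0 t)) (at t)"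
      using X_ode[OF order_refl, of "real (Suc n)" 0] by (auto simp: ode_on_def)
    have "(x0 has_vector_derivative f t (x0 t) (u0 t)) (at t)" if t: "t \<in> {0<..<real (Suc n)} - N" for t
      by (rule has_vector_derivative_transform_within_open[of "X 0" _ t "{0<..}"])
         (use t N(2) in \<open>auto simp: xX\<close>)
    with N(1) show "\<exists>N. negligible N \<and> (\<forall>t\<in>{0<..<real (Suc n)} - N. (x0 has_vector_derivative f t (x0 t) (u0 t)) (at t))" by blast
  qed
  have AE_\<psi>: "AE t in lebesgue_on {0..}. (\<psi>0 has_vector_derivative
      - gradient (\<lambda>y. hamiltonian f g y t (u0 t) (inverse c) (\<psi>0 t)) (x0 t)) (at t)"
  proof (rule AE_halfline_negligible)
    fix n :: nat
    obtain N where N: "negligible N" "\<forall>t\<in>{0<..<real (Suc n)} - N. (costate I_star has_vector_derivative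
         - (costate I_star t v* Df f t (X 0 t) (u0 t) + Dg g t (X 0 t) (u0 t))) (at t)"
      using costate_derivative[of "real (Suc n)" I_star] by auto
    have "(\<psi>0 has_vector_derivative - gradient (\<lambda>y. hamiltonian f g y t (u0 t) (inverse c) (\<psi>0 t)) (x0 t)) (at t)"
      if t: "t \<in> {0<..<real (Suc n)} - N" for t
    proof -
      have "(\<psi>0 has_vector_derivative inverse c *\<^sub>R - (costate I_star t v* Df f t (X 0 t) (u0 t) + Dg g t (X 0 t) (u0 t))) (at t)"
        unfolding \<psi>0_def by (rule bounded_linear.has_vector_derivative[OF bounded_linear_scaleR_right N(2)[rule_format, OF t]])
      moreover have "gradient (\<lambda>y. hamiltonian f g y t (u0 t) (inverse c) (\<psi>0 t)) (x0 t)
         = inverse c *\<^sub>R (costate I_star t v* Df f t (X 0 t) (u0 t) + Dg g t (X 0 t) (u0 t))"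
        using t by (simp add: hamiltonian_gradient xX \<psi>0_def scaleR_right_distrib
            bounded_bilinear.scaleR_left[OF bounded_bilinear_vector_matrix])
      ultimately show ?thesis by (simp only: scaleR_minus_right)
    qed
    with N(1) show "\<exists>N. negligible N \<and> (\<forall>t\<in>{0<..<real (Suc n)} - N. (\<psi>0 has_vector_derivative
      - gradient (\<lambda>y. hamiltonian f g y t (u0 t) (inverse c) (\<psi>0 t)) (x0 t)) (at t))" by blast
  qed
  have AE_H: "AE t in lebesgue_on {0..}. (SUP p\<in>U t. hamiltonian f g (x0 t) t p (inverse c) (\<psi>0 t))
      = hamiltonian f g (x0 t) t (u0 t) (inverse c) (\<psi>0 t)"
    unfolding AE_lebesgue_on_halfline using hamiltonian_maximised
  proof eventually_elim
    case (elim t)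
    show ?case
    proof
      assume t: "0 \<le> t"
      have h: "hamiltonian f g (x0 t) t p (inverse c) (\<psi>0 t) = inverse c * H t p" for p
        using t by (simp add: hamiltonian_def \<psi>0_def xX distrib_left)
      have "(SUP p\<in>U t. inverse c * H t p) = inverse c * H t (u0 t)"
        using elim t u0_in[OF t] c by (intro cSup_eq_maximum) auto
      then show "(SUP p\<in>U t. hamiltonian f g (x0 t) t p (inverse c) (\<psi>0 t)) = hamiltonian f g (x0 t) t (u0 t) (inverse c) (\<psi>0 t)"
        by (simp only: h)
    qed
  qed
  have mem: "(x0, u0, inverse c, \<psi>0) \<in> max_principle_solutions U f g"
  proof -
    have "inverse c \<in> {0..1}" by (simp add: c_def inverse_eq_divide divide_le_eq add_pos_nonneg)
    moreover have "norm (\<psi>0 0) + inverse c = 1"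
    proof -
      have "norm (\<psi>0 0) + inverse c = inverse c * c" using c by (simp add: \<psi>0_def costate_0 c_def algebra_simps)
      then show ?thesis using c by simp
    qed
    moreover have "x0 0 = 0" using xX[of 0] by (simp add: X_0)
    moreover have "AE t in lebesgue_on {0..}. (x0 has_vector_derivative f t (x0 t) (u0 t)) (at t) \<and>
        (\<psi>0 has_vector_derivative - gradient (\<lambda>y. hamiltonian f g y t (u0 t) (inverse c) (\<psi>0 t)) (x0 t)) (at t) \<and>
        (SUP p\<in>U t. hamiltonian f g (x0 t) t p (inverse c) (\<psi>0 t)) = hamiltonian f g (x0 t) t (u0 t) (inverse c) (\<psi>0 t)"
      using AE_x AE_\<psi> AE_H by eventually_elim simp
    ultimately show ?thesis
      unfolding max_principle_solutions_def
      using u0 x0ac \<psi>0ac loc_abs_cont_continuous[OF x0ac] loc_abs_cont_continuous[OF \<psi>0ac] by (simp add: C_loc_def)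
  qed
  have trans: "liminf (\<lambda>n. ereal (norm (\<psi>0 (\<tau> n) v* A 0 (\<tau> n)))) = 0"
  proof -
    have eq: "\<psi>0 (\<tau> n) v* A 0 (\<tau> n) = inverse c *\<^sub>R (I_star - I 0 (\<tau> n))" for n
      using costate_A[OF tau_nonneg, of I_star n]
      by (simp add: \<psi>0_def bounded_bilinear.scaleR_left[OF bounded_bilinear_vector_matrix])
    have "(\<lambda>n. norm (inverse c *\<^sub>R (I_star - I 0 (\<tau> n)))) \<longlonglongrightarrow> norm (inverse c *\<^sub>R (I_star - I_star))"
      by (intro tendsto_intros I_tendsto)
    then have "(\<lambda>n. ereal (norm (\<psi>0 (\<tau> n) v* A 0 (\<tau> n)))) \<longlonglongrightarrow> ereal 0" by (simp add: eq)
    from lim_imp_Liminf[OF _ this] show ?thesis by (simp add: zero_ereal_def)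
  qed
  have uniq: "lam = inverse c \<and> (\<forall>t\<ge>0. \<psi> t = \<psi>0 t)"
    if m: "(x0, u0, lam, \<psi>) \<in> max_principle_solutions U f g"
      and l: "liminf (\<lambda>n. ereal (norm (\<psi> (\<tau> n) v* A 0 (\<tau> n)))) = 0" for lam \<psi>
  proof -
    have m': "0 \<le> lam" "norm (\<psi> 0) + lam = 1" "loc_abs_cont \<psi>"
      "AE t in lebesgue_on {0..}. (\<psi> has_vector_derivative
              - gradient (\<lambda>y. hamiltonian f g y t (u0 t) lam (\<psi> t)) (x0 t)) (at t)"
      using m by (auto simp: max_principle_solutions_def elim: eventually_mono)
    obtain N where N: "negligible N" "\<And>t. 0 \<le> t \<Longrightarrow> t \<notin> N \<Longrightarrow> (\<psi> has_vector_derivative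
              - gradient (\<lambda>y. hamiltonian f g y t (u0 t) lam (\<psi> t)) (x0 t)) (at t)"
      using m'(4) by (subst (asm) AE_lebesgue_on_iff_negligible) auto
    have sol: "\<psi> T v* A 0 T = \<psi> 0 - lam *\<^sub>R I 0 T" if T: "0 \<le> T" for T
    proof (rule adjoint_solution[OF T _ N(1)])
      show "abs_cont_on {0..T} \<psi>" using m'(3) T by (simp add: loc_abs_cont_def)
      fix t assume "t \<in> {0<..<T} - N"
      then show "(\<psi> has_vector_derivative - (\<psi> t v* Df f t (X 0 t) (u0 t) + lam *\<^sub>R Dg g t (X 0 t) (u0 t))) (at t)"
        using N(2)[of t] by (simp add: hamiltonian_gradient xX)
    qed
    have "(\<lambda>n. norm (\<psi> 0 - lam *\<^sub>R I 0 (\<tau> n))) \<longlonglongrightarrow> norm (\<psi> 0 - lam *\<^sub>R I_star)"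
      by (intro tendsto_intros I_tendsto)
    then have "(\<lambda>n. ereal (norm (\<psi> (\<tau> n) v* A 0 (\<tau> n)))) \<longlonglongrightarrow> ereal (norm (\<psi> 0 - lam *\<^sub>R I_star))"
      by (simp add: sol tau_nonneg)
    from lim_imp_Liminf[OF _ this] l have "ereal (norm (\<psi> 0 - lam *\<^sub>R I_star)) = 0" by simp
    then have \<psi>00: "\<psi> 0 = lam *\<^sub>R I_star" by simp
    then have "lam * c = 1" using m'(1,2) by (simp add: c_def algebra_simps)
    then have lam: "lam = inverse c" using c by (simp add: field_simps)
    have "\<psi> t = \<psi>0 t" if t: "0 \<le> t" for t
    proof -
      have "\<psi> t = (\<psi> t v* A 0 t) v* matrix_inv (A 0 t)" by (simp add: vector_matrix_mul_assoc A_inverse[OF t])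
      also have "\<psi> t v* A 0 t = lam *\<^sub>R (I_star - I 0 t)" by (simp add: sol[OF t] \<psi>00 scaleR_right_diff_distrib)
      finally show ?thesis
        by (simp add: \<psi>0_def costate_def lam bounded_bilinear.scaleR_left[OF bounded_bilinear_vector_matrix])
    qed
    with lam show ?thesis by blast
  qed
  have form: "c *\<^sub>R \<psi>0 T = (I_star - integral\<^sup>L (lebesgue_on {0..T}) (\<lambda>t. Dg g t (x0 t) (u0 t) v* A 0 t)) v* matrix_inv (A 0 T)"
    if T: "0 \<le> T" for T
  proof -
    have "integral\<^sup>L (lebesgue_on {0..T}) (\<lambda>t. Dg g t (x0 t) (u0 t) v* A 0 t) = integral\<^sup>L (lebesgue_on {0..T}) (payoff_gradient 0)"
      by (rule Bochner_Integration.integral_cong) (auto simp: xX)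
    also have "\<dots> = I 0 T" using I[OF T, of 0] by (simp add: has_bochner_integral_iff)
    finally show ?thesis using c by (simp add: \<psi>0_def costate_def)
  qed
  show ?thesis
  proof (intro exI conjI)
    show "(x0, u0, inverse c, \<psi>0) \<in> max_principle_solutions U f g" by (rule mem)
    show "liminf (\<lambda>n. ereal (norm (\<psi>0 (\<tau> n) v* A 0 (\<tau> n)))) = 0" by (rule trans)
    show "\<forall>lam \<psi>. (x0, u0, lam, \<psi>) \<in> max_principle_solutions U f g \<longrightarrow>
        liminf (\<lambda>n. ereal (norm (\<psi> (\<tau> n) v* A 0 (\<tau> n)))) = 0 \<longrightarrow>
        lam = inverse c \<and> (\<forall>t\<ge>0. \<psi> t = \<psi>0 t)"
      by (intro allI impI) (rule uniq)
    show "c > 0" by (rule c)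
    show "c * inverse c = 1" using c by simp
    show "\<forall>T\<ge>0. c *\<^sub>R \<psi>0 T = (I_star - integral\<^sup>L (lebesgue_on {0..T})
        (\<lambda>t. Dg g t (x0 t) (u0 t) v* A 0 t)) v* matrix_inv (A 0 T)"
      by (intro allI impI) (rule form)
  qed
qed

end
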